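(* For a simplicial complex $\mathcal K$, the following conditions are equivalent: (a) all full subcomplexes of $\mathcal K$ are homotopy discrete sets of points (i.e. homotopy equivalent to discrete sets of points); (b) $\mathcal K$ is flag and its one-skeleton $\mathrm{sk}^1(\mathcal K)$ is a chordal graph; (c) $\mathcal K$ can be obtained by iterating the procedure of attaching a simplex along a (possibly empty) face, starting from a simplex. Each of these conditions implies that $\mathcal K$ is either a simplex, or $$\mathit{HH}^{-k,2\ell}(\mathcal Z_{\mathcal K})=\begin{cases}\mathbb Z&\text{for }(-k,2\ell)=(0,0),\ (-1,4);\\ 0&\text{otherwise.}\end{cases}$$
   Context: A simplicial complex $\mathcal K$ on the vertex set $[m]=\{1,\dots,m\}$, $m\ge1$, is a collection of subsets of $[m]$ closed under passing to subsets and containing $\varnothing$ and all singletons. $\mathcal K$ is a simplex if every subset of its vertex set is in $\mathcal K$. For $I\subset[m]$ the full subcomplex is $\mathcal K_I=\{J\in\mathcal K: J\subset I\}$. $\mathcal K$ is flag if every set of vertices that are pairwise joined by edges is a simplex of $\mathcal K$; a graph is chordal if every cycle of length at least $4$ has a chord. Attaching a simplex along a face: passing from $\mathcal K'$ to $\mathcal K'\cup_\sigma\Delta^n$, where $\sigma$ is a (possibly empty) simplex of $\mathcal K'$ identified with a face of $\Delta^n$, and the intersection of $\mathcal K'$ and $\Delta^n$ consists of $\sigma$ and its faces. All (co)homology has $\mathbb Z$ coefficients; $\widetilde H^*$ is reduced simplicial cohomology, with $\widetilde H^{-1}(\mathcal K_\varnothing)=\mathbb Z$. Moment-angle complex: $\mathcal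 Z_{\mathcal K}=\bigcup_{I\in\mathcal K}\{z\in(D^2)^m: |z_j|=1\text{ if }j\notin I\}$. Its cohomology has the bigraded Hochster decomposition $H^{-k,2\ell}(\mathcal Z_{\mathcal K})=\bigoplus_{I\subset[m],|I|=\ell}\widetilde H^{\ell-k-1}(\mathcal K_I)$, of total degree $-k+2\ell$. Double cohomology: for $i\in I$ let $\psi_{p;i,I}:\widetilde H^p(\mathcal K_I)\to\widetilde H^p(\mathcal K_{I\setminus\{i\}})$ be induced by inclusion, let $\varepsilon(i,I)=(-1)^{\#\{r\in I: r<i\}}$, and define $d'$ on $\widetilde H^p(\mathcal K_I)$ by $d'=(-1)^{p+1}\sum_{i\in I}\varepsilon(i,I)\psi_{p;i,I}$. Then $d':H^{-k,2\ell}(\mathcal Z_{\mathcal K})\to H^{-k+1,2\ell-2}(\mathcal Z_{\mathcal K})$, $(d')^2=0$, and $\mathit{HH}^{-k,2\ell}(\mathcal Z_{\mathcal K})$ denotes the cohomology of $(H^*(\mathcal Z_{\mathcal K}),d')$ at bidegree $(-k,2\ell)$. *)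

theory Defs
  imports "HOL-Homology.Homology"
begin

section \<open>Finite abstract simplicial complexes\<close>

definition abstract_complex :: "'a set \<Rightarrow> 'a set set \<Rightarrow> bool" where
  "abstract_complex V K \<longleftrightarrow>
     finite V \<and> K \<subseteq> Pow V \<and> {} \<in> K \<and> (\<forall>v\<in>V. {v} \<in> K) \<and>
     (\<forall>J\<in>K. \<forall>I. I \<subseteq> J \<longrightarrow> I \<in> K)"

definition is_simplex_on :: "'a set \<Rightarrow> 'a set set \<Rightarrow> bool" where
  "is_simplex_on V K \<longleftrightarrow> (\<forall>J. J \<subseteq> V \<longrightarrow> J \<in> K)"

definition full_subcomplex :: "'a set set \<Rightarrow> 'a set \<Rightarrow> 'a set set" where
  "full_subcomplex K I = {J \<in> K. J \<subseteq> I}"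

definition flag_complex :: "'a set \<Rightarrow> 'a set set \<Rightarrow> bool" where
  "flag_complex V K \<longleftrightarrow>
     (\<forall>S. S \<subseteq> V \<and> (\<forall>u\<in>S. \<forall>v\<in>S. u \<noteq> v \<longrightarrow> {u, v} \<in> K) \<longrightarrow> S \<in> K)"

definition skeleton :: "nat \<Rightarrow> 'a set set \<Rightarrow> 'a set set" where
  "skeleton d K = {J \<in> K. card J \<le> Suc d}"

definition edges :: "'a set set \<Rightarrow> 'a set set" where
  "edges K = {J \<in> K. card J = 2}"

text \<open>A simple graph is given by its set of two-element edges. A cycle is the list of its
  distinct vertices in cyclic order, and its length is the number of vertices. A chord is an edge
  joining two vertices that are not neighbours on the cycle.\<close>

definition graph_cycle :: "'a set set \<Rightarrow> 'a list \<Rightarrow> bool" where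
  "graph_cycle E c \<longleftrightarrow>
     length c \<ge> 3 \<and> distinct c \<and>
     (\<forall>i<length c. {c ! i, c ! (Suc i mod length c)} \<in> E)"

definition has_chord :: "'a set set \<Rightarrow> 'a list \<Rightarrow> bool" where
  "has_chord E c \<longleftrightarrow>
     (\<exists>i<length c. \<exists>j<length c. i \<noteq> j \<and> j \<noteq> Suc i mod length c \<and> i \<noteq> Suc j mod length c \<and>
        {c ! i, c ! j} \<in> E)"

definition chordal :: "'a set set \<Rightarrow> bool" where
  "chordal E \<longleftrightarrow> (\<forall>c. graph_cycle E c \<and> length c \<ge> 4 \<longrightarrow> has_chord E c)"

text \<open>Here the glued simplex is the full simplex on \<open>T\<close>; the identification of \<open>\<sigma>\<close> with one of
  its faces is encoded by letting \<open>T\<close> share exactly the vertices of \<open>\<sigma>\<close> with the complex.\<close>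

inductive iterated_simplex_attachment :: "'a set set \<Rightarrow> bool" where
  simplex: "finite T \<Longrightarrow> T \<noteq> {} \<Longrightarrow> iterated_simplex_attachment (Pow T)"
| attach: "iterated_simplex_attachment K' \<Longrightarrow> \<sigma> \<in> K' \<Longrightarrow> finite T \<Longrightarrow> T \<noteq> {} \<Longrightarrow> \<sigma> \<subseteq> T \<Longrightarrow>
     K' \<inter> Pow T = Pow \<sigma> \<Longrightarrow> iterated_simplex_attachment (K' \<union> Pow T)"

section \<open>Geometric realization\<close>

text \<open>Points are barycentric coordinates supported on a simplex. The topology induced from the
  product topology is the usual one because only finite complexes are considered. The
  realization of \<open>{{}}\<close> is the empty space.\<close>

definition geometric_realization :: "'a set set \<Rightarrow> ('a \<Rightarrow> real) topology" where
  "geometric_realization K =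
     subtopology (powertop_real UNIV)
       {x. (\<forall>v. 0 \<le> x v) \<and> {v. x v \<noteq> 0} \<in> K \<and> (\<Sum>v | x v \<noteq> 0. x v) = 1}"

text \<open>Realizations of finite complexes are compact, so discrete spaces on subsets of \<open>nat\<close>
  are sufficient; the empty one is included.\<close>

definition homotopy_discrete :: "'a topology \<Rightarrow> bool" where
  "homotopy_discrete X \<longleftrightarrow> (\<exists>S :: nat set. X homotopy_equivalent_space discrete_topology S)"

section \<open>Reduced simplicial cohomology with integer coefficients\<close>

text \<open>The cohomology at \<open>B\<close> of \<open>A\<close> --\<open>f\<close>--> \<open>B\<close> --\<open>g\<close>--> \<open>C\<close>.\<close>

definition cohomology_at ::
  "('a, 'x) monoid_scheme \<Rightarrow> ('a \<Rightarrow> 'b) \<Rightarrow> 'b monoid \<Rightarrow> ('b \<Rightarrow> 'c) \<Rightarrow> ('c, 'y) monoid_scheme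
     \<Rightarrow> 'b set monoid" where
  "cohomology_at A f B g C = (B\<lparr>carrier := kernel B C g\<rparr>) Mod (f ` carrier A)"

text \<open>The sign \<open>\<epsilon>(i,I)\<close>; with vertices ordered increasingly it is also the incidence sign of the
  facet \<open>I - {i}\<close> of \<open>I\<close> in the simplicial coboundary.\<close>

definition eps :: "nat \<Rightarrow> nat set \<Rightarrow> int" where
  "eps i I = (-1) ^ card {r \<in> I. r < i}"

text \<open>The empty simplex has dimension \<open>-1\<close>; including it gives the augmented complex, hence
  reduced cohomology.\<close>

definition simplices :: "int \<Rightarrow> nat set set \<Rightarrow> nat set set" where
  "simplices p L = {J \<in> L. int (card J) = p + 1}"

definition cochain_group :: "int \<Rightarrow> nat set set \<Rightarrow> (nat set \<Rightarrow> int) monoid" where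
  "cochain_group p L = product_group (simplices p L) (\<lambda>_. integer_group)"

definition coboundary :: "int \<Rightarrow> nat set set \<Rightarrow> (nat set \<Rightarrow> int) \<Rightarrow> nat set \<Rightarrow> int" where
  "coboundary p L f = (\<lambda>J\<in>simplices (p + 1) L. \<Sum>j\<in>J. eps j J * f (J - {j}))"

definition coboundaries :: "int \<Rightarrow> nat set set \<Rightarrow> (nat set \<Rightarrow> int) set" where
  "coboundaries p L = coboundary (p - 1) L ` carrier (cochain_group (p - 1) L)"

definition reduced_cohomology :: "int \<Rightarrow> nat set set \<Rightarrow> (nat set \<Rightarrow> int) set monoid" where
  "reduced_cohomology p L =
     cohomology_at (cochain_group (p - 1) L) (coboundary (p - 1) L)
       (cochain_group p L) (coboundary p L) (cochain_group (p + 1) L)"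

text \<open>The map induced by the inclusion of a subcomplex \<open>M\<close>: the class of a cocycle \<open>f\<close> goes to
  the class of its restriction to the simplices of \<open>M\<close>. The cosets in the union coincide for all
  representatives \<open>f\<close> of the same class.\<close>

definition restriction_map ::
  "int \<Rightarrow> nat set set \<Rightarrow> (nat set \<Rightarrow> int) set \<Rightarrow> (nat set \<Rightarrow> int) set" where
  "restriction_map p M c =
     (\<Union>f\<in>c. coboundaries p M #>\<^bsub>cochain_group p M\<^esub> (restrict f (simplices p M)))"

definition psi ::
  "nat set set \<Rightarrow> int \<Rightarrow> nat \<Rightarrow> nat set \<Rightarrow> (nat set \<Rightarrow> int) set \<Rightarrow> (nat set \<Rightarrow> int) set" where
  "psi K p i I = restriction_map p (full_subcomplex K (I - {i}))"

section \<open>Double cohomology of the moment-angle complex\<close>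

text \<open>The arguments \<open>k\<close>, \<open>l\<close> stand for the bidegree \<open>(-k, 2l)\<close>. The bigraded cohomology of the
  moment-angle complex of \<open>K\<close> is taken in its Hochster form.\<close>

definition vertex_sets :: "nat \<Rightarrow> int \<Rightarrow> nat set set" where
  "vertex_sets m l = {I. I \<subseteq> {1..m} \<and> int (card I) = l}"

definition bigraded_cohomology ::
  "nat \<Rightarrow> nat set set \<Rightarrow> int \<Rightarrow> int \<Rightarrow> (nat set \<Rightarrow> (nat set \<Rightarrow> int) set) monoid" where
  "bigraded_cohomology m K k l =
     sum_group (vertex_sets m l) (\<lambda>I. reduced_cohomology (l - k - 1) (full_subcomplex K I))"

text \<open>The component of \<open>d' x\<close> at \<open>J\<close> collects the terms
  \<open>(-1)\<^sup>p\<^sup>+\<^sup>1 \<epsilon>(i,I) \<psi>\<^sub>p\<^sub>;\<^sub>i\<^sub>,\<^sub>I (x\<^sub>I)\<close> with \<open>i \<in> I\<close> and \<open>I - {i} = J\<close>, i.e. \<open>I = J \<union> {i}\<close>, where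
  \<open>p = l - k - 1\<close>. The cohomology groups are written multiplicatively. For \<open>p < -1\<close>, where
  \<open>nat\<close> truncates the exponent, they are trivial.\<close>

definition dprime ::
  "nat \<Rightarrow> nat set set \<Rightarrow> int \<Rightarrow> int \<Rightarrow> (nat set \<Rightarrow> (nat set \<Rightarrow> int) set)
     \<Rightarrow> (nat set \<Rightarrow> (nat set \<Rightarrow> int) set)" where
  "dprime m K k l x =
     (let p = l - k - 1; H = (\<lambda>J. reduced_cohomology p (full_subcomplex K J)) in
       (\<lambda>J\<in>vertex_sets m (l - 1).
          finprod (H J)
            (\<lambda>i. psi K p i (insert i J) (x (insert i J))
                   [^]\<^bsub>H J\<^esub> ((-1) ^ nat (p + 1) * eps i (insert i J)))
            ({1..m} - J)))"

definition double_cohomology ::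
  "nat \<Rightarrow> nat set set \<Rightarrow> int \<Rightarrow> int \<Rightarrow> (nat set \<Rightarrow> (nat set \<Rightarrow> int) set) set monoid" where
  "double_cohomology m K k l =
     cohomology_at
       (bigraded_cohomology m K (k + 1) (l + 1)) (dprime m K (k + 1) (l + 1))
       (bigraded_cohomology m K k l) (dprime m K k l)
       (bigraded_cohomology m K (k - 1) (l - 1))"

end

theory Submission
  imports Defs
begin

text \<open>The three conditions are proved equivalent along the circle (b), (c), (a), (b).

From (b) to (c): a chordal graph that is not complete has a vertex whose neighbours form a clique
(\<open>chordal_imp_simplicial_vertex\<close>, Dirac's theorem). For a flag complex this says that the complex
arises from the full subcomplex on the other vertices by attaching the simplex on that vertex and
its neighbours, along the simplex of the neighbours, and the full subcomplex is again flag with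
chordal graph.

From (c) to (a): attaching a simplex along a non-empty face does not change the homotopy type of
the realization, because the new barycentric coordinates can be pushed linearly onto a vertex of
the face (\<open>realization_collapse\<close>). Attaching along the empty face means adding an isolated point
and then attaching along that point. So only isolated points survive, and the class of iterated
attachments is closed under full subcomplexes.

From (a) to (b): if the complex is not flag, a minimal missing simplex spans a full subcomplex that
is the boundary of a simplex; if the graph is not chordal, a chordless cycle spans a full subcomplex
that is a cycle. Both realizations retract onto a sphere of positive dimension. A homotopy discrete
space has no such retract, since the retract would be connected and hence contractible.

For the double cohomology, let \<open>K\<close> satisfy the conditions without being a simplex. The reduced
cohomology of \<open>K\<^sub>I\<close> vanishes in positive degrees by a cone argument (\<open>attachment_acyclic\<close>), and in
degree \<open>-1\<close> it is \<open>\<int>\<close> for \<open>I = {}\<close>, which gives the class at \<open>(0,0)\<close>, and zero otherwise. What is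
left is degree \<open>0\<close>, where classes are locally constant functions on the vertices of \<open>K\<^sub>I\<close> modulo
constants and \<open>d'\<close> is an alternating sum of restrictions (\<open>koszul\<close>). Choose a vertex \<open>v\<close> whose
neighbours form a clique, and a vertex \<open>u\<close> that is not adjacent to \<open>v\<close>. Restriction from
\<open>I \<union> {v}\<close> to \<open>I\<close> is onto, so that a cocycle can be changed by a coboundary until it is supported
on the sets that contain \<open>v\<close>. On such a set \<open>J \<union> {v}\<close> it is then, modulo constants, a multiple of
the indicator function of \<open>v\<close>, and the multiple vanishes unless \<open>J\<close> avoids the neighbours of \<open>v\<close>.
These multiples form the simplicial chain complex of the full simplex on the non-neighbours of \<open>v\<close>,
which is contracted by the cone from \<open>u\<close>. Constants are divided out, and on a one-element set every
function is constant; therefore the chain complex is not augmented, and exactly one copy of \<open>\<int>\<close>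
survives, on the two-element sets (\<open>koszul_exact\<close>). It is detected by \<open>pair_sum\<close>.\<close>

section \<open>Simplicial vertices of chordal graphs\<close>

definition clique :: "'a set set \<Rightarrow> 'a set \<Rightarrow> bool" where
  "clique E S \<longleftrightarrow> (\<forall>x\<in>S. \<forall>y\<in>S. x \<noteq> y \<longrightarrow> {x, y} \<in> E)"

definition neighbours :: "'a set set \<Rightarrow> 'a set \<Rightarrow> 'a \<Rightarrow> 'a set" where
  "neighbours E U v = {x \<in> U. {v, x} \<in> E}"

lemma successively_shortcut:
  assumes p: "successively P p" and j: "j < length p" and i: "i < j"
    and adj: "P (p ! i) (p ! j)"
  shows "successively P (take (Suc i) p @ drop j p)"
proof -
  have "take (Suc i) p \<noteq> []" "drop j p \<noteq> []" using i j by auto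
  moreover have "last (take (Suc i) p) = p ! i"
    using i j by (simp add: take_Suc_conv_app_nth)
  moreover have "hd (drop j p) = p ! j" using j by (simp add: hd_drop_conv_nth)
  moreover have "successively P (take (Suc i) p)" "successively P (drop j p)"
    using p by (metis append_take_drop_id successively_append_iff)+
  ultimately show ?thesis using adj by (simp add: successively_append_iff)
qed

text \<open>A path of minimal length has no repeated vertex and no chord: either one would yield a shortcut.\<close>

lemma shortest_path_induced:
  fixes p0 :: "'a list"
  assumes ex: "successively P p0" "p0 \<noteq> []" "hd p0 = x" "last p0 = y" "set p0 \<subseteq> A"
  obtains p where "successively P p" "p \<noteq> []" "hd p = x" "last p = y" "set p \<subseteq> A" "distinct p"
    "\<And>i j. j < length p \<Longrightarrow> Suc i < j \<Longrightarrow> \<not> P (p ! i) (p ! j)"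
proof -
  define Q where "Q = (\<lambda>p. successively P p \<and> p \<noteq> [] \<and> hd p = x \<and> last p = y \<and> set p \<subseteq> A)"
  define p where "p = arg_min length Q"
  have "Q p0" using ex by (simp add: Q_def)
  then have Q: "Q p" and min: "\<And>q. Q q \<Longrightarrow> length p \<le> length q"
    unfolding p_def by (auto intro: arg_min_natI arg_min_nat_le)
  have cut: False if "j < length p" "i < j" "P (p ! i) (p ! j)" "Suc i < j" for i j
  proof -
    have "Q (take (Suc i) p @ drop j p)"
      unfolding Q_def
    proof (intro conjI)
      show "successively P (take (Suc i) p @ drop j p)"
        using that Q by (intro successively_shortcut) (auto simp: Q_def)
      show "set (take (Suc i) p @ drop j p) \<subseteq> A"
        using Q set_take_subset set_drop_subset by (fastforce simp: Q_def)
    qed (use that Q in \<open>auto simp: Q_def hd_append\<close>)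
    from min[OF this] show False using that by simp
  qed
  have dist: False if "j < length p" "i < j" "p ! i = p ! j" for i j
  proof -
    have "Q (take i p @ drop j p)"
      unfolding Q_def
    proof (intro conjI)
      have "successively P (take i p)" "successively P (drop j p)"
        using Q by (metis Q_def append_take_drop_id successively_append_iff)+
      moreover have "P (last (take i p)) (hd (drop j p))" if ne: "take i p \<noteq> []"
      proof -
        obtain i' where i': "i = Suc i'" using ne by (cases i) auto
        then have "last (take i p) = p ! i'" "hd (drop j p) = p ! i"
          using \<open>j < length p\<close> \<open>i < j\<close> \<open>p ! i = p ! j\<close>
          by (simp_all add: take_Suc_conv_app_nth hd_drop_conv_nth)
        moreover have "P (p ! i') (p ! Suc i')"
          using Q \<open>j < length p\<close> \<open>i < j\<close> i' by (simp add: Q_def successively_nth)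
        ultimately show ?thesis using i' by simp
      qed
      ultimately show "successively P (take i p @ drop j p)"
        by (auto simp: successively_append_iff)
      show "set (take i p @ drop j p) \<subseteq> A"
        using Q set_take_subset set_drop_subset by (fastforce simp: Q_def)
      show "hd (take i p @ drop j p) = x"
      proof (cases i)
        case 0
        have "p ! 0 = x" using Q by (metis Q_def hd_conv_nth)
          then show ?thesis using that 0 by (simp add: hd_drop_conv_nth)
      next
        case (Suc i')
        then show ?thesis using that Q by (simp add: Q_def hd_append)
      qed
    qed (use that Q in \<open>auto simp: Q_def\<close>)
    from min[OF this] show False using that by simp
  qed
  have "distinct p"
    unfolding distinct_conv_nth using dist by (metis linorder_neqE_nat)
  show thesis
  proof (rule that)
    show "\<not> P (p ! i) (p ! j)" if "j < length p" "Suc i < j" for i j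
      using cut[of j i] that by auto
  qed (use Q \<open>distinct p\<close> in \<open>auto simp: Q_def\<close>)
qed

text \<open>A vertex that is joined to the two ends of an induced path and to no interior vertex closes the path
to a cycle without chords. In this form chordality enters Dirac's theorem.\<close>

lemma chordless_cone_over_path:
  assumes "chordal E" and v: "v \<notin> set p" and path: "successively (\<lambda>a b. {a, b} \<in> E) p" "distinct p"
    and induced: "\<And>i j. j < length p \<Longrightarrow> Suc i < j \<Longrightarrow> {p ! i, p ! j} \<notin> E"
    and len: "length p \<ge> 3"
    and ends: "{v, hd p} \<in> E" "{last p, v} \<in> E"
    and interior: "\<And>i. 0 < i \<Longrightarrow> Suc i < length p \<Longrightarrow> {v, p ! i} \<notin> E"
  shows False
proof -
  let ?c = "v # p"
  have ne: "p \<noteq> []" using len by auto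
  have "graph_cycle E ?c"
    unfolding graph_cycle_def
  proof (intro conjI allI impI)
    fix i assume i: "i < length ?c"
    consider "i = 0" | j where "i = Suc j" "Suc j < length p" | j where "i = Suc j" "Suc j = length p"
      using i by (cases i) (auto simp: less_Suc_eq)
    then show "{?c ! i, ?c ! (Suc i mod length ?c)} \<in> E"
    proof cases
      case 1
      then show ?thesis using ends ne by (simp add: hd_conv_nth)
    next
      case 2
      then show ?thesis using successively_nth[OF path(1)] by simp
    next
      case 3
      then have "j = length p - 1" by simp
      then show ?thesis using 3 ends ne by (simp add: last_conv_nth)
    qed
  qed (use len v path in auto)
  moreover have "length ?c \<ge> 4" using len by simp
  ultimately have "has_chord E ?c" using \<open>chordal E\<close> by (auto simp: chordal_def)
  then obtain i j where ij: "i < length ?c" "j < length ?c" "i \<noteq> j" "j \<noteq> Suc i mod length ?c"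
     "i \<noteq> Suc j mod length ?c" "{?c ! i, ?c ! j} \<in> E"
    by (auto simp: has_chord_def)
  have key: False if "i < length ?c" "j < length ?c" "i < j" "j \<noteq> Suc i mod length ?c"
     "i \<noteq> Suc j mod length ?c" "{?c ! i, ?c ! j} \<in> E" for i j
  proof -
    obtain j' where j': "j = Suc j'" using \<open>i < j\<close> by (cases j) auto
    show False
    proof (cases i)
      case 0
      have "0 < j'" using that(4) j' 0 ne by (cases "j' = 0") (simp_all add: mod_Suc)
      moreover have "Suc j' < length p"
      proof (rule ccontr)
        assume "\<not> Suc j' < length p"
        then have "Suc j = length ?c" using that(2) j' by simp
        then show False using that(5) 0 by (metis mod_self)
      qed
      ultimately show False using interior[of j'] that 0 j' by auto
    next
      case (Suc i')
      then have "Suc i' \<noteq> j'" using that j' by auto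
      then show False using induced[of j' i'] that Suc j' by auto
    qed
  qed
  show False
  proof (cases "i < j")
    case True then show ?thesis using key[of i j] ij by blast
  next
    case False
    then have "{?c ! j, ?c ! i} \<in> E" "j < i" using ij by (auto simp: insert_commute)
    then show ?thesis using key[of j i] ij by blast
  qed
qed

lemma rtrancl_imp_path:
  assumes "(a, b) \<in> R\<^sup>*"
  shows "\<exists>p. p \<noteq> [] \<and> hd p = a \<and> last p = b \<and> successively (\<lambda>x y. (x, y) \<in> R) p \<and> set p \<subseteq> R\<^sup>* `` {a}"
  using assms
proof (induction rule: rtrancl_induct)
  case base
  then show ?case by (intro exI[of _ "[a]"]) auto
next
  case (step y z)
  then obtain p where p: "p \<noteq> []" "hd p = a" "last p = y" "successively (\<lambda>x y. (x, y) \<in> R) p"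
    "set p \<subseteq> R\<^sup>* `` {a}" by blast
  then show ?case using step
    by (intro exI[of _ "p @ [z]"]) (auto simp: successively_append_iff)
qed

text \<open>Dirac's theorem, in a form that supports induction: the simplicial vertex can be chosen away from
any vertex \<open>v\<close> that is not adjacent to all others. Let \<open>C\<close> be a component of the graph of all
vertices that are neither \<open>v\<close> nor adjacent to \<open>v\<close>, and let \<open>S\<close> be the set of its neighbours outside
\<open>C\<close>. Two non-adjacent elements of \<open>S\<close> would be joined by an induced path through \<open>C\<close>, which \<open>v\<close>
closes to a chordless cycle; so \<open>S\<close> is a clique. The induction hypothesis for \<open>C \<union> S\<close>, applied to a
vertex chosen so that the simplicial vertex cannot lie in \<open>S\<close>, gives a simplicial vertex in \<open>C\<close>. All
neighbours of a vertex of \<open>C\<close> lie in \<open>C \<union> S\<close>, so it is simplicial in the whole graph.\<close>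

lemma chordal_imp_simplicial_vertex:
  assumes "chordal E" and loopfree: "\<And>x. {x} \<notin> E"
    and "finite U" "v \<in> U" "u \<in> U" "u \<noteq> v" "{v, u} \<notin> E"
  shows "\<exists>w\<in>U. w \<noteq> v \<and> {v, w} \<notin> E \<and> clique E (neighbours E U w)"
  using assms(3-)
proof (induction "card U" arbitrary: U v u rule: less_induct)
  case less
  define A where "A = {x \<in> U. x \<noteq> v \<and> {v, x} \<notin> E}"
  define R where "R = {(x, y). x \<in> A \<and> y \<in> A \<and> {x, y} \<in> E}"
  define C where "C = R\<^sup>* `` {u}"
  define S where "S = {x \<in> U. {v, x} \<in> E \<and> (\<exists>c\<in>C. {c, x} \<in> E)}"
  have uA: "u \<in> A" using less.prems by (simp add: A_def)
  have CA: "C \<subseteq> A"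
  proof
    fix x assume "x \<in> C"
    then have "(u, x) \<in> R\<^sup>*" by (simp add: C_def)
    then show "x \<in> A" using uA by (induction rule: rtrancl_induct) (auto simp: R_def)
  qed
  have symR: "sym R" by (auto simp: R_def sym_def insert_commute)
  have nbC: "x \<in> C \<union> S" if "c \<in> C" "x \<in> U" "{c, x} \<in> E" for c x
  proof -
    have "x \<noteq> v" using that CA by (auto simp: A_def insert_commute)
    show ?thesis
    proof (cases "{v, x} \<in> E")
      case True then show ?thesis using that by (auto simp: S_def)
    next
      case False
      then have "(c, x) \<in> R" using that CA \<open>x \<noteq> v\<close> by (auto simp: R_def A_def)
      then show ?thesis using that by (auto simp: C_def intro: rtrancl_into_rtrancl)
    qed
  qed
  have cliqueS: "clique E S"
    unfolding clique_def
  proof (intro ballI impI, rule ccontr)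
    fix x y assume xy: "x \<in> S" "y \<in> S" "x \<noteq> y" "{x, y} \<notin> E"
    obtain a b where ab: "a \<in> C" "{a, x} \<in> E" "b \<in> C" "{b, y} \<in> E"
      using xy by (auto simp: S_def)
    have "(a, u) \<in> R\<^sup>*" using ab(1) symR by (metis C_def Image_singleton_iff symD sym_rtrancl)
    moreover have "(u, b) \<in> R\<^sup>*" using ab by (simp add: C_def)
    ultimately have "(a, b) \<in> R\<^sup>*" by simp
    then obtain q where q: "q \<noteq> []" "hd q = a" "last q = b" "successively (\<lambda>x y. (x, y) \<in> R) q"
      "set q \<subseteq> R\<^sup>* `` {a}" using rtrancl_imp_path by metis
    have qC: "set q \<subseteq> C"
      using q(5) ab(1) by (auto simp: C_def intro: rtrancl_trans)
    have "successively (\<lambda>x y. {x, y} \<in> E) q"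
      using q(4) by (rule successively_mono) (auto simp: R_def)
    then have "successively (\<lambda>x y. {x, y} \<in> E) (x # q @ [y])"
      using q ab by (auto simp: successively_append_iff successively_Cons insert_commute)
    then obtain p where p: "successively (\<lambda>x y. {x, y} \<in> E) p" "p \<noteq> []" "hd p = x" "last p = y"
      "set p \<subseteq> C \<union> {x, y}" "distinct p"
      "\<And>i j. j < length p \<Longrightarrow> Suc i < j \<Longrightarrow> {p ! i, p ! j} \<notin> E"
      by (rule shortest_path_induced[where x = x and y = y and A = "C \<union> {x, y}"]) (use qC in auto)
    have vS: "v \<notin> S" using loopfree by (auto simp: S_def)
    show False
    proof (rule chordless_cone_over_path[OF \<open>chordal E\<close> _ p(1,6,7)])
      show "v \<notin> set p" using p(5) CA xy vS by (auto simp: A_def)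
      show "length p \<ge> 3"
      proof (rule ccontr)
        assume "\<not> length p \<ge> 3"
        moreover have "length p \<noteq> 0" using p(2) by simp
        ultimately consider "length p = 1" | "length p = 2" by linarith
        then show False
        proof cases
          case 1
          then obtain z where "p = [z]" by (auto simp: length_Suc_conv)
          then show False using p xy by auto
        next
          case 2
          then obtain z z' where "p = [z, z']" by (auto simp: length_Suc_conv numeral_2_eq_2)
          then show False using p xy by auto
        qed
      qed
      show "{v, hd p} \<in> E" "{last p, v} \<in> E"
        using p xy by (auto simp: S_def insert_commute)
      fix i assume i: "0 < i" "Suc i < length p"
      have "p ! i \<noteq> p ! 0" "p ! i \<noteq> p ! (length p - 1)"
        proof -
        have "i < length p" "0 < length p" "length p - 1 < length p" "i \<noteq> 0" "i \<noteq> length p - 1"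
          using i by linarith+
        then show "p ! i \<noteq> p ! 0" "p ! i \<noteq> p ! (length p - 1)"
          using nth_eq_iff_index_eq[OF p(6)] by blast+
      qed
      then have "p ! i \<noteq> x" "p ! i \<noteq> y"
        using p(2,3,4) by (auto simp: hd_conv_nth last_conv_nth)
      moreover have "p ! i \<in> set p" using i(2) by simp
      ultimately have "p ! i \<in> C" using p(5) by blast
      then show "{v, p ! i} \<notin> E" using CA by (auto simp: A_def)
    qed
  qed
  let ?H = "C \<union> S"
  have HU: "?H \<subseteq> U" using CA by (auto simp: A_def S_def)
  have "v \<notin> ?H" using CA loopfree by (auto simp: A_def S_def)
  then have card: "card ?H < card U"
    using HU less.prems by (intro psubset_card_mono) auto
  have fin: "finite ?H" using HU less.prems finite_subset by blast
  have nbeq: "neighbours E U w = neighbours E ?H w" if "w \<in> C" for w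
    using nbC[OF that] HU by (auto simp: neighbours_def)
  have enough: ?case if w: "w \<in> C" "clique E (neighbours E ?H w)" for w
  proof (intro bexI conjI)
    show "w \<in> U" "w \<noteq> v" "{v, w} \<notin> E" using w(1) CA by (auto simp: A_def)
    show "clique E (neighbours E U w)" using w nbeq by simp
  qed
  show ?case
  proof (cases "\<exists>s\<in>S. \<exists>h\<in>?H. h \<noteq> s \<and> {s, h} \<notin> E")
    case True
    then obtain s h where s: "s \<in> S" "h \<in> ?H" "h \<noteq> s" "{s, h} \<notin> E" by blast
    obtain w where w: "w \<in> ?H" "w \<noteq> s" "{s, w} \<notin> E" "clique E (neighbours E ?H w)"
      using less.hyps[OF card fin, of s h] s by auto
    then have "w \<in> C" using cliqueS s by (auto simp: clique_def)
    then show ?thesis using enough w by blast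
  next
    case univ: False
    show ?thesis
    proof (cases "\<exists>c\<in>C. \<exists>h\<in>?H. h \<noteq> c \<and> {c, h} \<notin> E")
      case True
      then obtain c h where c: "c \<in> C" "h \<in> ?H" "h \<noteq> c" "{c, h} \<notin> E" by blast
      obtain w where w: "w \<in> ?H" "w \<noteq> c" "{c, w} \<notin> E" "clique E (neighbours E ?H w)"
        using less.hyps[OF card fin, of c h] c by auto
      moreover have "w \<notin> S"
      proof
        assume "w \<in> S"
        then have "{w, c} \<in> E" using univ c(1) w(2) by auto
        then show False using w(3) by (simp add: insert_commute)
      qed
      ultimately have "w \<in> C" by simp
      then show ?thesis using enough w by blast
    next
      case False
      then have "\<forall>x\<in>?H. \<forall>h\<in>?H. h \<noteq> x \<longrightarrow> {x, h} \<in> E" using univ by blast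
      then have "clique E ?H" unfolding clique_def by metis
      then have "clique E (neighbours E ?H u)" by (auto simp: clique_def neighbours_def)
      then show ?thesis using enough[of u] by (auto simp: C_def)
    qed
  qed
qed

lemma edge_skeleton_iff: "x \<noteq> y \<Longrightarrow> {x, y} \<in> edges (skeleton 1 K) \<longleftrightarrow> {x, y} \<in> K"
  by (auto simp: edges_def skeleton_def)

lemma loopfree_edges: "{x} \<notin> edges K"
  by (auto simp: edges_def)

lemma abstract_complexD:
  assumes "abstract_complex V K"
  shows "finite V" "J \<in> K \<Longrightarrow> J \<subseteq> V" "{} \<in> K" "v \<in> V \<Longrightarrow> {v} \<in> K" "J \<in> K \<Longrightarrow> I \<subseteq> J \<Longrightarrow> I \<in> K"
    "J \<in> K \<Longrightarrow> finite J"
proof -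
  show *: "J \<in> K \<Longrightarrow> J \<subseteq> V" and fin: "finite V"
    using assms unfolding abstract_complex_def by blast+
  show "{} \<in> K" "v \<in> V \<Longrightarrow> {v} \<in> K"
    using assms unfolding abstract_complex_def by blast+
  show "I \<in> K" if "J \<in> K" "I \<subseteq> J"
    using assms that unfolding abstract_complex_def by blast
  show "J \<in> K \<Longrightarrow> finite J" using finite_subset[OF * fin] .
qed

lemma flag_not_simplex_imp_nonedge:
  assumes K: "abstract_complex V K" and "flag_complex V K" and "\<not> is_simplex_on V K"
  obtains u v where "u \<in> V" "v \<in> V" "u \<noteq> v" "{u, v} \<notin> K"
proof -
  obtain J where J: "J \<subseteq> V" "J \<notin> K" using assms(3) by (auto simp: is_simplex_on_def)
  then have "\<not> (\<forall>u\<in>J. \<forall>v\<in>J. u \<noteq> v \<longrightarrow> {u, v} \<in> K)"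
    using assms(2) unfolding flag_complex_def by blast
  then show thesis using that J by blast
qed

text \<open>The neighbours \<open>N\<close> of a simplicial vertex \<open>w\<close> of the graph span, together with \<open>w\<close>, a simplex of the
flag complex, and this simplex contains every simplex through \<open>w\<close>. The witness \<open>u\<close> records that not
every vertex is adjacent to \<open>w\<close>.\<close>

lemma flag_chordal_split:
  assumes K: "abstract_complex V K" and flag: "flag_complex V K"
    and ch: "chordal (edges (skeleton 1 K))" and ns: "\<not> is_simplex_on V K"
  obtains w N u where "w \<in> V" "N \<subseteq> V - {w}" "insert w N \<in> K"
    "\<forall>J\<in>K. w \<in> J \<longrightarrow> J \<subseteq> insert w N" "u \<in> V" "u \<noteq> w" "u \<notin> N"
proof -
  let ?E = "edges (skeleton 1 K)"
  obtain u v where uv: "u \<in> V" "v \<in> V" "u \<noteq> v" "{u, v} \<notin> K"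
    using flag_not_simplex_imp_nonedge[OF K flag ns] .
  then have "{v, u} \<notin> ?E" using edge_skeleton_iff[of v u K] by (metis insert_commute)
  then obtain w where w: "w \<in> V" "w \<noteq> v" "{v, w} \<notin> ?E" "clique ?E (neighbours ?E V w)"
    using chordal_imp_simplicial_vertex[OF ch loopfree_edges abstract_complexD(1)[OF K] uv(2,1,3)] by auto
  let ?N = "neighbours ?E V w"
  have wN: "w \<notin> ?N" using loopfree_edges[of w "skeleton 1 K"] by (auto simp: neighbours_def)
  have Nsub: "?N \<subseteq> V - {w}" using wN by (auto simp: neighbours_def)
  have NK: "{w, x} \<in> K" if "x \<in> ?N" for x
  proof -
    have "w \<noteq> x" "{w, x} \<in> ?E" using that wN by (auto simp: neighbours_def)
    then show ?thesis using edge_skeleton_iff[of w x K] by blast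
  qed
  have cl: "{x, y} \<in> K" if "x \<in> ?N" "y \<in> ?N" "x \<noteq> y" for x y
    using w(4) that edge_skeleton_iff[of x y K] unfolding clique_def by blast
  have simp: "insert w ?N \<in> K"
  proof -
    have "\<forall>x\<in>insert w ?N. \<forall>y\<in>insert w ?N. x \<noteq> y \<longrightarrow> {x, y} \<in> K"
    proof (intro ballI impI)
      fix x y assume xy: "x \<in> insert w ?N" "y \<in> insert w ?N" "x \<noteq> y"
      consider "x = w" "y \<in> ?N" | "y = w" "x \<in> ?N" | "x \<in> ?N" "y \<in> ?N" using xy by blast
      then show "{x, y} \<in> K"
      proof cases
        case 2
        have "{w, x} \<in> K" by (rule NK[OF 2(2)])
        moreover have "{x, y} = {w, x}" using 2(1) by auto
        ultimately show ?thesis by simp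
      next
        case 1
        then show ?thesis using NK[OF 1(2)] by simp
      next
        case 3
        then show ?thesis using cl xy(3) by blast
      qed
    qed
    moreover have "insert w ?N \<subseteq> V" using Nsub w by auto
    ultimately show ?thesis using flag unfolding flag_complex_def by blast
  qed
  show thesis
  proof (rule that[of w ?N v])
    show "\<forall>J\<in>K. w \<in> J \<longrightarrow> J \<subseteq> insert w ?N"
    proof (intro ballI impI subsetI)
      fix J x assume J: "J \<in> K" "w \<in> J" and x: "x \<in> J"
      have "{w, x} \<in> K" "x \<in> V"
        using J x abstract_complexD(5)[OF K J(1), of "{w, x}"] abstract_complexD(2)[OF K J(1)] by auto
      then show "x \<in> insert w ?N" using edge_skeleton_iff[of w x K] unfolding neighbours_def by blast
    qed
  next
    show "v \<notin> ?N" using w by (auto simp: neighbours_def insert_commute)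
  qed (use w Nsub simp uv in auto)
qed

lemma full_subcomplex_complex:
  assumes "abstract_complex V K" "I \<subseteq> V"
  shows "abstract_complex I (full_subcomplex K I)"
proof -
  note D = abstract_complexD[OF assms(1)]
  have "finite I" using finite_subset[OF assms(2) D(1)] .
  then show ?thesis
    using D(3,4,5) assms(2) unfolding abstract_complex_def full_subcomplex_def by blast
qed

lemma full_subcomplex_flag:
  assumes "flag_complex V K" "I \<subseteq> V"
  shows "flag_complex I (full_subcomplex K I)"
  unfolding flag_complex_def full_subcomplex_def
proof (intro allI impI)
  fix S assume S: "S \<subseteq> I \<and> (\<forall>u\<in>S. \<forall>v\<in>S. u \<noteq> v \<longrightarrow> {u, v} \<in> {J \<in> K. J \<subseteq> I})"
  then have "S \<in> K" using assms unfolding flag_complex_def by (metis (no_types, lifting) dual_order.trans mem_Collect_eq)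
  then show "S \<in> {J \<in> K. J \<subseteq> I}" using S by auto
qed

lemma full_subcomplex_chordal:
  assumes "chordal (edges (skeleton 1 K))"
  shows "chordal (edges (skeleton 1 (full_subcomplex K I)))" (is "chordal ?E'")
  unfolding chordal_def
proof (intro allI impI)
  fix c assume c: "graph_cycle ?E' c \<and> 4 \<le> length c"
  have sub: "?E' = {e \<in> edges (skeleton 1 K). e \<subseteq> I}"
    by (auto simp: edges_def skeleton_def full_subcomplex_def)
  have "graph_cycle (edges (skeleton 1 K)) c"
    using c unfolding graph_cycle_def sub by blast
  then have "has_chord (edges (skeleton 1 K)) c"
    using assms c by (auto simp: chordal_def)
  moreover have "c ! i \<in> I" if "i < length c" for i
    using c that unfolding graph_cycle_def sub by blast
  ultimately show "has_chord ?E' c"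
    unfolding has_chord_def sub mem_Collect_eq by (metis empty_subsetI insert_subset)
qed

lemma flag_chordal_imp_attachment:
  assumes "abstract_complex V K" "V \<noteq> {}" "flag_complex V K" "chordal (edges (skeleton 1 K))"
  shows "iterated_simplex_attachment K"
  using assms
proof (induction "card V" arbitrary: V K rule: less_induct)
  case less
  note K = less.prems(1)
  note cD = abstract_complexD[OF K]
  show ?case
  proof (cases "is_simplex_on V K")
    case True
    then have "K = Pow V" using cD(2) by (auto simp: is_simplex_on_def)
    then show ?thesis using iterated_simplex_attachment.simplex[OF cD(1) less.prems(2)] by simp
  next
    case False
    obtain w N u where w: "w \<in> V" "N \<subseteq> V - {w}" "insert w N \<in> K"
      "\<forall>J\<in>K. w \<in> J \<longrightarrow> J \<subseteq> insert w N" "u \<in> V" "u \<noteq> w" "u \<notin> N"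
      using flag_chordal_split[OF K less.prems(3,4) False] by blast
    let ?K' = "full_subcomplex K (V - {w})"
    have att: "iterated_simplex_attachment ?K'"
    proof (rule less.hyps)
      show "card (V - {w}) < card V" using w(1) cD(1) by (rule card_Diff1_less[rotated])
      show "abstract_complex (V - {w}) ?K'"
        by (rule full_subcomplex_complex[OF K]) auto
      show "flag_complex (V - {w}) ?K'"
        by (rule full_subcomplex_flag[OF less.prems(3)]) auto
      show "chordal (edges (skeleton 1 ?K'))"
        by (rule full_subcomplex_chordal[OF less.prems(4)])
    qed (use w in auto)
    have eq: "K = ?K' \<union> Pow (insert w N)"
    proof (intro equalityI subsetI)
      fix J assume J: "J \<in> K"
      show "J \<in> ?K' \<union> Pow (insert w N)"
        using J w(4) cD(2)[OF J] by (auto simp: full_subcomplex_def)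
    next
      fix J assume "J \<in> ?K' \<union> Pow (insert w N)"
      then show "J \<in> K" using cD(5)[OF w(3)] by (auto simp: full_subcomplex_def)
    qed
    have N: "N \<in> K" using cD(5)[OF w(3)] by auto
    have "iterated_simplex_attachment (?K' \<union> Pow (insert w N))"
    proof (rule iterated_simplex_attachment.attach[OF att, of N])
      show "N \<in> ?K'" using N w by (auto simp: full_subcomplex_def)
      show "finite (insert w N)" using cD(6)[OF w(3)] .
      show "?K' \<inter> Pow (insert w N) = Pow N"
        using w(2) cD(5)[OF N] by (auto simp: full_subcomplex_def)
    qed auto
    then show ?thesis using eq by simp
  qed
qed

section \<open>Collapsing attached simplices\<close>

definition realization_points :: "'a set set \<Rightarrow> ('a \<Rightarrow> real) set" where
  "realization_points K =
     {x. (\<forall>v. 0 \<le> x v) \<and> {v. x v \<noteq> 0} \<in> K \<and> (\<Sum>v | x v \<noteq> 0. x v) = 1}"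

lemma geometric_realization_eq:
  "geometric_realization K = subtopology (powertop_real UNIV) (realization_points K)"
  by (simp add: geometric_realization_def realization_points_def)

lemma topspace_geometric_realization [simp]:
  "topspace (geometric_realization K) = realization_points K"
  by (simp add: geometric_realization_eq)

lemma realization_points_iff:
  assumes "finite F" "\<And>v. v \<notin> F \<Longrightarrow> x v = 0"
  shows "x \<in> realization_points K \<longleftrightarrow> (\<forall>v. 0 \<le> x v) \<and> {v. x v \<noteq> 0} \<in> K \<and> sum x F = 1"
proof -
  have "(\<Sum>v | x v \<noteq> 0. x v) = sum x F"
    using assms by (intro sum.mono_neutral_left) auto
  then show ?thesis by (simp add: realization_points_def)
qed

lemma continuous_map_realization_coordinate [continuous_intros]:
  "continuous_map (geometric_realization K) euclideanreal (\<lambda>x. x v)"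
  unfolding geometric_realization_eq
  by (intro continuous_map_from_subtopology continuous_map_product_projection) auto

lemma continuous_map_into_realization:
  assumes "\<And>v. continuous_map Z euclideanreal (\<lambda>z. h z v)"
    and "\<And>z. z \<in> topspace Z \<Longrightarrow> h z \<in> realization_points K"
  shows "continuous_map Z (geometric_realization K) h"
  unfolding geometric_realization_eq continuous_map_in_subtopology continuous_map_componentwise_UNIV
  using assms by auto

text \<open>Fix a vertex \<open>a\<close> of the face \<open>\<sigma>\<close> along which the simplex on \<open>T\<close> is attached. Moving all weight on
the new vertices \<open>T - \<sigma>\<close> onto \<open>a\<close> is a retraction onto the realization of \<open>L\<close>. The straight line from
a point to its image stays inside one simplex, so the retraction is homotopic to the identity.\<close>

theorem realization_collapse:
  assumes down: "\<And>J I. J \<in> L \<Longrightarrow> I \<subseteq> J \<Longrightarrow> I \<in> L"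
    and T: "finite T" and \<sigma>: "\<sigma> \<noteq> {}" "L \<inter> Pow T = Pow \<sigma>"
  shows "geometric_realization (L \<union> Pow T) homotopy_equivalent_space geometric_realization L"
proof -
  obtain a where a: "a \<in> \<sigma>" using \<sigma> by auto
  have \<sigma>T: "\<sigma> \<subseteq> T" "Pow \<sigma> \<subseteq> L" using \<sigma> by blast+
  define R where "R = T - \<sigma>"
  define r where "r = (\<lambda>(x :: 'a \<Rightarrow> real) v. if v \<in> R then 0 else if v = a then x a + sum x R else x v)"
  let ?X = "geometric_realization (L \<union> Pow T)" and ?Y = "geometric_realization L"
  have finR: "finite R" using T by (simp add: R_def)
  have RL: "v \<notin> J" if "v \<in> R" "J \<in> L" for v J
  proof
    assume "v \<in> J"
    then have "{v} \<in> L \<inter> Pow T" using down[OF that(2), of "{v}"] that(1) by (auto simp: R_def)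
    then show False using \<sigma> that by (auto simp: R_def)
  qed
  have r_id: "r x = x" if "{v. x v \<noteq> 0} \<in> L" for x
  proof -
    have "x v = 0" if "v \<in> R" for v using RL[OF that \<open>{v. x v \<noteq> 0} \<in> L\<close>] by auto
    then have "sum x R = 0" "\<And>v. v \<in> R \<Longrightarrow> x v = 0" by auto
    then show ?thesis by (auto simp: r_def)
  qed
  have aT: "a \<in> T" "a \<notin> R" using a \<sigma>T by (auto simp: R_def)
  have r_out: "r x v = 0" if "v \<notin> T" "{v. x v \<noteq> 0} \<subseteq> T" for x v
    using that aT by (auto simp: r_def)
  have r_sum: "sum (r x) T = sum x T" for x
  proof -
    have "T = insert a (T - R - {a}) \<union> R" using aT by (auto simp: R_def)
    then have split: "sum f T = f a + sum f (T - R - {a}) + sum f R" for f :: "'a \<Rightarrow> real"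
      using aT T finR
      by (metis (no_types, lifting) Diff_Diff_Int Diff_insert_absorb finite_Diff insert_Diff insert_iff
          sum.insert sum.subset_diff Diff_iff Diff_subset R_def)
    have "sum (r x) (T - R - {a}) = sum x (T - R - {a})" by (rule sum.cong) (auto simp: r_def)
    moreover have "sum (r x) R = 0" by (simp add: r_def)
    moreover have "r x a = x a + sum x R" using aT by (simp add: r_def)
    ultimately show ?thesis using split[of "r x"] split[of x] by simp
  qed
  define h where "h = (\<lambda>(t :: real, x) v. (1 - t) * r x v + t * x v)"
  have r_nonneg: "0 \<le> r x v" if "\<And>v. 0 \<le> x v" for x v
    using that by (auto simp: r_def sum_nonneg)
  have h_in: "h (t, x) \<in> realization_points (L \<union> Pow T)"
    if t: "0 \<le> t" "t \<le> 1" and x: "x \<in> realization_points (L \<union> Pow T)" for t x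
  proof (cases "{v. x v \<noteq> 0} \<in> L")
    case True
    then have "h (t, x) = x" by (simp add: h_def r_id algebra_simps)
    then show ?thesis using x by simp
  next
    case False
    then have sub: "{v. x v \<noteq> 0} \<subseteq> T" using x by (auto simp: realization_points_def)
    have x': "(\<forall>v. 0 \<le> x v)" "sum x T = 1"
      using realization_points_iff[OF T, of x "L \<union> Pow T"] x sub by blast+
    have out: "h (t, x) v = 0" if "v \<notin> T" for v
      using that sub r_out by (auto simp: h_def)
    show ?thesis
    proof (subst realization_points_iff[of T], intro T, rule out, simp, intro conjI allI)
      show "0 \<le> h (t, x) v" for v using x' t r_nonneg by (simp add: h_def)
      show "{v. h (t, x) v \<noteq> 0} \<in> L \<union> Pow T" using out by auto
      have "sum (h (t, x)) T = (1 - t) * sum (r x) T + t * sum x T"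
        by (simp add: h_def sum.distrib sum_distrib_left)
      then show "sum (h (t, x)) T = 1" using x' r_sum by simp
    qed
  qed
  have r_in: "r x \<in> realization_points L" if x: "x \<in> realization_points (L \<union> Pow T)" for x
  proof (cases "{v. x v \<noteq> 0} \<in> L")
    case True
    then show ?thesis using x by (simp add: r_id realization_points_def)
  next
    case False
    then have sub: "{v. x v \<noteq> 0} \<subseteq> T" using x by (auto simp: realization_points_def)
    have "{v. r x v \<noteq> 0} \<subseteq> \<sigma>"
      using sub a by (auto simp: r_def R_def split: if_splits)
    then have "{v. r x v \<noteq> 0} \<in> L" using \<sigma>T by auto
    moreover have "r x \<in> realization_points (L \<union> Pow T)"
      using h_in[of 0 x] x by (simp add: h_def)
    ultimately show ?thesis by (auto simp: realization_points_def)
  qed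
  have L_sub: "realization_points L \<subseteq> realization_points (L \<union> Pow T)"
    by (auto simp: realization_points_def)
  have r_cont: "continuous_map ?X euclideanreal (\<lambda>x. r x v)" for v
    unfolding r_def using finR by (auto intro!: continuous_intros)
  have "retraction_maps ?X ?Y r id"
    unfolding retraction_maps_def
  proof (intro conjI ballI)
    show "continuous_map ?X ?Y r"
      by (rule continuous_map_into_realization[OF r_cont]) (simp add: r_in)
    show "continuous_map ?Y ?X id"
      by (rule continuous_map_into_realization) (use L_sub in \<open>auto intro!: continuous_intros\<close>)
    show "r (id y) = y" if "y \<in> topspace ?Y" for y
      using that r_id by (simp add: realization_points_def)
  qed
  moreover have "homotopic_with (\<lambda>x. True) ?X ?X r id"
    unfolding homotopic_with_def
  proof (intro exI[of _ h] conjI allI ballI)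
    let ?P = "prod_topology (top_of_set {0..1::real}) ?X"
    show "continuous_map ?P ?X h"
    proof (rule continuous_map_into_realization)
      fix v
      have "continuous_map ?P euclideanreal fst"
        using continuous_map_fst continuous_map_into_fulltopology by blast
      moreover have "continuous_map ?P euclideanreal (\<lambda>z. r (snd z) v)"
        using continuous_map_compose[OF continuous_map_snd r_cont] by (simp add: o_def)
      moreover have "continuous_map ?P euclideanreal (\<lambda>z. snd z v)"
        using continuous_map_compose[OF continuous_map_snd continuous_map_realization_coordinate]
        by (simp add: o_def)
      ultimately have "continuous_map ?P euclideanreal (\<lambda>z. (1 - fst z) * r (snd z) v + fst z * snd z v)"
        by (intro continuous_intros) auto
      then show "continuous_map ?P euclideanreal (\<lambda>z. h z v)"
        by (simp add: h_def case_prod_unfold)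
    next
      fix z assume "z \<in> topspace ?P"
      then show "h z \<in> realization_points (L \<union> Pow T)"
        using h_in[of "fst z" "snd z"] by (cases z) auto
    qed
  qed (auto simp: h_def)
  ultimately show ?thesis using deformation_retract_imp_homotopy_equivalent_space by blast
qed

definition isolated_points :: "'a set \<Rightarrow> 'a set set" where
  "isolated_points S = insert {} ((\<lambda>s. {s}) ` S)"

lemma Hausdorff_realization: "Hausdorff_space (geometric_realization K)"
  unfolding geometric_realization_eq
  by (rule Hausdorff_space_subtopology) (metis Hausdorff_space_euclidean Hausdorff_space_product_topology)

text \<open>A finite Hausdorff space is discrete.\<close>

lemma homotopy_discrete_isolated_points:
  assumes "finite S"
  shows "homotopy_discrete (geometric_realization (isolated_points S))"
proof -
  let ?X = "geometric_realization (isolated_points S)"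
  have "realization_points (isolated_points S) \<subseteq> (\<lambda>s v. if v = s then 1 else 0) ` S"
  proof
    fix x :: "'a \<Rightarrow> real" assume x: "x \<in> realization_points (isolated_points S)"
    then have "{v. x v \<noteq> 0} \<noteq> {}" unfolding realization_points_def by (auto simp: isolated_points_def)
    then obtain s where s: "s \<in> S" "{v. x v \<noteq> 0} = {s}"
      using x by (auto simp: realization_points_def isolated_points_def)
    moreover have "x s = 1" using x s by (simp add: realization_points_def)
    ultimately have "x = (\<lambda>v. if v = s then 1 else 0)" by (auto simp: fun_eq_iff)
    then show "x \<in> (\<lambda>s v. if v = s then 1 else 0) ` S" using s by blast
  qed
  then have fin: "finite (topspace ?X)" using assms by (simp add: finite_subset)
  then have disc: "?X = discrete_topology (topspace ?X)"
    using Hausdorff_imp_t1_space[OF Hausdorff_realization] finite_t1_space_imp_discrete_topology by metis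
  obtain f where f: "bij_betw f (topspace ?X) {0..<card (topspace ?X)}"
    using ex_bij_betw_finite_nat[OF fin] by blast
  let ?g = "inv_into (topspace ?X) f"
  have "homeomorphic_maps (discrete_topology (topspace ?X)) (discrete_topology {0..<card (topspace ?X)}) f ?g"
    unfolding homeomorphic_maps_def
    using f bij_betw_inv_into[OF f] bij_betw_inv_into_left[OF f] bij_betw_inv_into_right[OF f]
    by (auto simp: bij_betw_def)
  then have "?X homotopy_equivalent_space discrete_topology {0..<card (topspace ?X)}"
    using disc homeomorphic_imp_homotopy_equivalent_space homeomorphic_space_def by metis
  then show ?thesis unfolding homotopy_discrete_def by blast
qed

lemma homotopy_discrete_cong:
  assumes "X homotopy_equivalent_space Y" "homotopy_discrete Y"
  shows "homotopy_discrete X"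
  using assms homotopy_eqv_trans unfolding homotopy_discrete_def by blast

lemma iterated_attachment_down:
  assumes "iterated_simplex_attachment K" "J \<in> K" "I \<subseteq> J"
  shows "I \<in> K"
  using assms by induction auto

lemma iterated_attachment_empty: "iterated_simplex_attachment K \<Longrightarrow> {} \<in> K"
  by (induction rule: iterated_simplex_attachment.induct) auto

text \<open>The set \<open>D\<close> of additional isolated points is what makes the induction work. If a simplex on \<open>T\<close> is
attached along the empty face, then one vertex \<open>t\<close> of \<open>T\<close> is moved into \<open>D\<close>, and the simplex is
attached along the non-empty face \<open>{t}\<close> and collapses.\<close>

lemma homotopy_discrete_attachment_points:
  assumes "iterated_simplex_attachment K" "finite D" "D \<inter> \<Union>K = {}"
  shows "homotopy_discrete (geometric_realization (K \<union> isolated_points D))"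
  using assms
proof (induction arbitrary: D)
  case (simplex T)
  then obtain t where t: "t \<in> T" by blast
  have "geometric_realization (isolated_points (insert t D) \<union> Pow T) homotopy_equivalent_space
          geometric_realization (isolated_points (insert t D))"
    by (rule realization_collapse[where \<sigma> = "{t}"]) (use simplex t in \<open>auto simp: isolated_points_def\<close>)
  moreover have "isolated_points (insert t D) \<union> Pow T = Pow T \<union> isolated_points D" using t by (auto simp: isolated_points_def)
  ultimately show ?case
    using homotopy_discrete_isolated_points[of "insert t D"] simplex homotopy_discrete_cong by fastforce
next
  case (attach K' \<sigma> T)
  have down: "I \<in> K'" if "J \<in> K'" "I \<subseteq> J" for I J
    using iterated_attachment_down[OF attach.hyps(1) that] .
  have fin: "finite D" and DK: "D \<inter> \<Union>K' = {}" "D \<inter> T = {}" using attach.prems by auto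
  have e: "{} \<in> K'" using iterated_attachment_empty[OF attach.hyps(1)] .
  show ?case
  proof (cases "\<sigma> = {}")
    case False
    have "geometric_realization ((K' \<union> isolated_points D) \<union> Pow T) homotopy_equivalent_space
          geometric_realization (K' \<union> isolated_points D)"
    proof (rule realization_collapse[where \<sigma> = \<sigma>])
      show "I \<in> K' \<union> isolated_points D" if "J \<in> K' \<union> isolated_points D" "I \<subseteq> J" for J I
        using that down by (auto simp: isolated_points_def subset_singleton_iff)
      show "(K' \<union> isolated_points D) \<inter> Pow T = Pow \<sigma>"
        using attach.hyps DK by (auto simp: isolated_points_def)
    qed (use False attach.hyps in auto)
    moreover have "(K' \<union> isolated_points D) \<union> Pow T = (K' \<union> Pow T) \<union> isolated_points D" by auto
    ultimately show ?thesis using attach.IH[OF fin DK(1)] homotopy_discrete_cong by metis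
  next
    case True
    obtain t where t: "t \<in> T" using attach.hyps by blast
    have TK: "T \<inter> \<Union>K' = {}"
    proof (rule ccontr)
      assume "T \<inter> \<Union>K' \<noteq> {}"
      then obtain v J where "v \<in> T" "v \<in> J" "J \<in> K'" by blast
      then have "{v} \<in> K' \<inter> Pow T" using down[of J "{v}"] by auto
      then show False using attach.hyps True by auto
    qed
    have "geometric_realization ((K' \<union> isolated_points (insert t D)) \<union> Pow T) homotopy_equivalent_space
          geometric_realization (K' \<union> isolated_points (insert t D))"
    proof (rule realization_collapse[where \<sigma> = "{t}"])
      show "I \<in> K' \<union> isolated_points (insert t D)" if "J \<in> K' \<union> isolated_points (insert t D)" "I \<subseteq> J" for J I
        using that down by (auto simp: isolated_points_def subset_singleton_iff)
      show "(K' \<union> isolated_points (insert t D)) \<inter> Pow T = Pow {t}"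
      proof
        show "(K' \<union> isolated_points (insert t D)) \<inter> Pow T \<subseteq> Pow {t}"
          using TK DK by (auto simp: isolated_points_def)
        show "Pow {t} \<subseteq> (K' \<union> isolated_points (insert t D)) \<inter> Pow T"
          using t by (auto simp: isolated_points_def subset_singleton_iff)
      qed
    qed (use attach.hyps in auto)
    moreover have "(K' \<union> isolated_points (insert t D)) \<union> Pow T = (K' \<union> Pow T) \<union> isolated_points D"
      using t by (auto simp: isolated_points_def)
    moreover have "homotopy_discrete (geometric_realization (K' \<union> isolated_points (insert t D)))"
      by (rule attach.IH) (use fin DK TK t in auto)
    ultimately show ?thesis using homotopy_discrete_cong by metis
  qed
qed

text \<open>The exceptional value \<open>{{}}\<close> occurs if \<open>I\<close> contains no vertex of \<open>K\<close>; it is not an iterated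
attachment because the simplex at the start has a vertex.\<close>

lemma iterated_attachment_full_subcomplex:
  assumes "iterated_simplex_attachment K"
  shows "full_subcomplex K I = {{}} \<or> iterated_simplex_attachment (full_subcomplex K I)"
  using assms
proof induction
  case (simplex T)
  have "full_subcomplex (Pow T) I = Pow (T \<inter> I)" by (auto simp: full_subcomplex_def)
  then show ?case using simplex iterated_simplex_attachment.simplex[of "T \<inter> I"] by (cases "T \<inter> I = {}") auto
next
  case (attach K' \<sigma> T)
  have eq: "full_subcomplex (K' \<union> Pow T) I = full_subcomplex K' I \<union> Pow (T \<inter> I)"
    by (auto simp: full_subcomplex_def)
  have e: "{} \<in> full_subcomplex K' I"
    using iterated_attachment_empty[OF attach.hyps(1)] by (simp add: full_subcomplex_def)
  show ?case
  proof (cases "T \<inter> I = {}")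
    case True
    then show ?thesis using attach.IH e by (simp add: eq insert_absorb)
  next
    case False
    show ?thesis
    proof (cases "full_subcomplex K' I = {{}}")
      case True
      then have "full_subcomplex (K' \<union> Pow T) I = Pow (T \<inter> I)" by (auto simp: eq)
      then show ?thesis
        using iterated_simplex_attachment.simplex[of "T \<inter> I"] attach.hyps False by simp
    next
      case F: False
      have "iterated_simplex_attachment (full_subcomplex K' I \<union> Pow (T \<inter> I))"
      proof (rule iterated_simplex_attachment.attach)
        show "iterated_simplex_attachment (full_subcomplex K' I)" using attach.IH F by simp
        show "\<sigma> \<inter> I \<in> full_subcomplex K' I"
          using iterated_attachment_down[OF attach.hyps(1,2), of "\<sigma> \<inter> I"] by (simp add: full_subcomplex_def)
        have "full_subcomplex K' I \<inter> Pow (T \<inter> I) = (K' \<inter> Pow T) \<inter> Pow I"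
          by (auto simp: full_subcomplex_def)
        then show "full_subcomplex K' I \<inter> Pow (T \<inter> I) = Pow (\<sigma> \<inter> I)"
          using attach.hyps by auto
      qed (use False attach.hyps in auto)
      then show ?thesis by (simp add: eq)
    qed
  qed
qed

lemma attachment_imp_homotopy_discrete:
  assumes "iterated_simplex_attachment K"
  shows "homotopy_discrete (geometric_realization (full_subcomplex K I))"
  using iterated_attachment_full_subcomplex[OF assms, of I]
proof
  assume "full_subcomplex K I = {{}}"
  then show ?thesis using homotopy_discrete_isolated_points[of "{}"] by (simp add: isolated_points_def)
next
  assume *: "iterated_simplex_attachment (full_subcomplex K I)"
  have "full_subcomplex K I \<union> isolated_points {} = full_subcomplex K I"
    using iterated_attachment_empty[OF *] by (auto simp: isolated_points_def)
  then show ?thesis using homotopy_discrete_attachment_points[OF *, of "{}"] by simp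
qed

section \<open>Spheres in realizations that are not homotopy discrete\<close>

definition sphere_projection :: "nat \<Rightarrow> (nat \<Rightarrow> real) \<Rightarrow> nat \<Rightarrow> real" where
  "sphere_projection p x = (\<lambda>i. if i \<le> p then x i / sqrt (\<Sum>j\<le>p. (x j)\<^sup>2) else 0)"

lemma topspace_nsphere:
  "topspace (nsphere p) = {x. (\<Sum>i\<le>p. (x i)\<^sup>2) = 1 \<and> (\<forall>i>p. x i = 0)}"
  by (simp add: nsphere)

lemma sum_squares_pos: "(\<Sum>j\<le>p. (x j)\<^sup>2) > 0" if "i \<le> (p::nat)" "x i \<noteq> (0::real)"
  using that by (intro sum_pos2[of _ i]) auto

lemma continuous_map_sphere_projection:
  assumes cont: "\<And>i. i \<le> p \<Longrightarrow> continuous_map Z euclideanreal (\<lambda>z. h z i)"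
    and nz: "\<And>z. z \<in> topspace Z \<Longrightarrow> \<exists>i\<le>p. h z i \<noteq> 0"
  shows "continuous_map Z (nsphere p) (\<lambda>z. sphere_projection p (h z))"
  unfolding nsphere continuous_map_in_subtopology continuous_map_componentwise_UNIV
proof (intro conjI allI)
  have pos: "(\<Sum>j\<le>p. (h z j)\<^sup>2) > 0" if z: "z \<in> topspace Z" for z
  proof -
    obtain i where "i \<le> p" "h z i \<noteq> 0" using nz[OF z] by blast
    then show ?thesis by (rule sum_squares_pos)
  qed
  show "continuous_map Z euclideanreal (\<lambda>z. sphere_projection p (h z) i)" for i
  proof (cases "i \<le> p")
    case True
    have "continuous_map Z euclideanreal (\<lambda>z. h z i / sqrt (\<Sum>j\<le>p. (h z j)\<^sup>2))"
      using True pos cont by (intro continuous_intros) fastforce+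
    then show ?thesis using True by (simp add: sphere_projection_def)
  qed (simp add: sphere_projection_def)
  show "(\<lambda>z. sphere_projection p (h z)) \<in> topspace Z \<rightarrow> {x. (\<Sum>i\<le>p. (x i)\<^sup>2) = 1 \<and> (\<forall>i>p. x i = 0)}"
  proof (intro Pi_I CollectI conjI)
    fix z assume z: "z \<in> topspace Z"
    have "(\<Sum>i\<le>p. (sphere_projection p (h z) i)\<^sup>2) = (\<Sum>i\<le>p. (h z i)\<^sup>2 / (\<Sum>j\<le>p. (h z j)\<^sup>2))"
      using pos[OF z] by (intro sum.cong) (auto simp: sphere_projection_def power_divide)
    also have "\<dots> = 1" using pos[OF z] by (simp flip: sum_divide_distrib)
    finally show "(\<Sum>i\<le>p. (sphere_projection p (h z) i)\<^sup>2) = 1" .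
  qed (auto simp: sphere_projection_def)
qed

lemma sphere_projection_scale:
  assumes y: "y \<in> topspace (nsphere p)" and c: "c > 0"
  shows "sphere_projection p (\<lambda>i. c * y i) = y"
proof
  fix i
  have "(\<Sum>j\<le>p. (c * y j)\<^sup>2) = c\<^sup>2"
    using y by (simp add: topspace_nsphere power_mult_distrib flip: sum_distrib_left)
  then show "sphere_projection p (\<lambda>i. c * y i) i = y i"
    using c y by (auto simp: sphere_projection_def topspace_nsphere)
qed

text \<open>Two points that are not antipodal are joined by the normalized segment between them. Antipodal
points are joined through a third point, which one of the first two unit vectors provides.\<close>

lemma connected_space_nsphere:
  assumes "p \<ge> 1"
  shows "connected_space (nsphere p)"
proof -
  have segment: "connected_component_of (nsphere p) x y"
    if x: "x \<in> topspace (nsphere p)" and y: "y \<in> topspace (nsphere p)" and ne: "y \<noteq> (\<lambda>i. - x i)" for x y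
  proof -
    define h where "h = (\<lambda>t i. (1 - t) * x i + t * y i)"
    have nz: "\<exists>i\<le>p. h t i \<noteq> 0" if t: "t \<in> {0..1}" for t
    proof (rule ccontr)
      assume "\<not> (\<exists>i\<le>p. h t i \<noteq> 0)"
      then have eq: "(1 - t) * x i = - (t * y i)" if "i \<le> p" for i using that by (force simp: h_def)
      have "(\<Sum>i\<le>p. ((1 - t) * x i)\<^sup>2) = (\<Sum>i\<le>p. (t * y i)\<^sup>2)"
        by (intro sum.cong) (auto simp: eq)
      then have "(1 - t)\<^sup>2 = t\<^sup>2"
        using x y by (simp add: topspace_nsphere power_mult_distrib flip: sum_distrib_left)
      then have "t = 1/2" by (simp add: power2_eq_square algebra_simps)
      have "y i = - x i" for i
      proof (cases "i \<le> p")
        case True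
        then show ?thesis using eq[OF True] \<open>t = 1/2\<close> by simp
      next
        case False
        then show ?thesis using x y by (simp add: topspace_nsphere)
      qed
      then show False using ne by blast
    qed
    have "continuous_map (top_of_set {0..1}) (nsphere p) (\<lambda>t. sphere_projection p (h t))"
    proof (rule continuous_map_sphere_projection)
      show "continuous_map (top_of_set {0..1}) euclideanreal (\<lambda>t. h t i)" for i
        unfolding h_def by (simp add: continuous_map_iff_continuous) (intro continuous_intros)
    qed (use nz in auto)
    moreover have "connectedin (top_of_set {0..1::real}) {0..1}"
      by (simp add: connectedin_subtopology)
    ultimately have "connectedin (nsphere p) ((\<lambda>t. sphere_projection p (h t)) ` {0..1})"
      by (rule connectedin_continuous_map_image)
    moreover have "sphere_projection p (h 0) = x" "sphere_projection p (h 1) = y"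
      using sphere_projection_scale[OF x, of 1] sphere_projection_scale[OF y, of 1] by (simp_all add: h_def)
    moreover have "sphere_projection p (h 0) \<in> (\<lambda>t. sphere_projection p (h t)) ` {0..1}"
      "sphere_projection p (h 1) \<in> (\<lambda>t. sphere_projection p (h t)) ` {0..1}" by auto
    ultimately show ?thesis unfolding connected_component_of_def by metis
  qed
  define e :: "nat \<Rightarrow> nat \<Rightarrow> real" where "e = (\<lambda>k i. if i = k then 1 else 0)"
  have e: "e k \<in> topspace (nsphere p)" if "k \<le> p" for k
    using that by (simp add: e_def topspace_nsphere if_distrib[of "\<lambda>z. z\<^sup>2"] cong: if_cong)
  have e01: "e 0 \<noteq> e 1" "e 1 \<noteq> (\<lambda>i. - e 0 i)" by (auto simp: e_def fun_eq_iff intro!: exI[of _ 0])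
  have "connected_component_of (nsphere p) x y"
    if x: "x \<in> topspace (nsphere p)" and y: "y \<in> topspace (nsphere p)" for x y
  proof (cases "y = (\<lambda>i. - x i)")
    case True
    obtain k where k: "k \<le> p" "e k \<noteq> x" "e k \<noteq> (\<lambda>i. - x i)"
    proof (cases "e 0 = x \<or> e 0 = (\<lambda>i. - x i)")
      case True
      then have "x = e 0 \<or> x = (\<lambda>i. - e 0 i)" by (auto simp: fun_eq_iff)
      then have "e 1 \<noteq> x" "e 1 \<noteq> (\<lambda>i. - x i)"
        using e01 by (elim disjE; simp)+
      then show ?thesis using that[of 1] \<open>p \<ge> 1\<close> by blast
    qed (use that[of 0] in auto)
    have xe: "connected_component_of (nsphere p) x (e k)" using segment[OF x e[OF k(1)] k(3)] .
    have "y \<noteq> (\<lambda>i. - e k i)"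
    proof
      assume "y = (\<lambda>i. - e k i)"
      then have "e k i = x i" for i using fun_cong[OF True, of i] by simp
      then show False using k(2) by blast
    qed
    then have "connected_component_of (nsphere p) (e k) y" by (rule segment[OF e[OF k(1)] y])
    then show ?thesis by (rule connected_component_of_trans[OF xe])
  qed (use segment x y in blast)
  then show ?thesis by (simp add: connected_space_iff_connected_component)
qed

text \<open>Composing the inclusion of the connected retract \<open>Y\<close> with the map from \<open>X\<close> to a discrete space gives
a constant map. So the identity of \<open>Y\<close>, which factors up to homotopy through this composition, is
homotopic to a constant map.\<close>

lemma retraction_of_homotopy_discrete_contractible:
  assumes "retraction_map X Y f" "connected_space Y" "homotopy_discrete X"
  shows "contractible_space Y"
proof (cases "topspace Y = {}")
  case True
  then show ?thesis by (simp add: contractible_space_empty null_topspace_iff_trivial)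
next
  case False
  then obtain y0 where y0: "y0 \<in> topspace Y" by blast
  obtain g where f: "continuous_map X Y f" and g: "continuous_map Y X g"
    and fg: "\<And>y. y \<in> topspace Y \<Longrightarrow> f (g y) = y"
    using assms(1) unfolding retraction_map_def retraction_maps_def by blast
  obtain S :: "nat set" and h k where h: "continuous_map X (discrete_topology S) h"
    and k: "continuous_map (discrete_topology S) X k"
    and kh: "homotopic_with (\<lambda>x. True) X X (k \<circ> h) id"
    using assms(3) unfolding homotopy_discrete_def homotopy_equivalent_space_def by blast
  have "connectedin (discrete_topology S) ((h \<circ> g) ` topspace Y)"
    using connectedin_continuous_map_image[OF continuous_map_compose[OF g h]] assms(2)
    by (simp add: connectedin_topspace)
  then obtain d where "(h \<circ> g) ` topspace Y \<subseteq> {d}" unfolding connectedin_discrete_topology by blast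
  then have d: "h (g y) = d" if "y \<in> topspace Y" for y using that by auto
  have "homotopic_with (\<lambda>x. True) Y X (k \<circ> h \<circ> g) (id \<circ> g)"
    by (rule homotopic_with_compose_continuous_map_right[OF kh g]) simp
  then have "homotopic_with (\<lambda>x. True) Y Y (f \<circ> (k \<circ> h \<circ> g)) (f \<circ> (id \<circ> g))"
    by (rule homotopic_with_compose_continuous_map_left[OF _ f]) simp
  then have "homotopic_with (\<lambda>x. True) Y Y (\<lambda>y. f (k d)) id"
    by (rule homotopic_with_eq) (auto simp: d fg)
  then show ?thesis unfolding contractible_space_def using homotopic_with_sym by blast
qed

definition has_sphere_retract :: "'a topology \<Rightarrow> bool" where
  "has_sphere_retract X \<longleftrightarrow> (\<exists>p\<ge>1. \<exists>f. retraction_map X (nsphere p) f)"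

lemma has_sphere_retract_imp_not_homotopy_discrete:
  "has_sphere_retract X \<Longrightarrow> \<not> homotopy_discrete X"
  unfolding has_sphere_retract_def
  using retraction_of_homotopy_discrete_contractible connected_space_nsphere non_contractible_space_nsphere
  by blast

lemma has_sphere_retract_retraction:
  "retraction_map X Y f \<Longrightarrow> has_sphere_retract Y \<Longrightarrow> has_sphere_retract X"
  unfolding has_sphere_retract_def using retraction_map_compose by blast

lemma continuous_map_Min:
  fixes F :: "'i \<Rightarrow> 'z \<Rightarrow> real"
  assumes "finite I" "I \<noteq> {}" "\<And>i. i \<in> I \<Longrightarrow> continuous_map Z euclideanreal (F i)"
  shows "continuous_map Z euclideanreal (\<lambda>z. Min ((\<lambda>i. F i z) ` I))"
  using assms
proof (induction rule: finite_ne_induct)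
  case (insert i I)
  then show ?case by (simp add: continuous_map_real_min)
qed simp

text \<open>The retraction to the sphere sends barycentric coordinates \<open>x\<^sub>0, \<dots>, x\<^sub>n\<close> to the direction of
\<open>(x\<^sub>0 - x\<^sub>n, \<dots>, x\<^bsub>n-1\<^esub> - x\<^sub>n)\<close>; the coordinates are not all equal, as one of them is zero. A section
sends a unit vector \<open>y\<close>, extended by \<open>y\<^sub>n = 0\<close>, to the multiple of \<open>y - min y\<close> whose coordinates
have sum \<open>1\<close>; the minimal coordinate becomes zero, so that the image lies in the boundary.\<close>

lemma simplex_boundary_sphere_retract:
  assumes S: "finite S" "card S \<ge> 3"
  shows "has_sphere_retract (geometric_realization (Pow S - {S}))"
proof -
  \<comment> \<open>With \<open>Suc p\<close> for the last index \<open>n\<close>, the sphere lies in the space with coordinates \<open>0, \<dots>, p\<close>. Its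
    points vanish in all other coordinates, so the extension by \<open>y\<^sub>n = 0\<close> is already there.\<close>
  define p where "p = card S - 2"
  have p: "p \<ge> 1" "card S = Suc (Suc p)" using S by (auto simp: p_def)
  obtain e where e: "bij_betw e {..Suc p} S"
    using ex_bij_betw_nat_finite[OF S(1)] p by (metis atLeast0LessThan lessThan_Suc_atMost)
  let ?X = "geometric_realization (Pow S - {S})"
  let ?e' = "inv_into {..Suc p} e"
  have e': "?e' v \<le> Suc p" "e (?e' v) = v" if "v \<in> S" for v
    using that e bij_betw_inv_into_right[OF e] by (auto simp: bij_betw_def inv_into_into dest: inv_into_into)
  have e'e: "?e' (e i) = i" "e i \<in> S" if "i \<le> Suc p" for i
    using that e bij_betw_inv_into_left[OF e] by (auto simp: bij_betw_def)
  have sum_e: "sum x S = (\<Sum>i\<le>Suc p. x (e i))" for x :: "'a \<Rightarrow> real"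
    using sum.reindex_bij_betw[OF e, of x] by simp
  define h where "h = (\<lambda>(x :: 'a \<Rightarrow> real) i. x (e i) - x (e (Suc p)))"
  define f where "f = (\<lambda>x. sphere_projection p (h x))"
  define \<mu> where "\<mu> = (\<lambda>y :: nat \<Rightarrow> real. Min ((\<lambda>i. y i) ` {..Suc p}))"
  define s where "s = (\<lambda>y :: nat \<Rightarrow> real. \<Sum>i\<le>Suc p. y i - \<mu> y)"
  define g where "g = (\<lambda>y v. if v \<in> S then (y (?e' v) - \<mu> y) / s y else 0)"
  have X: "x \<in> realization_points (Pow S - {S}) \<longleftrightarrow>
      (\<forall>v. 0 \<le> x v) \<and> (\<forall>v. v \<notin> S \<longrightarrow> x v = 0) \<and> (\<exists>v\<in>S. x v = 0) \<and> sum x S = 1" for x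
  proof (cases "\<forall>v. v \<notin> S \<longrightarrow> x v = 0")
    case True
    then have sub: "{v. x v \<noteq> 0} \<subseteq> S" by auto
    have "{v. x v \<noteq> 0} = S \<longleftrightarrow> (\<forall>v\<in>S. x v \<noteq> 0)"
    proof
      assume "\<forall>v\<in>S. x v \<noteq> 0"
      then have "S \<subseteq> {v. x v \<noteq> 0}" by auto
      with sub show "{v. x v \<noteq> 0} = S" by (rule equalityI)
    qed auto
    then have "{v. x v \<noteq> 0} \<in> Pow S - {S} \<longleftrightarrow> (\<exists>v\<in>S. x v = 0)" using sub by simp
    moreover have "x \<in> realization_points (Pow S - {S}) \<longleftrightarrow>
        (\<forall>v. 0 \<le> x v) \<and> {v. x v \<noteq> 0} \<in> Pow S - {S} \<and> sum x S = 1"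
      using True by (intro realization_points_iff[OF S(1)]) simp
    ultimately have "x \<in> realization_points (Pow S - {S}) \<longleftrightarrow>
        (\<forall>v. 0 \<le> x v) \<and> (\<exists>v\<in>S. x v = 0) \<and> sum x S = 1" by (simp only:)
    then show ?thesis by (simp only: eqTrueI[OF True] simp_thms)
  next
    case False
    then have "\<not> {v. x v \<noteq> 0} \<subseteq> S" by blast
    then show ?thesis using False by (simp add: realization_points_def)
  qed
  have f: "continuous_map ?X (nsphere p) f"
    unfolding f_def
  proof (rule continuous_map_sphere_projection)
    show "continuous_map ?X euclideanreal (\<lambda>x. h x i)" for i
      unfolding h_def by (intro continuous_intros)
    fix x assume "x \<in> topspace ?X"
    then have x: "\<exists>v\<in>S. x v = 0" "sum x S = 1" by (auto simp: X)
    show "\<exists>i\<le>p. h x i \<noteq> 0"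
    proof (rule ccontr)
      assume "\<not> (\<exists>i\<le>p. h x i \<noteq> 0)"
      then have eq: "x (e i) = x (e (Suc p))" if "i \<le> Suc p" for i
        using that by (cases "i = Suc p") (auto simp: h_def)
      obtain v where v: "v \<in> S" "x v = 0" using x by blast
      then have "x (e (Suc p)) = 0" using eq[of "?e' v"] e'[of v] by simp
      then have "x (e i) = 0" if "i \<le> Suc p" for i using eq[OF that] by simp
      then have "sum x S = 0" unfolding sum_e by (intro sum.neutral) auto
      then show False using x by simp
    qed
  qed
  have \<mu>_le: "\<mu> y \<le> y i" if "i \<le> Suc p" for y i using that by (simp add: \<mu>_def)
  have \<mu>_ex: "\<exists>i\<le>Suc p. y i = \<mu> y" for y
  proof -
    have "\<mu> y \<in> (\<lambda>i. y i) ` {..Suc p}" unfolding \<mu>_def by (rule Min_in) auto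
    then show ?thesis by auto
  qed
  have s_pos: "s y > 0" if y: "y \<in> topspace (nsphere p)" for y
  proof -
    have "\<exists>i\<le>Suc p. y i \<noteq> \<mu> y"
    proof (rule ccontr)
      assume "\<not> ?thesis"
      then have "y i = \<mu> y" if "i \<le> Suc p" for i using that by blast
      moreover have "y (Suc p) = 0" using y by (simp add: topspace_nsphere)
      ultimately have "y i = 0" if "i \<le> p" for i using that by (metis le_Suc_eq order_refl)
      then have "(\<Sum>i\<le>p. (y i)\<^sup>2) = 0" by simp
      then show False using y by (simp add: topspace_nsphere)
    qed
    then obtain i where "i \<le> Suc p" "y i \<noteq> \<mu> y" by blast
    then have "0 < y i - \<mu> y" using \<mu>_le[of i y] by simp
    then show ?thesis unfolding s_def
      using \<open>i \<le> Suc p\<close> \<mu>_le by (intro sum_pos2[of _ i]) auto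
  qed
  have g: "continuous_map (nsphere p) ?X g"
  proof (rule continuous_map_into_realization)
    have c: "continuous_map (nsphere p) euclideanreal (\<lambda>y. y i)" for i
      by (rule continuous_map_nsphere_projection)
    have \<mu>: "continuous_map (nsphere p) euclideanreal \<mu>"
      unfolding \<mu>_def using c by (intro continuous_map_Min) auto
    have s: "continuous_map (nsphere p) euclideanreal s"
      unfolding s_def using c \<mu> by (intro continuous_intros) auto
    fix v
    show "continuous_map (nsphere p) euclideanreal (\<lambda>y. g y v)"
    proof (cases "v \<in> S")
      case True
      have "continuous_map (nsphere p) euclideanreal (\<lambda>y. (y (?e' v) - \<mu> y) / s y)"
        using c \<mu> s s_pos by (intro continuous_intros) (auto simp: less_imp_neq[symmetric])
      then show ?thesis using True by (simp add: g_def)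
    qed (simp add: g_def)
  next
    fix y assume y: "y \<in> topspace (nsphere p)"
    have "g y v \<ge> 0" for v
      using \<mu>_le e' s_pos[OF y] by (auto simp: g_def)
    moreover have "\<exists>v\<in>S. g y v = 0"
    proof -
      obtain i where i: "i \<le> Suc p" "y i = \<mu> y" using \<mu>_ex by blast
      then show ?thesis using e'e[of i] by (intro bexI[of _ "e i"]) (auto simp: g_def)
    qed
    moreover have "sum (g y) S = 1"
    proof -
      have "sum (g y) S = (\<Sum>i\<le>Suc p. (y i - \<mu> y) / s y)"
        unfolding sum_e by (rule sum.cong) (auto simp: g_def e'e simp del: sum.atMost_Suc)
      also have "\<dots> = s y / s y" unfolding s_def by (rule sum_divide_distrib[symmetric])
      finally show ?thesis using s_pos[OF y] by simp
    qed
    ultimately show "g y \<in> realization_points (Pow S - {S})" unfolding X by (auto simp: g_def)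
  qed
  have fg: "f (g y) = y" if y: "y \<in> topspace (nsphere p)" for y
  proof -
    have "h (g y) i = inverse (s y) * y i" if "i \<le> p" for i
      using that y e'e[of i] e'e[of "Suc p"]
      by (simp add: h_def g_def topspace_nsphere divide_inverse algebra_simps)
    then have "f (g y) = sphere_projection p (\<lambda>i. inverse (s y) * y i)"
      by (simp add: f_def sphere_projection_def fun_eq_iff)
    then show ?thesis using sphere_projection_scale[OF y, of "inverse (s y)"] s_pos[OF y] by simp
  qed
  have "retraction_map ?X (nsphere p) f"
    using f g fg unfolding retraction_map_def retraction_maps_def by blast
  then show ?thesis using p(1) unfolding has_sphere_retract_def by blast
qed

text \<open>The larger complex subdivides the edge \<open>{u, v}\<close> by a new vertex \<open>w\<close>. The map that puts \<open>w\<close> at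
the midpoint of the edge is even a homeomorphism of realizations, with the inverse \<open>g\<close> below; for the
transfer of sphere retracts one of the two compositions is enough.\<close>

lemma edge_subdivision_retraction:
  assumes down: "\<And>J I. J \<in> K \<Longrightarrow> I \<subseteq> J \<Longrightarrow> I \<in> K" and uv: "u \<noteq> v" "{u, v} \<in> K"
    and maximal: "\<And>J. J \<in> K \<Longrightarrow> {u, v} \<subseteq> J \<Longrightarrow> J = {u, v}"
    and w: "w \<notin> \<Union>K"
  shows "\<exists>f. retraction_map (geometric_realization (K - {{u, v}} \<union> {{w}, {u, w}, {w, v}}))
              (geometric_realization K) f"
proof -
  let ?K' = "K - {{u, v}} \<union> {{w}, {u, w}, {w, v}}"
  let ?X = "geometric_realization ?K'" and ?Y = "geometric_realization K"
  have wuv: "w \<noteq> u" "w \<noteq> v" using uv w by auto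
  define f where "f = (\<lambda>(x :: 'a \<Rightarrow> real) t. if t = u then x u + x w / 2 else if t = v then x v + x w / 2
                         else if t = w then 0 else x t)"
  define g where "g = (\<lambda>(y :: 'a \<Rightarrow> real) t. if t = w then 2 * min (y u) (y v)
                         else if t = u \<or> t = v then y t - min (y u) (y v) else y t)"
  have f_id: "f x = x" if "x w = 0" for x using that wuv by (auto simp: f_def)
  have g_id: "g y = y" if "min (y u) (y v) = 0" "y w = 0" for y using that by (auto simp: g_def)
  have Yw: "y w = 0" if "y \<in> realization_points K" for y using that w by (auto simp: realization_points_def)
  have sum3: "sum z {u, v, w} = z u + z v + z w" for z :: "'a \<Rightarrow> real" using uv(1) wuv by auto
  have Yuv: "(\<forall>t. 0 \<le> z t) \<Longrightarrow> (\<And>t. t \<notin> {u, v, w} \<Longrightarrow> z t = 0) \<Longrightarrow> {t. z t \<noteq> 0} \<in> L \<Longrightarrow> z u + z v + z w = 1 \<Longrightarrow>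
      z \<in> realization_points L" for z :: "'a \<Rightarrow> real" and L
    using realization_points_iff[of "{u, v, w}" z L] sum3 by simp
  have f_in: "f x \<in> realization_points K" if x: "x \<in> realization_points ?K'" for x
  proof (cases "x w = 0")
    case True
    then have "{t. x t \<noteq> 0} \<in> K" using x wuv by (auto simp: realization_points_def)
    then show ?thesis using x f_id[of x] True by (auto simp: realization_points_def)
  next
    case False
    then have "{t. x t \<noteq> 0} \<notin> K" using w by blast
    then have "{t. x t \<noteq> 0} \<in> {{w}, {u, w}, {w, v}}" using x unfolding realization_points_def by blast
    then have out: "x t = 0" if "t \<notin> {u, v, w}" for t using that by blast
    have nonneg: "\<forall>t. 0 \<le> x t" using x by (simp add: realization_points_def)
    have "x u + x v + x w = 1"
      using x realization_points_iff[of "{u, v, w}" x ?K'] out sum3 by simp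
    moreover have "{t. f x t \<noteq> 0} \<in> K"
      by (rule down[OF uv(2)]) (use out in \<open>auto simp: f_def split: if_splits\<close>)
    moreover have "f x u + f x v + f x w = x u + x v + x w"
      using uv(1) wuv by (simp add: f_def)
    moreover have "0 \<le> f x t" for t
      using nonneg by (simp add: f_def)
    moreover have "f x t = 0" if "t \<notin> {u, v, w}" for t
      using that out by (simp add: f_def)
    ultimately show ?thesis by (intro Yuv) auto
  qed
  have g_in: "g y \<in> realization_points ?K'" if y: "y \<in> realization_points K" for y
  proof (cases "min (y u) (y v) = 0")
    case True
    then have "{t. y t \<noteq> 0} \<noteq> {u, v}" by (auto simp: min_def split: if_splits)
    then show ?thesis using y g_id[OF True Yw[OF y]] by (auto simp: realization_points_def)
  next
    case False
    have nonneg: "0 \<le> y t" for t using y by (simp add: realization_points_def)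
    have m: "min (y u) (y v) > 0"
    proof -
      have "0 \<le> min (y u) (y v)" using nonneg by simp
      then show ?thesis using order.not_eq_order_implies_strict[OF False[symmetric]] by blast
    qed
    then have "{u, v} \<subseteq> {t. y t \<noteq> 0}" by auto
    then have supp: "{t. y t \<noteq> 0} = {u, v}"
      using y by (intro maximal) (simp add: realization_points_def)
    have out: "y t = 0" if "t \<notin> {u, v}" for t using that supp by blast
    have "y u + y v = 1" using y supp uv(1) by (simp add: realization_points_def)
    moreover have "{t. g y t \<noteq> 0} \<in> {{w}, {u, w}, {w, v}}"
    proof -
      have "g y t = 0" if "t \<notin> {u, v, w}" for t using that out by (simp add: g_def)
      moreover have "g y w \<noteq> 0" using m by (simp add: g_def min_def)
      moreover have "g y u = 0 \<or> g y v = 0" using wuv by (auto simp: g_def min_def)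
      ultimately show ?thesis by fast
    qed
    moreover have "g y u + g y v + g y w = y u + y v"
      using uv(1) wuv by (simp add: g_def)
    moreover have "0 \<le> g y t" for t
      using nonneg[of t] m by (auto simp: g_def)
    moreover have "g y t = 0" if "t \<notin> {u, v, w}" for t
      using that out by (simp add: g_def)
    ultimately show ?thesis by (intro Yuv) auto
  qed
  have "continuous_map ?X ?Y f"
  proof (rule continuous_map_into_realization)
    show "continuous_map ?X euclideanreal (\<lambda>x. f x t)" for t
      unfolding f_def by (auto intro!: continuous_intros)
  qed (use f_in in auto)
  moreover have "continuous_map ?Y ?X g"
  proof (rule continuous_map_into_realization)
    show "continuous_map ?Y euclideanreal (\<lambda>y. g y t)" for t
      unfolding g_def by (auto intro!: continuous_intros)
  qed (use g_in in auto)
  moreover have "f (g y) = y" if "y \<in> topspace ?Y" for y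
    using Yw[of y] that wuv uv(1) by (auto simp: f_def g_def fun_eq_iff)
  ultimately show ?thesis unfolding retraction_map_def retraction_maps_def by blast
qed

definition cycle_complex :: "'a list \<Rightarrow> 'a set set" where
  "cycle_complex c = insert {} ((\<lambda>v. {v}) ` set c \<union> (\<lambda>i. {c ! i, c ! (Suc i mod length c)}) ` {..<length c})"

lemma cycle_complex_snoc:
  assumes c: "distinct c" "length c \<ge> 3" and w: "w \<notin> set c"
  shows "cycle_complex (c @ [w]) =
    cycle_complex c - {{last c, hd c}} \<union> {{w}, {last c, w}, {w, hd c}}"
proof -
  define n where "n = length c"
  have n: "n \<ge> 3" "c \<noteq> []" using c by (auto simp: n_def)
  have lst: "last c = c ! (n - 1)" "hd c = c ! 0" using n by (auto simp: n_def last_conv_nth hd_conv_nth)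
  let ?e = "\<lambda>i. {c ! i, c ! Suc i}"
  have edges_c: "(\<lambda>i. {c ! i, c ! (Suc i mod length c)}) ` {..<length c} = insert {last c, hd c} (?e ` {..<n - 1})"
  proof -
    have "{..<length c} = insert (n - 1) {..<n - 1}" using n by (auto simp: n_def)
    moreover have "(\<lambda>i. {c ! i, c ! (Suc i mod length c)}) ` {..<n - 1} = ?e ` {..<n - 1}"
      by (rule image_cong) (auto simp: n_def)
    moreover have "{c ! (n - 1), c ! (Suc (n - 1) mod length c)} = {last c, hd c}" using n lst by (simp add: n_def)
    ultimately show ?thesis by (simp only: image_insert)
  qed
  let ?d = "c @ [w]"
  have edges_d: "(\<lambda>i. {?d ! i, ?d ! (Suc i mod length ?d)}) ` {..<length ?d} =
      insert {last c, w} (insert {w, hd c} (?e ` {..<n - 1}))"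
  proof -
    have "{..<length ?d} = insert n (insert (n - 1) {..<n - 1})" using n by (auto simp: n_def)
    moreover have "(\<lambda>i. {?d ! i, ?d ! (Suc i mod length ?d)}) ` {..<n - 1} = ?e ` {..<n - 1}"
      by (rule image_cong) (auto simp: n_def nth_append)
    moreover have "{?d ! (n - 1), ?d ! (Suc (n - 1) mod length ?d)} = {last c, w}"
      using n lst by (simp add: n_def nth_append)
    moreover have "{?d ! n, ?d ! (Suc n mod length ?d)} = {w, hd c}"
      using n lst by (simp add: n_def nth_append)
    ultimately show ?thesis by (simp only: image_insert) (rule insert_commute)
  qed
  have notin: "{last c, hd c} \<notin> ?e ` {..<n - 1}"
  proof
    assume "{last c, hd c} \<in> ?e ` {..<n - 1}"
    then obtain i where i: "i < n - 1" "{c ! (n - 1), c ! 0} = {c ! i, c ! Suc i}" using lst by auto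
    have inj: "c ! a = c ! b \<Longrightarrow> a = b" if "a < n" "b < n" for a b
      using that c(1) by (simp add: n_def nth_eq_iff_index_eq)
    from i(2) have "c ! (n - 1) = c ! i \<and> c ! 0 = c ! Suc i \<or> c ! (n - 1) = c ! Suc i \<and> c ! 0 = c ! i"
      by (simp add: doubleton_eq_iff)
    then show False
    proof
      assume "c ! (n - 1) = c ! i \<and> c ! 0 = c ! Suc i"
      moreover have "0 < n" "Suc i < n" using i(1) n by linarith+
      ultimately show False using inj[of 0 "Suc i"] by blast
    next
      assume "c ! (n - 1) = c ! Suc i \<and> c ! 0 = c ! i"
      then have "i = 0" "n - 1 = Suc i" using inj[of 0 i] inj[of "n - 1" "Suc i"] i(1) n by auto
      then show False using n by simp
    qed
  qed
  have ne: "last c \<noteq> hd c"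
    using lst c(1) n by (simp add: n_def nth_eq_iff_index_eq)
  have vs: "{last c, hd c} \<notin> insert {} ((\<lambda>v. {v}) ` set c)"
    using ne by (auto simp: doubleton_eq_iff)
  have "cycle_complex c = insert {last c, hd c} (insert {} ((\<lambda>v. {v}) ` set c) \<union> ?e ` {..<n - 1})"
    unfolding cycle_complex_def edges_c by blast
  then have "cycle_complex c - {{last c, hd c}} = insert {} ((\<lambda>v. {v}) ` set c) \<union> ?e ` {..<n - 1}"
  proof -
    have "{last c, hd c} \<notin> insert {} ((\<lambda>v. {v}) ` set c) \<union> ?e ` {..<n - 1}"
      using notin vs by (simp only: Un_iff simp_thms)
    from Diff_insert_absorb[OF this] show ?thesis unfolding \<open>cycle_complex c = _\<close> .
  qed
  moreover have "cycle_complex ?d = insert {} ((\<lambda>v. {v}) ` set c) \<union> ?e ` {..<n - 1} \<union> {{w}, {last c, w}, {w, hd c}}"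
    unfolding cycle_complex_def edges_d by auto
  ultimately show ?thesis by (simp only:)
qed

lemma cycle_complex_down:
  assumes "J \<in> cycle_complex c" "I \<subseteq> J"
  shows "I \<in> cycle_complex c"
proof -
  consider "J = {}" | v where "v \<in> set c" "J = {v}"
    | i where "i < length c" "J = {c ! i, c ! (Suc i mod length c)}"
    using assms(1) unfolding cycle_complex_def by blast
  then show ?thesis
  proof cases
    case 3
    then have "length c > 0" by auto
    then have "c ! i \<in> set c" "c ! (Suc i mod length c) \<in> set c" using 3(1) by simp_all
    moreover have "I = {} \<or> I = {c ! i} \<or> I = {c ! (Suc i mod length c)} \<or> I = J"
      using assms(2) 3(2) by blast
    ultimately show ?thesis using assms(1) unfolding cycle_complex_def by blast
  qed (use assms(2) in \<open>auto simp: cycle_complex_def subset_singleton_iff\<close>)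
qed

lemma card_cycle_complex: "J \<in> cycle_complex c \<Longrightarrow> finite J \<and> card J \<le> 2"
  by (auto simp: cycle_complex_def card_insert_if)

text \<open>A cycle with more than three vertices is obtained from a shorter one by subdividing the edge between
the last and the first vertex; the triangle is the boundary of a 2-simplex.\<close>

lemma cycle_sphere_retract:
  assumes "distinct c" "length c \<ge> 3"
  shows "has_sphere_retract (geometric_realization (cycle_complex c))"
  using assms
proof (induction c rule: rev_induct)
  case (snoc w c)
  show ?case
  proof (cases "length c \<ge> 3")
    case True
    have c: "distinct c" "w \<notin> set c" using snoc.prems by auto
    have ne: "c \<noteq> []" using True by auto
    have uv: "last c \<noteq> hd c"
      using True c ne by (simp add: last_conv_nth hd_conv_nth nth_eq_iff_index_eq)
    have edge: "{last c, hd c} \<in> cycle_complex c"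
    proof -
      have "{c ! (length c - 1), c ! (Suc (length c - 1) mod length c)} \<in> cycle_complex c"
        using ne unfolding cycle_complex_def by fastforce
      then show ?thesis using ne by (simp add: last_conv_nth hd_conv_nth)
    qed
    have "\<exists>f. retraction_map (geometric_realization (cycle_complex (c @ [w]))) (geometric_realization (cycle_complex c)) f"
      unfolding cycle_complex_snoc[OF c(1) True c(2)]
    proof (rule edge_subdivision_retraction[OF _ uv edge])
      show "J = {last c, hd c}" if "J \<in> cycle_complex c" "{last c, hd c} \<subseteq> J" for J
        using card_cycle_complex[OF that(1)] that(2) uv card_seteq[of J "{last c, hd c}"] by simp
      have "\<Union>(cycle_complex c) \<subseteq> set c"
      proof
        fix x assume "x \<in> \<Union>(cycle_complex c)"
        then obtain J where "J \<in> cycle_complex c" "x \<in> J" by blast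
        then have "{x} \<in> cycle_complex c" using cycle_complex_down[of J c "{x}"] by simp
        then show "x \<in> set c" using ne
          by (auto simp: cycle_complex_def)
      qed
      then show "w \<notin> \<Union>(cycle_complex c)" using c by blast
    qed (rule cycle_complex_down)
    then show ?thesis using has_sphere_retract_retraction snoc.IH[OF c(1) True] by blast
  next
    case False
    then have "length c = 2" using snoc.prems by simp
    then obtain x y where xy: "c = [x, y]" by (auto simp: numeral_2_eq_2 length_Suc_conv)
    have d: "x \<noteq> y" "x \<noteq> w" "y \<noteq> w" using snoc.prems xy by auto
    have "{..<length [x, y, w]} = {0, 1, 2}" by auto
    then have "cycle_complex (c @ [w]) = {{}, {x}, {y}, {w}, {x, y}, {y, w}, {w, x}}"
      unfolding cycle_complex_def xy by (auto simp: numeral_2_eq_2)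
    also have "\<dots> = Pow {x, y, w} - {{x, y, w}}"
      using d by (auto simp: Pow_insert)
    finally show ?thesis using simplex_boundary_sphere_retract[of "{x, y, w}"] d by simp
  qed
qed simp

text \<open>All proper subsets of a minimal missing simplex are simplices.\<close>

lemma not_flag_imp_sphere_retract:
  assumes K: "abstract_complex V K" and "\<not> flag_complex V K"
  shows "\<exists>S\<subseteq>V. has_sphere_retract (geometric_realization (full_subcomplex K S))"
proof -
  define Q where "Q = (\<lambda>S. S \<subseteq> V \<and> (\<forall>u\<in>S. \<forall>v\<in>S. u \<noteq> v \<longrightarrow> {u, v} \<in> K) \<and> S \<notin> K)"
  obtain S0 where "Q S0" using assms(2) by (auto simp: flag_complex_def Q_def)
  define S where "S = arg_min card Q"
  have Q: "Q S" and min: "\<And>S'. Q S' \<Longrightarrow> card S \<le> card S'"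
    unfolding S_def using \<open>Q S0\<close> by (auto intro: arg_min_natI arg_min_nat_le)
  have SV: "S \<subseteq> V" and pairs: "\<And>u v. u \<in> S \<Longrightarrow> v \<in> S \<Longrightarrow> u \<noteq> v \<Longrightarrow> {u, v} \<in> K" and SK: "S \<notin> K"
    using Q by (auto simp: Q_def)
  have fin: "finite S" using K SV finite_subset by (auto simp: abstract_complex_def)
  have proper: "J \<in> K" if "J \<subset> S" for J
  proof (rule ccontr)
    assume "J \<notin> K"
    then have "Q J" using that SV pairs unfolding Q_def by blast
    then have "card S \<le> card J" by (rule min)
    then show False using psubset_card_mono[OF fin that] by simp
  qed
  have eq: "full_subcomplex K S = Pow S - {S}"
    using proper SK by (auto simp: full_subcomplex_def)
  have "card S \<ge> 3"
  proof (rule ccontr)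
    assume "\<not> card S \<ge> 3"
    then consider "card S = 0" | "card S = 1" | "card S = 2" by linarith
    then have "S \<in> K"
    proof cases
      case 1
      then show ?thesis using fin K by (simp add: abstract_complex_def)
    next
      case 2
      then obtain v where "S = {v}" by (auto simp: card_1_singleton_iff)
      then show ?thesis using SV K by (auto simp: abstract_complex_def)
    next
      case 3
      then obtain u v where "S = {u, v}" "u \<noteq> v" by (auto simp: card_2_iff)
      then show ?thesis using pairs by auto
    qed
    then show False using SK by simp
  qed
  then show ?thesis using simplex_boundary_sphere_retract[OF fin] SV eq by metis
qed

text \<open>A vertex that is adjacent to both \<open>i\<close> and \<open>i + 1\<close> is congruent to both
\<open>i - 1\<close> and \<open>i + 2\<close>, which forces \<open>n\<close> to divide \<open>3\<close>.\<close>

lemma cyclic_no_triangle: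
  fixes i k n :: nat
  assumes "4 \<le> n" "i < n" "k < n" and j: "j = Suc i mod n"
    and "k \<noteq> i" "k \<noteq> j"
    and "k = Suc i mod n \<or> i = Suc k mod n" and "k = Suc j mod n \<or> j = Suc k mod n"
  shows False
proof -
  have "Suc a mod n = (if Suc a = n then 0 else Suc a)" if "a < n" for a using that by simp
  moreover have "j < n" using assms by simp
  ultimately show False using assms by (simp split: if_splits)
qed

text \<open>Two vertices of a simplex on the cycle are neighbours on the cycle, as there is no chord, and a cycle
with at least four vertices contains no three that are pairwise neighbours.\<close>

lemma chordless_cycle_full_subcomplex:
  assumes K: "abstract_complex V K" and c: "graph_cycle (edges (skeleton 1 K)) c" "length c \<ge> 4"
    and nochord: "\<not> has_chord (edges (skeleton 1 K)) c"
  shows "full_subcomplex K (set c) = cycle_complex c" "set c \<subseteq> V"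
proof -
  let ?n = "length c"
  have E: "e \<in> edges (skeleton 1 K) \<longleftrightarrow> e \<in> K \<and> card e = 2" for e
    by (auto simp: edges_def skeleton_def)
  have down: "\<And>J I. J \<in> K \<Longrightarrow> I \<subseteq> J \<Longrightarrow> I \<in> K" and KV: "K \<subseteq> Pow V"
    and vert: "\<And>v. v \<in> V \<Longrightarrow> {v} \<in> K" and em: "{} \<in> K"
    using K unfolding abstract_complex_def by blast+
  have dist: "distinct c" using c by (simp add: graph_cycle_def)
  have edge: "{c ! i, c ! (Suc i mod ?n)} \<in> K" if "i < ?n" for i
    using c(1) that unfolding graph_cycle_def E by blast
  show cV: "set c \<subseteq> V"
  proof
    fix v assume "v \<in> set c"
    then obtain i where "i < ?n" "v = c ! i" by (auto simp: in_set_conv_nth)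
    then show "v \<in> V" using edge[of i] KV by blast
  qed
  have adj: "j = Suc i mod ?n \<or> i = Suc j mod ?n"
    if "i < ?n" "j < ?n" "i \<noteq> j" "c ! i \<in> J" "c ! j \<in> J" "J \<in> K" for i j J
  proof (rule ccontr)
    assume *: "\<not> ?thesis"
    have "c ! i \<noteq> c ! j" using that dist by (simp add: nth_eq_iff_index_eq)
    moreover have "{c ! i, c ! j} \<in> K" by (rule down[OF that(6)]) (use that in auto)
    ultimately have "{c ! i, c ! j} \<in> edges (skeleton 1 K)" unfolding E by simp
    then show False using nochord * that(1,2,3) unfolding has_chord_def by blast
  qed
  show "full_subcomplex K (set c) = cycle_complex c"
  proof
    show "cycle_complex c \<subseteq> full_subcomplex K (set c)"
    proof
      fix J assume J: "J \<in> cycle_complex c"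
      then have "J \<in> K" using em vert cV edge unfolding cycle_complex_def by blast
      moreover have "J \<subseteq> set c"
      proof
        fix x assume "x \<in> J"
        then have "{x} \<in> cycle_complex c" using cycle_complex_down[OF J, of "{x}"] by simp
        moreover have "c \<noteq> []" using c by auto
        ultimately show "x \<in> set c" by (auto simp: cycle_complex_def)
      qed
      ultimately show "J \<in> full_subcomplex K (set c)" by (simp add: full_subcomplex_def)
    qed
    show "full_subcomplex K (set c) \<subseteq> cycle_complex c"
    proof
      fix J assume "J \<in> full_subcomplex K (set c)"
      then have J: "J \<in> K" "J \<subseteq> set c" by (auto simp: full_subcomplex_def)
      show "J \<in> cycle_complex c"
      proof (cases "\<exists>x\<in>J. \<exists>y\<in>J. x \<noteq> y")
        case False
        then have "J = {} \<or> (\<exists>x. J = {x})" by blast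
        then show ?thesis using J by (auto simp: cycle_complex_def)
      next
        case True
        then obtain x y where xy: "x \<in> J" "y \<in> J" "x \<noteq> y" by blast
        obtain a b where ab: "a < ?n" "c ! a = x" "b < ?n" "c ! b = y"
          using xy J(2) by (metis in_set_conv_nth subsetD)
        then have "a \<noteq> b" using xy by auto
        obtain i where i: "i < ?n" "c ! i \<in> J" "c ! (Suc i mod ?n) \<in> J"
          using adj[OF ab(1,3) \<open>a \<noteq> b\<close> _ _ J(1)] ab xy that by metis
        let ?j = "Suc i mod ?n"
        have j: "?j < ?n" using c by (metis i(1) less_nat_zero_code mod_less_divisor not_gr_zero)
        have "z \<in> {c ! i, c ! ?j}" if z: "z \<in> J" for z
        proof (rule ccontr)
          assume nz: "z \<notin> {c ! i, c ! ?j}"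
          obtain k where k: "k < ?n" "c ! k = z" using z J(2) by (metis in_set_conv_nth subsetD)
          have ki: "k \<noteq> i" "k \<noteq> ?j" using k nz by auto
          have 1: "k = Suc i mod ?n \<or> i = Suc k mod ?n"
            using adj[OF i(1) k(1) ki(1)[symmetric] i(2) _ J(1)] k z by blast
          have 2: "k = Suc ?j mod ?n \<or> ?j = Suc k mod ?n"
            using adj[OF j k(1) ki(2)[symmetric] i(3) _ J(1)] k z by blast
          show False by (rule cyclic_no_triangle[OF c(2) i(1) k(1) refl ki 1 2])
        qed
        then have "J = {c ! i, c ! ?j}" using i by blast
        then show ?thesis using i(1) unfolding cycle_complex_def by blast
      qed
    qed
  qed
qed

theorem homotopy_discrete_imp_flag_chordal:
  assumes K: "abstract_complex V K"
    and discrete: "\<And>I. I \<subseteq> V \<Longrightarrow> homotopy_discrete (geometric_realization (full_subcomplex K I))"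
  shows "flag_complex V K" "chordal (edges (skeleton 1 K))"
proof -
  have no_sphere: False if "S \<subseteq> V" "has_sphere_retract (geometric_realization (full_subcomplex K S))" for S
    using that discrete has_sphere_retract_imp_not_homotopy_discrete by blast
  show "flag_complex V K"
    using not_flag_imp_sphere_retract[OF K] no_sphere by blast
  show "chordal (edges (skeleton 1 K))"
    unfolding chordal_def
  proof (intro allI impI, rule ccontr)
    fix c assume c: "graph_cycle (edges (skeleton 1 K)) c \<and> length c \<ge> 4" "\<not> has_chord (edges (skeleton 1 K)) c"
    then have "has_sphere_retract (geometric_realization (cycle_complex c))"
      by (intro cycle_sphere_retract) (auto simp: graph_cycle_def)
    then show False using chordless_cycle_full_subcomplex[OF K] c no_sphere by metis
  qed
qed

section \<open>The double complex of locally constant functions\<close>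

lemma eps_square [simp]: "eps i I * eps i I = 1"
  by (simp add: eps_def flip: power_add mult_2)

lemma eps_remove:
  assumes "finite I" "j \<in> I" "i \<noteq> j"
  shows "eps i (I - {j}) = (if j < i then - eps i I else eps i I)"
proof (cases "j < i")
  case True
  have "{r \<in> I. r < i} = insert j {r \<in> I - {j}. r < i}" using True assms by auto
  moreover have "j \<notin> {r \<in> I - {j}. r < i}" "finite {r \<in> I - {j}. r < i}" using assms by auto
  ultimately have "card {r \<in> I. r < i} = Suc (card {r \<in> I - {j}. r < i})" by simp
  then show ?thesis using True by (simp add: eps_def)
next
  case False
  then have "{r \<in> I - {j}. r < i} = {r \<in> I. r < i}" using assms by auto
  then show ?thesis using False by (simp add: eps_def)
qed

text \<open>Removing two vertices in the two possible orders gives opposite signs. This identity is behind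
\<open>\<delta>\<delta> = 0\<close>, \<open>d'd' = 0\<close> and the contracting homotopies.\<close>

lemma eps_anticommute:
  assumes "finite I" "i \<in> I" "j \<in> I" "i \<noteq> j"
  shows "eps i I * eps j (I - {i}) = - (eps j I * eps i (I - {j}))"
  using eps_remove[of I i j] eps_remove[of I j i] assms by (auto simp: not_less_iff_gr_or_eq)

lemma eps_singleton [simp]: "eps i {i} = 1"
proof -
  have "{r \<in> {i}. r < i} = {}" by auto
  then show ?thesis by (simp only: eps_def card.empty power_0)
qed

lemma eps_pair:
  assumes "i \<noteq> j"
  shows "eps i {i, j} = - eps j {i, j}"
proof -
  have "{i, j} - {i} = {j}" "{i, j} - {j} = {i}" using assms by auto
  then show ?thesis using eps_anticommute[of "{i, j}" i j] assms by simp
qed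

lemma sum_antisymmetric:
  fixes T :: "'a \<Rightarrow> 'a \<Rightarrow> int"
  assumes "finite A" "\<And>i j. i \<in> A \<Longrightarrow> j \<in> A \<Longrightarrow> i \<noteq> j \<Longrightarrow> T i j = - T j i"
  shows "(\<Sum>i\<in>A. \<Sum>j\<in>A - {i}. T i j) = 0"
proof -
  have off: "(\<Sum>i\<in>A. \<Sum>j\<in>A - {i}. U i j) = (\<Sum>i\<in>A. \<Sum>j\<in>A. if i = j then 0 else U i j)"
    for U :: "'a \<Rightarrow> 'a \<Rightarrow> int"
  proof (rule sum.cong[OF refl])
    show "(\<Sum>j\<in>A - {i}. U i j) = (\<Sum>j\<in>A. if i = j then 0 else U i j)" for i
      using assms(1) by (intro sum.mono_neutral_cong_left) auto
  qed
  have "(\<Sum>i\<in>A. \<Sum>j\<in>A - {i}. T i j) = (\<Sum>i\<in>A. \<Sum>j\<in>A. if i = j then 0 else T i j)" by (rule off)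
  also have "\<dots> = (\<Sum>j\<in>A. \<Sum>i\<in>A. if i = j then 0 else T i j)" by (rule sum.swap)
  also have "\<dots> = (\<Sum>j\<in>A. \<Sum>i\<in>A. - (if j = i then 0 else T j i))"
  proof (rule sum.cong[OF refl], rule sum.cong[OF refl])
    fix j i assume "j \<in> A" "i \<in> A"
    then show "(if i = j then 0 else T i j) = - (if j = i then 0 else T j i)"
      using assms(2)[of i j] by (cases "i = j") simp_all
  qed
  also have "\<dots> = - (\<Sum>i\<in>A. \<Sum>j\<in>A - {i}. T i j)" by (simp add: off sum_negf)
  finally show ?thesis by simp
qed

text \<open>Restriction of functions to a subset does not change their values, so it is left implicit. For
cochains of degree \<open>0\<close> this is \<open>d'\<close> on representatives: the sign in front is \<open>(-1)\<^sup>p\<^sup>+\<^sup>1\<close> with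
\<open>p = 0\<close>.\<close>

definition koszul :: "nat set \<Rightarrow> (nat set \<Rightarrow> 'x \<Rightarrow> int) \<Rightarrow> nat set \<Rightarrow> 'x \<Rightarrow> int" where
  "koszul V g J x = - (\<Sum>i\<in>V - J. eps i (insert i J) * g (insert i J) x)"

lemma koszul_koszul:
  assumes V: "finite V" and J: "finite J"
  shows "koszul V (koszul V g) J x = 0"
proof -
  let ?T = "\<lambda>i k. eps i (insert i J) * (eps k (insert k (insert i J)) * g (insert k (insert i J)) x)"
  have "koszul V (koszul V g) J x = (\<Sum>i\<in>V - J. \<Sum>k\<in>V - insert i J. ?T i k)"
    by (simp add: koszul_def sum_negf sum_distrib_left)
  also have "\<dots> = (\<Sum>i\<in>V - J. \<Sum>k\<in>(V - J) - {i}. ?T i k)"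
    by (intro sum.cong refl) auto
  also have "\<dots> = 0"
  proof (rule sum_antisymmetric)
    fix i k assume ik: "i \<in> V - J" "k \<in> V - J" "i \<noteq> k"
    let ?I = "insert i (insert k J)"
    have eq: "?I - {k} = insert i J" "?I - {i} = insert k J" "insert k (insert i J) = ?I" using ik by auto
    have "eps k ?I * eps i (?I - {k}) = - (eps i ?I * eps k (?I - {i}))"
      using ik J by (intro eps_anticommute) auto
    then have "eps i (insert i J) * eps k ?I = - (eps k (insert k J) * eps i ?I)"
      unfolding eq by (simp only: mult.commute)
    then show "?T i k = - ?T k i"
      unfolding eq by (simp only: mult.assoc[symmetric] mult_minus_left)
  qed (use V in simp)
  finally show ?thesis .
qed

lemma koszul_add: "koszul V (\<lambda>I x. g I x + h I x) J x = koszul V g J x + koszul V h J x"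
  by (simp add: koszul_def distrib_left sum.distrib)

lemma koszul_diff: "koszul V (\<lambda>I x. g I x - h I x) J x = koszul V g J x - koszul V h J x"
  by (simp add: koszul_def right_diff_distrib sum_subtractf)

lemma koszul_single:
  assumes "finite V" "v \<in> V" "v \<notin> J" "\<And>i. i \<in> V - J \<Longrightarrow> i \<noteq> v \<Longrightarrow> g (insert i J) x = 0"
  shows "koszul V g J x = - (eps v (insert v J) * g (insert v J) x)"
proof -
  have "(\<Sum>i\<in>V - J. eps i (insert i J) * g (insert i J) x)
      = (\<Sum>i\<in>{v}. eps i (insert i J) * g (insert i J) x)"
    using assms by (intro sum.mono_neutral_right) auto
  then show ?thesis by (simp add: koszul_def)
qed

definition locally_constant :: "nat set set \<Rightarrow> nat set \<Rightarrow> (nat \<Rightarrow> int) \<Rightarrow> bool" where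
  "locally_constant K I f \<longleftrightarrow> (\<forall>a\<in>I. \<forall>b\<in>I. {a, b} \<in> K \<longrightarrow> f a = f b)"

text \<open>The component of \<open>koszul\<close> on a one-element set is a function on one point, hence zero modulo
constants. The sum of its values is an invariant of a family on two-element sets that is lost by
passing to classes in the target.\<close>

definition pair_sum :: "nat set \<Rightarrow> (nat set \<Rightarrow> nat \<Rightarrow> int) \<Rightarrow> int" where
  "pair_sum V g = (\<Sum>j\<in>V. koszul V g {j} j)"

lemma locally_constant_koszul:
  assumes "\<And>i. i \<in> V - J \<Longrightarrow> locally_constant K (insert i J) (g (insert i J))"
  shows "locally_constant K J (koszul V g J)"
  unfolding locally_constant_def koszul_def
proof (intro ballI impI arg_cong[of _ _ uminus] sum.cong refl)
  fix a b i assume "a \<in> J" "b \<in> J" "{a, b} \<in> K" "i \<in> V - J"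
  then show "eps i (insert i J) * g (insert i J) a = eps i (insert i J) * g (insert i J) b"
    using assms[of i] by (simp add: locally_constant_def)
qed

text \<open>Here \<open>N\<close> is the set of neighbours of the simplicial vertex \<open>v\<close>, and \<open>u\<close> is a vertex outside the
closed star of \<open>v\<close>. All results concern the complex of families of functions \<open>g I\<close> that are locally
constant on \<open>I\<close>, with differential \<open>koszul V\<close>, modulo families of constants.\<close>

locale simplicial_vertex =
  fixes V :: "nat set" and K :: "nat set set" and v :: nat and N :: "nat set" and u :: nat
  assumes finV: "finite V" and v: "v \<in> V" "v \<notin> N" and u: "u \<in> V" "u \<noteq> v" "u \<notin> N"
    and clique: "\<And>a b. a \<in> N \<Longrightarrow> b \<in> N \<Longrightarrow> {a, b} \<in> K"
    and nbr: "\<And>a. {v, a} \<in> K \<longleftrightarrow> a \<in> insert v N"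
begin

text \<open>Extends a function over \<open>v\<close>. A locally constant function takes the same value at all neighbours of
\<open>v\<close> in \<open>I\<close>, because these form a clique; giving \<open>v\<close> this value keeps it locally constant.\<close>

definition extend :: "nat set \<Rightarrow> (nat \<Rightarrow> int) \<Rightarrow> nat \<Rightarrow> int" where
  "extend I f = f(v := if I \<inter> N = {} then 0 else f (SOME j. j \<in> I \<inter> N))"

lemma locally_constant_extend:
  assumes f: "locally_constant K I f" and "v \<notin> I"
  shows "locally_constant K (insert v I) (extend I f)"
proof -
  have nb: "extend I f v = f a" if "a \<in> I" "{v, a} \<in> K" for a
  proof -
    have a: "a \<in> I \<inter> N" using that nbr[of a] \<open>v \<notin> I\<close> by auto
    then have s: "(SOME j. j \<in> I \<inter> N) \<in> I \<inter> N" by (rule someI)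
    then have "f (SOME j. j \<in> I \<inter> N) = f a"
      using f clique a unfolding locally_constant_def by blast
    then show ?thesis using a by (auto simp: extend_def)
  qed
  have other: "extend I f a = f a" if "a \<in> I" for a using that \<open>v \<notin> I\<close> by (auto simp: extend_def)
  show ?thesis
    unfolding locally_constant_def
  proof (intro ballI impI)
    fix a b assume ab: "a \<in> insert v I" "b \<in> insert v I" "{a, b} \<in> K"
    consider "a = v" "b = v" | "a = v" "b \<in> I" | "a \<in> I" "b = v" | "a \<in> I" "b \<in> I" using ab by blast
    then show "extend I f a = extend I f b"
    proof cases
      case 2
      then show ?thesis using nb[of b] other[of b] ab by simp
    next
      case 3
      then show ?thesis using nb[of a] other[of a] ab by (simp add: insert_commute)
    next
      case 4
      then show ?thesis using f ab other by (simp add: locally_constant_def)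
    qed simp
  qed
qed

text \<open>On a set \<open>I\<close> without \<open>v\<close>, the differential of a family supported on the sets that contain \<open>v\<close> has
only the term for \<open>I \<union> {v}\<close>. So extending the functions over \<open>v\<close> solves the equation.\<close>

proposition koszul_kills_off_star:
  assumes g: "\<And>I. I \<subseteq> V \<Longrightarrow> card I = l \<Longrightarrow> locally_constant K I (g I)"
  obtains h where "\<And>I. I \<subseteq> V \<Longrightarrow> card I = Suc l \<Longrightarrow> locally_constant K I (h I)"
    "\<And>I x. I \<subseteq> V \<Longrightarrow> v \<notin> I \<Longrightarrow> x \<in> I \<Longrightarrow> koszul V h I x = g I x"
proof
  define h where "h = (\<lambda>I x. if v \<in> I then - eps v I * extend (I - {v}) (g (I - {v})) x else 0)"
  show "locally_constant K I (h I)" if I: "I \<subseteq> V" "card I = Suc l" for I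
  proof (cases "v \<in> I")
    case True
    have "card (I - {v}) = l" using True I finV finite_subset by (simp add: card_Diff_singleton)
    then have "locally_constant K (I - {v}) (g (I - {v}))" using I by (intro g) auto
    then have "locally_constant K (insert v (I - {v})) (extend (I - {v}) (g (I - {v})))"
      by (rule locally_constant_extend) simp
    then show ?thesis using True by (simp add: h_def locally_constant_def insert_absorb)
  qed (simp add: h_def locally_constant_def)
  show "koszul V h I x = g I x" if I: "I \<subseteq> V" "v \<notin> I" "x \<in> I" for I x
  proof -
    have "koszul V h I x = - (eps v (insert v I) * h (insert v I) x)"
      using I finV v by (intro koszul_single) (auto simp: h_def)
    also have "\<dots> = eps v (insert v I) * eps v (insert v I) * g I x"
      using I by (auto simp: h_def extend_def)
    finally show ?thesis by simp
  qed
qed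

text \<open>Modulo constants, such a family is given by integers \<open>a J\<close>: on \<open>J \<union> {v}\<close> it is \<open>a J\<close> times the
indicator function of \<open>v\<close>, and \<open>a J = 0\<close> if \<open>J\<close> contains a neighbour of \<open>v\<close>. The cocycle condition
makes \<open>a\<close> a cycle in the chain complex of the full simplex on the non-neighbours \<open>W\<close>. Its component
at the empty set is no consequence of the cocycle condition, since functions on \<open>{v}\<close> are constant;
this is the extra hypothesis on \<open>pair_sum\<close> for \<open>l = 2\<close>. The cone from \<open>u\<close> bounds the cycle.\<close>

proposition koszul_exact_on_star:
  assumes l: "2 \<le> l" and g: "\<And>I. I \<subseteq> V \<Longrightarrow> card I = l \<Longrightarrow> locally_constant K I (g I)"
    and off: "\<And>I x. I \<subseteq> V \<Longrightarrow> card I = l \<Longrightarrow> v \<notin> I \<Longrightarrow> x \<in> I \<Longrightarrow> g I x = 0"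
    and cocycle: "\<And>J x y. J \<subseteq> V \<Longrightarrow> card J = l - 1 \<Longrightarrow> x \<in> J \<Longrightarrow> y \<in> J \<Longrightarrow> koszul V g J x = koszul V g J y"
    and pairs: "l = 2 \<Longrightarrow> pair_sum V g = 0"
  obtains h where "\<And>I. I \<subseteq> V \<Longrightarrow> card I = Suc l \<Longrightarrow> locally_constant K I (h I)"
    "\<And>I x y. I \<subseteq> V \<Longrightarrow> card I = l \<Longrightarrow> x \<in> I \<Longrightarrow> y \<in> I \<Longrightarrow> g I x - koszul V h I x = g I y - koszul V h I y"
proof
  have fin: "finite I" if "I \<subseteq> V" for I using that finV finite_subset by blast
  define W where "W = V - N - {v}"
  have uW: "u \<in> W" using u by (simp add: W_def)
  \<comment> \<open>By \<open>const\<close> below, the value at the chosen \<open>j\<close> is the common value on \<open>J\<close>.\<close>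
  define a where "a = (\<lambda>J. g (insert v J) v - g (insert v J) (SOME j. j \<in> J))"
  have const: "g (insert v J) x = g (insert v J) y"
    if J: "J \<subseteq> V" "v \<notin> J" "card J = l - 1" "x \<in> J" "y \<in> J" for J x y
  proof -
    have k: "koszul V g J z = - (eps v (insert v J) * g (insert v J) z)" if "z \<in> J" for z
    proof (rule koszul_single[OF finV v(1) J(2)])
      fix i assume i: "i \<in> V - J" "i \<noteq> v"
      have "card (insert i J) = l" using i J l fin by simp
      then show "g (insert i J) z = 0" using i J that by (intro off) auto
    qed
    have "eps v (insert v J) * g (insert v J) x = eps v (insert v J) * g (insert v J) y"
      using cocycle[OF J(1,3,4,5)] k[OF J(4)] k[OF J(5)] by simp
    moreover have "eps v (insert v J) \<noteq> 0" by (simp add: eps_def)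
    ultimately show ?thesis by simp
  qed
  have a_diff: "g (insert v J) v - g (insert v J) x = a J"
    if J: "J \<subseteq> V" "v \<notin> J" "card J = l - 1" "x \<in> J" for J x
  proof -
    have "(SOME j. j \<in> J) \<in> J" using J(4) by (rule someI)
    then show ?thesis using const[OF J(1-4)] by (simp add: a_def)
  qed
  have a_zero: "a J = 0" if J: "J \<subseteq> V" "v \<notin> J" "card J = l - 1" "\<not> J \<subseteq> W" for J
  proof -
    obtain x where x: "x \<in> J" "x \<in> N" using J by (auto simp: W_def)
    obtain I where I: "I = insert v J" by simp
    have "locally_constant K I (g I)" using J v l fin I by (intro g) auto
    moreover have "{v, x} \<in> K" using x nbr by simp
    ultimately have "g I v = g I x" using x I by (auto simp: locally_constant_def)
    then show ?thesis using a_diff[OF J(1-3) x(1)] I by simp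
  qed
  have cycle: "(\<Sum>i\<in>V - insert v J. eps i (insert i (insert v J)) * a (insert i J)) = 0"
    if J: "J \<subseteq> V" "v \<notin> J" "card J = l - 2" for J
  proof -
    have vJ: "insert v J \<subseteq> V" "card (insert v J) = l - 1" using J v l fin by auto
    have cardi: "card (insert i J) = l - 1" "insert i J \<subseteq> V" "v \<notin> insert i J"
      if "i \<in> V - insert v J" for i using that J l fin by auto
    have comm: "insert i (insert v J) = insert v (insert i J)" for i by auto
    show ?thesis
    proof (cases "J = {}")
      case False
      then obtain x where x: "x \<in> J" by blast
      have "koszul V g (insert v J) x - koszul V g (insert v J) v =
          (\<Sum>i\<in>V - insert v J. eps i (insert i (insert v J)) *
             (g (insert i (insert v J)) v - g (insert i (insert v J)) x))"
        by (simp add: koszul_def right_diff_distrib sum_subtractf)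
      also have "\<dots> = (\<Sum>i\<in>V - insert v J. eps i (insert i (insert v J)) * a (insert i J))"
      proof (rule sum.cong[OF refl])
        fix i assume i: "i \<in> V - insert v J"
        have "g (insert i (insert v J)) v - g (insert i (insert v J)) x = a (insert i J)"
          unfolding comm using x by (intro a_diff cardi[OF i]) auto
        then show "eps i (insert i (insert v J)) * (g (insert i (insert v J)) v - g (insert i (insert v J)) x) =
          eps i (insert i (insert v J)) * a (insert i J)" by simp
      qed
      finally show ?thesis using cocycle[OF vJ, of x v] x by simp
    next
      case True
      then have l2: "l = 2" using J l by simp
      have single: "koszul V g {j} j = eps j {j, v} * g {j, v} j" if j: "j \<in> V - {v}" for j
      proof -
        have "koszul V g {j} j = - (eps v (insert v {j}) * g (insert v {j}) j)"
          using j v finV l2 by (intro koszul_single) (auto intro!: off)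
        moreover have "eps v {v, j} = - eps j {v, j}" using j by (intro eps_pair) auto
        ultimately show ?thesis by (simp add: insert_commute)
      qed
      have "pair_sum V g = koszul V g {v} v + (\<Sum>j\<in>V - {v}. koszul V g {j} j)"
        using finV v by (simp add: pair_sum_def sum.remove)
      also have "\<dots> = - (\<Sum>j\<in>V - {v}. eps j {j, v} * (g {j, v} v - g {j, v} j))"
        using single by (simp add: koszul_def right_diff_distrib sum_subtractf)
      also have "\<dots> = - (\<Sum>j\<in>V - {v}. eps j {j, v} * a {j})"
      proof -
        have "g {j, v} v - g {j, v} j = a {j}" if "j \<in> V - {v}" for j
          using a_diff[of "{j}" j] that l2 by (simp add: insert_commute)
        then show ?thesis by simp
      qed
      finally show ?thesis using pairs[OF l2] True by simp
    qed
  qed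
  \<comment> \<open>The cone from \<open>u\<close>. The signs refer to sets that contain \<open>v\<close>, because these index the family.\<close>
  define b where "b = (\<lambda>I. if u \<in> I \<and> I \<subseteq> W then - (eps u (insert v I) * a (I - {u})) else 0)"
  have boundary: "- (\<Sum>i\<in>V - insert v J. eps i (insert i (insert v J)) * b (insert i J)) = a J"
    if J: "J \<subseteq> V" "v \<notin> J" "card J = l - 1" for J
  proof (cases "J \<subseteq> W")
    case False
    then show ?thesis using a_zero[OF J] by (simp add: b_def)
  next
    case JW: True
    show ?thesis
    proof (cases "u \<in> J")
      case False
      have "(\<Sum>i\<in>V - insert v J. eps i (insert i (insert v J)) * b (insert i J)) =
            (\<Sum>i\<in>{u}. eps i (insert i (insert v J)) * b (insert i J))"
        using finV u False by (intro sum.mono_neutral_right) (auto simp: b_def)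
      also have "\<dots> = - (eps u (insert u (insert v J)) * eps u (insert u (insert v J)) * a J)"
        using False JW uW by (simp add: b_def insert_commute mult.assoc)
      finally show ?thesis by simp
    next
      case True
      let ?J' = "J - {u}"
      have J': "?J' \<subseteq> V" "v \<notin> ?J'" "card ?J' = l - 2" using J True fin[OF J(1)] by (auto simp: card_Diff_singleton)
      have "V - insert v ?J' = insert u (V - insert v J)" using True u by auto
      then have "0 = eps u (insert u (insert v ?J')) * a (insert u ?J') +
          (\<Sum>i\<in>V - insert v J. eps i (insert i (insert v ?J')) * a (insert i ?J'))"
        using cycle[OF J'] finV True by simp
      moreover have "insert u ?J' = J" "insert u (insert v ?J') = insert v J" using True by auto
      ultimately have aJ: "eps u (insert v J) * a J =
          - (\<Sum>i\<in>V - insert v J. eps i (insert i (insert v ?J')) * a (insert i ?J'))" by simp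
      have "- (\<Sum>i\<in>V - insert v J. eps i (insert i (insert v J)) * b (insert i J)) =
         - (eps u (insert v J) * (\<Sum>i\<in>V - insert v J. eps i (insert i (insert v ?J')) * a (insert i ?J')))"
        unfolding sum_distrib_left
      proof (intro arg_cong[of _ _ uminus] sum.cong refl)
        fix i assume i: "i \<in> V - insert v J"
        have iu: "i \<noteq> u" "insert i J - {u} = insert i ?J'" using i True by auto
        let ?I = "insert i (insert v J)"
        have e: "eps i ?I * eps u ?I = - (eps u (insert v J) * eps i (insert i (insert v ?J')))"
        proof -
          have d: "?I - {i} = insert v J" "?I - {u} = insert i (insert v ?J')" using i True iu u by auto
          have "eps i ?I * eps u (insert v J) = - (eps u ?I * eps i (insert i (insert v ?J')))"
            using eps_anticommute[of ?I i u] i True iu fin[OF J(1)] unfolding d by simp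
          then have "eps u ?I * (eps i ?I * eps u (insert v J)) * eps u (insert v J) =
              - ((eps u ?I * eps u ?I) * eps i (insert i (insert v ?J')) * eps u (insert v J))"
            by (simp add: mult.assoc)
          moreover have "eps u ?I * (eps i ?I * eps u (insert v J)) * eps u (insert v J) =
              eps i ?I * eps u ?I * (eps u (insert v J) * eps u (insert v J))" by (simp only: mult_ac)
          ultimately show ?thesis by (simp add: mult_ac)
        qed
        show "eps i ?I * b (insert i J) = eps u (insert v J) * (eps i (insert i (insert v ?J')) * a (insert i ?J'))"
        proof (cases "i \<in> W")
          case True
          then have "b (insert i J) = - (eps u (insert v (insert i J)) * a (insert i ?J'))"
            using JW \<open>u \<in> J\<close> iu by (simp add: b_def)
          moreover have "insert v (insert i J) = ?I" by auto
          ultimately have "eps i ?I * b (insert i J) = - (eps i ?I * eps u ?I) * a (insert i ?J')" by simp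
          then show ?thesis unfolding e by simp
        next
          case False
          then have "b (insert i J) = 0" by (simp add: b_def)
          moreover have "a (insert i ?J') = 0"
          proof (rule a_zero)
            show "card (insert i ?J') = l - 1"
              using i J' fin[OF J'(1)] l by auto
          qed (use i J' False in auto)
          ultimately show ?thesis by simp
        qed
      qed
      also have "\<dots> = eps u (insert v J) * (eps u (insert v J) * a J)" unfolding aJ by simp
      also have "\<dots> = a J" by (simp flip: mult.assoc)
      finally show ?thesis .
    qed
  qed
  define h where "h = (\<lambda>I x. if x = v \<and> v \<in> I then b (I - {v}) else 0)"
  show "locally_constant K I (h I)" for I
  proof (cases "I - {v} \<subseteq> W")
    case True
    have ne: "{v, x} \<notin> K" "{x, v} \<notin> K" if "x \<in> I" "x \<noteq> v" for x
    proof -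
      show "{v, x} \<notin> K" using nbr[of x] that True by (auto simp: W_def)
      then show "{x, v} \<notin> K" by (simp add: insert_commute)
    qed
    show ?thesis
      unfolding locally_constant_def
    proof (intro ballI impI)
      fix x y assume "x \<in> I" "y \<in> I" "{x, y} \<in> K"
      then have "x = y \<or> x \<noteq> v \<and> y \<noteq> v" using ne by blast
      then show "h I x = h I y" by (auto simp: h_def)
    qed
  qed (auto simp: h_def b_def locally_constant_def)
  show "g I x - koszul V h I x = g I y - koszul V h I y"
    if I: "I \<subseteq> V" "card I = l" "x \<in> I" "y \<in> I" for I x y
  proof (cases "v \<in> I")
    case False
    have "koszul V h I z = 0" if "z \<in> I" for z
      using that False by (auto simp: koszul_def h_def intro!: sum.neutral)
    then show ?thesis using off[OF I(1,2) False] I by simp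
  next
    case True
    let ?J = "I - {v}"
    have J: "?J \<subseteq> V" "v \<notin> ?J" "card ?J = l - 1" "insert v ?J = I"
      using I True fin[OF I(1)] by (auto simp: card_Diff_singleton)
    have kv: "koszul V h I v = a ?J"
    proof -
      have "koszul V h I v = - (\<Sum>i\<in>V - insert v ?J. eps i (insert i (insert v ?J)) * b (insert i ?J))"
        unfolding koszul_def J(4)
      proof (intro arg_cong[of _ _ uminus] sum.cong refl)
        fix i assume "i \<in> V - I"
        then have "insert i I - {v} = insert i ?J" using True by auto
        then show "eps i (insert i I) * h (insert i I) v = eps i (insert i I) * b (insert i ?J)"
          using True by (simp add: h_def)
      qed
      then show ?thesis using boundary[OF J(1-3)] by simp
    qed
    have k0: "koszul V h I z = 0" if "z \<noteq> v" for z using that by (simp add: koszul_def h_def)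
    obtain w where w: "w \<in> ?J"
    proof -
      have "card ?J > 0" using J l by simp
      then show ?thesis using that by (metis card_gt_0_iff ex_in_conv)
    qed
    have "g I z - koszul V h I z = g I w" if "z \<in> I" for z
    proof (cases "z = v")
      case True
      then show ?thesis using a_diff[OF J(1-3) w] kv J(4) by simp
    next
      case False
      then show ?thesis using const[OF J(1-3), of z w] that w J(4) k0 by simp
    qed
    then show ?thesis using I by simp
  qed
qed

text \<open>The two steps combine: first the components away from \<open>v\<close> are removed, which affects neither the
differential nor its \<open>pair_sum\<close> because \<open>koszul\<close> squares to zero.\<close>

proposition koszul_exact:
  assumes l: "2 \<le> l" and g: "\<And>I. I \<subseteq> V \<Longrightarrow> card I = l \<Longrightarrow> locally_constant K I (g I)"
    and cocycle: "\<And>J x y. J \<subseteq> V \<Longrightarrow> card J = l - 1 \<Longrightarrow> x \<in> J \<Longrightarrow> y \<in> J \<Longrightarrow> koszul V g J x = koszul V g J y"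
    and pairs: "l = 2 \<Longrightarrow> pair_sum V g = 0"
  obtains h where "\<And>I. I \<subseteq> V \<Longrightarrow> card I = Suc l \<Longrightarrow> locally_constant K I (h I)"
    "\<And>I x y. I \<subseteq> V \<Longrightarrow> card I = l \<Longrightarrow> x \<in> I \<Longrightarrow> y \<in> I \<Longrightarrow> g I x - koszul V h I x = g I y - koszul V h I y"
proof -
  have fin: "finite I" if "I \<subseteq> V" for I using that finV finite_subset by blast
  obtain h1 where h1: "\<And>I. I \<subseteq> V \<Longrightarrow> card I = Suc l \<Longrightarrow> locally_constant K I (h1 I)"
    and kill: "\<And>I x. I \<subseteq> V \<Longrightarrow> v \<notin> I \<Longrightarrow> x \<in> I \<Longrightarrow> koszul V h1 I x = g I x"
    by (rule koszul_kills_off_star[OF g], assumption+, rule that, assumption+)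
  define g1 where "g1 = (\<lambda>I x. g I x - koszul V h1 I x)"
  have g1_lc: "locally_constant K I (g1 I)" if I: "I \<subseteq> V" "card I = l" for I
  proof -
    have "locally_constant K I (koszul V h1 I)"
      using h1 I fin by (intro locally_constant_koszul) auto
    then show ?thesis using g[OF I] unfolding g1_def locally_constant_def by metis
  qed
  have kg1: "koszul V g1 J x = koszul V g J x" if "J \<subseteq> V" for J x
    using koszul_koszul[OF finV fin[OF that]] by (simp add: g1_def koszul_diff)
  have g1_pairs: "pair_sum V g1 = pair_sum V g"
    unfolding pair_sum_def by (intro sum.cong refl kg1) auto
  have g1_closed: "koszul V g1 J x = koszul V g1 J y"
    if "J \<subseteq> V" "card J = l - 1" "x \<in> J" "y \<in> J" for J x y
    using cocycle[OF that] kg1[OF that(1)] by simp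
  have g1_off: "g1 I x = 0" if "I \<subseteq> V" "v \<notin> I" "x \<in> I" for I x
    using kill[OF that] by (simp add: g1_def)
  obtain h2 where h2: "\<And>I. I \<subseteq> V \<Longrightarrow> card I = Suc l \<Longrightarrow> locally_constant K I (h2 I)"
    and g1h2: "\<And>I x y. I \<subseteq> V \<Longrightarrow> card I = l \<Longrightarrow> x \<in> I \<Longrightarrow> y \<in> I \<Longrightarrow>
      g1 I x - koszul V h2 I x = g1 I y - koszul V h2 I y"
  proof (rule koszul_exact_on_star[OF l, of g1])
    show "pair_sum V g1 = 0" if "l = 2" using pairs[OF that] g1_pairs by simp
    show "locally_constant K I (g1 I)" if "I \<subseteq> V" "card I = l" for I by (rule g1_lc[OF that])
    show "g1 I x = 0" if "I \<subseteq> V" "card I = l" "v \<notin> I" "x \<in> I" for I x by (rule g1_off[OF that(1,3,4)])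
    show "koszul V g1 J x = koszul V g1 J y"
      if "J \<subseteq> V" "card J = l - 1" "x \<in> J" "y \<in> J" for J x y by (rule g1_closed[OF that])
  qed (rule that)
  let ?h = "\<lambda>I x. h1 I x + h2 I x"
  show thesis
  proof (rule that[of ?h])
    show "locally_constant K I (?h I)" if "I \<subseteq> V" "card I = Suc l" for I
      using h1[OF that] h2[OF that] unfolding locally_constant_def by metis
    show "g I x - koszul V ?h I x = g I y - koszul V ?h I y"
      if "I \<subseteq> V" "card I = l" "x \<in> I" "y \<in> I" for I x y
      using g1h2[OF that] by (simp add: koszul_add g1_def)
  qed
qed

end

lemma pair_sum_expand: "pair_sum V g = - (\<Sum>j\<in>V. \<Sum>i\<in>V - {j}. eps i {i, j} * g {i, j} j)"
  by (simp add: pair_sum_def koszul_def sum_negf)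

text \<open>The contributions of a constant on \<open>{i, j}\<close> at \<open>i\<close> and at \<open>j\<close> have opposite signs.\<close>

lemma pair_sum_mod_constants:
  assumes "finite V" and "\<And>I. I \<subseteq> V \<Longrightarrow> card I = 2 \<Longrightarrow> \<exists>c. \<forall>x\<in>I. g I x = h I x + c"
  shows "pair_sum V g = pair_sum V h"
proof -
  obtain c where c: "\<And>I x. I \<subseteq> V \<Longrightarrow> card I = 2 \<Longrightarrow> x \<in> I \<Longrightarrow> g I x = h I x + c I"
    using assms(2) by metis
  have "(\<Sum>j\<in>V. \<Sum>i\<in>V - {j}. eps i {i, j} * g {i, j} j) =
      (\<Sum>j\<in>V. \<Sum>i\<in>V - {j}. eps i {i, j} * h {i, j} j + eps i {i, j} * c {i, j})"
  proof (rule sum.cong[OF refl], rule sum.cong[OF refl])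
    fix j i assume "j \<in> V" "i \<in> V - {j}"
    then have "g {i, j} j = h {i, j} j + c {i, j}" by (intro c) auto
    then show "eps i {i, j} * g {i, j} j = eps i {i, j} * h {i, j} j + eps i {i, j} * c {i, j}"
      by (simp add: distrib_left)
  qed
  also have "\<dots> = (\<Sum>j\<in>V. \<Sum>i\<in>V - {j}. eps i {i, j} * h {i, j} j)
      + (\<Sum>j\<in>V. \<Sum>i\<in>V - {j}. eps i {i, j} * c {i, j})"
    by (simp add: sum.distrib)
  also have "(\<Sum>j\<in>V. \<Sum>i\<in>V - {j}. eps i {i, j} * c {i, j}) = 0"
  proof (rule sum_antisymmetric[OF assms(1)])
    fix j i :: nat assume "j \<noteq> i"
    then show "eps i {i, j} * c {i, j} = - (eps j {j, i} * c {j, i})"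
      using eps_pair[of i j] by (simp add: insert_commute)
  qed
  finally show ?thesis by (simp add: pair_sum_expand)
qed

section \<open>Reduced cohomology groups and restriction maps\<close>

definition down_closed :: "nat set set \<Rightarrow> bool" where
  "down_closed L \<longleftrightarrow> (\<forall>J\<in>L. finite J \<and> (\<forall>I. I \<subseteq> J \<longrightarrow> I \<in> L))"

text \<open>The simplicial coboundary as a function on all finite sets. It allows computing with cochains that
are not restricted to the simplices of one complex.\<close>

definition differential :: "(nat set \<Rightarrow> int) \<Rightarrow> nat set \<Rightarrow> int" where
  "differential f J = (\<Sum>j\<in>J. eps j J * f (J - {j}))"

lemma differential_differential:
  assumes "finite J"
  shows "differential (differential f) J = 0"
proof -
  let ?T = "\<lambda>j i. eps j J * (eps i (J - {j}) * f (J - {j} - {i}))"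
  have "differential (differential f) J = (\<Sum>j\<in>J. \<Sum>i\<in>J - {j}. ?T j i)"
    by (simp add: differential_def sum_distrib_left)
  also have "\<dots> = 0"
  proof (rule sum_antisymmetric[OF assms])
    fix j i assume ij: "j \<in> J" "i \<in> J" "j \<noteq> i"
    have "eps j J * eps i (J - {j}) = - (eps i J * eps j (J - {i}))"
      by (rule eps_anticommute[OF assms ij])
    moreover have "J - {j} - {i} = J - {i} - {j}" by auto
    ultimately show "?T j i = - ?T i j" by (simp only: mult.assoc[symmetric] mult_minus_left)
  qed
  finally show ?thesis .
qed

lemma differential_cong: "(\<And>j. j \<in> J \<Longrightarrow> f (J - {j}) = g (J - {j})) \<Longrightarrow> differential f J = differential g J"
  by (simp add: differential_def)

lemma differential_add: "differential (\<lambda>I. f I + g I) J = differential f J + differential g J"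
  by (simp add: differential_def distrib_left sum.distrib)

lemma differential_diff: "differential (\<lambda>I. f I - g I) J = differential f J - differential g J"
  by (simp add: differential_def right_diff_distrib sum_subtractf)

lemma differential_sum: "differential (\<lambda>I. \<Sum>x\<in>A. c x * f x I) J = (\<Sum>x\<in>A. c x * differential (f x) J)"
  unfolding differential_def sum_distrib_left
  by (subst sum.swap) (simp add: mult_ac)

lemma face_simplices:
  assumes "down_closed L" "J \<in> simplices p L" "j \<in> J"
  shows "J - {j} \<in> simplices (p - 1) L"
proof -
  have JL: "J \<in> L" "int (card J) = p + 1" using assms(2) by (simp_all add: simplices_def)
  have J: "finite J" "J - {j} \<in> L" using assms(1) JL(1) by (simp_all add: down_closed_def)
  moreover have "card J > 0" using J(1) assms(3) by (auto simp: card_gt_0_iff)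
  ultimately show ?thesis using assms(3) JL by (simp add: simplices_def card_Diff_singleton)
qed

definition cocycles :: "int \<Rightarrow> nat set set \<Rightarrow> (nat set \<Rightarrow> int) set" where
  "cocycles p L = {f \<in> extensional (simplices p L). \<forall>J\<in>simplices (p + 1) L. differential f J = 0}"

definition cocycle_group :: "int \<Rightarrow> nat set set \<Rightarrow> (nat set \<Rightarrow> int) monoid" where
  "cocycle_group p L = cochain_group p L\<lparr>carrier := cocycles p L\<rparr>"

definition coclass :: "int \<Rightarrow> nat set set \<Rightarrow> (nat set \<Rightarrow> int) \<Rightarrow> (nat set \<Rightarrow> int) set" where
  "coclass p L f = coboundaries p L #>\<^bsub>cochain_group p L\<^esub> f"

lemma cocycle_group_simps [simp]:
  "carrier (cocycle_group p L) = cocycles p L"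
  "\<one>\<^bsub>cocycle_group p L\<^esub> = (\<lambda>s\<in>simplices p L. 0)"
  "f \<otimes>\<^bsub>cocycle_group p L\<^esub> g = (\<lambda>s\<in>simplices p L. f s + g s)"
  by (simp_all add: cocycle_group_def cochain_group_def)

lemma differential_restrict:
  assumes "down_closed L" "J \<in> simplices (p + 1) L"
  shows "differential (\<lambda>s\<in>simplices p L. f s) J = differential f J"
  using face_simplices[OF assms] by (intro differential_cong) simp

lemma restrict_cocycle:
  assumes "down_closed L" "\<And>J. J \<in> simplices (p + 1) L \<Longrightarrow> differential f J = 0"
  shows "(\<lambda>s\<in>simplices p L. f s) \<in> cocycles p L"
  unfolding cocycles_def using assms differential_restrict[OF assms(1)] by simp

lemma cocycle_differential: "f \<in> cocycles p L \<Longrightarrow> J \<in> simplices (p + 1) L \<Longrightarrow> differential f J = 0"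
  by (simp add: cocycles_def)

lemma cocycle_restrict_eq: "f \<in> cocycles p L \<Longrightarrow> (\<lambda>s\<in>simplices p L. f s) = f"
  by (simp add: cocycles_def extensional_restrict)

lemma coboundary_kernel:
  assumes "down_closed L"
  shows "kernel (cochain_group p L) (cochain_group (p + 1) L) (coboundary p L) = cocycles p L"
proof -
  have "coboundary p L f = (\<lambda>s\<in>simplices (p + 1) L. 0) \<longleftrightarrow> (\<forall>J\<in>simplices (p + 1) L. differential f J = 0)" for f
    unfolding coboundary_def differential_def[symmetric] by (auto simp: fun_eq_iff restrict_def)
  then show ?thesis
    by (auto simp: kernel_def cochain_group_def cocycles_def PiE_def)
qed

lemma reduced_cohomology_eq:
  assumes "down_closed L"
  shows "reduced_cohomology p L = cocycle_group p L Mod coboundaries p L"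
  unfolding reduced_cohomology_def cohomology_at_def coboundary_kernel[OF assms] cocycle_group_def
    coboundaries_def ..

text \<open>Since the faces of simplices of \<open>L\<close> lie in \<open>L\<close>, arbitrary functions have the same coboundaries as the
cochains on \<open>L\<close>.\<close>

lemma coboundaries_iff:
  assumes "down_closed L"
  shows "b \<in> coboundaries p L \<longleftrightarrow> (\<exists>c. b = (\<lambda>J\<in>simplices p L. differential c J))"
proof
  assume "b \<in> coboundaries p L"
  then obtain c where "b = coboundary (p - 1) L c" by (auto simp: coboundaries_def)
  then show "\<exists>c. b = (\<lambda>J\<in>simplices p L. differential c J)"
    by (auto simp: coboundary_def differential_def)
next
  assume "\<exists>c. b = (\<lambda>J\<in>simplices p L. differential c J)"
  then obtain c where c: "b = (\<lambda>J\<in>simplices p L. differential c J)" by blast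
  let ?c = "\<lambda>s\<in>simplices (p - 1) L. c s"
  have "b = coboundary (p - 1) L ?c"
    unfolding c coboundary_def differential_def[symmetric]
    using differential_restrict[OF assms, of _ "p - 1" c] by (auto simp: restrict_def fun_eq_iff)
  moreover have "?c \<in> carrier (cochain_group (p - 1) L)" by (simp add: cochain_group_def)
  ultimately show "b \<in> coboundaries p L" unfolding coboundaries_def by blast
qed

lemma add_cocycles:
  assumes "down_closed L" "f \<in> cocycles p L" "g \<in> cocycles p L"
  shows "(\<lambda>s\<in>simplices p L. f s + g s) \<in> cocycles p L"
  by (rule restrict_cocycle[OF assms(1)])
    (simp add: differential_add cocycle_differential[OF assms(2)] cocycle_differential[OF assms(3)])

lemma comm_group_cocycle_group:
  assumes L: "down_closed L"
  shows "comm_group (cocycle_group p L)"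
proof (rule comm_groupI; (simp only: cocycle_group_simps)?)
  fix f g assume f: "f \<in> cocycles p L" and g: "g \<in> cocycles p L"
  show "(\<lambda>s\<in>simplices p L. f s + g s) \<in> cocycles p L" by (rule add_cocycles[OF L f g])
  show "(\<lambda>s\<in>simplices p L. f s + g s) = (\<lambda>s\<in>simplices p L. g s + f s)"
    by (simp add: add.commute)
next
  show "(\<lambda>s\<in>simplices p L. 0) \<in> cocycles p L"
    by (rule restrict_cocycle[OF L]) (simp add: differential_def)
next
  fix f g h :: "nat set \<Rightarrow> int"
  show "(\<lambda>s\<in>simplices p L. (\<lambda>s\<in>simplices p L. f s + g s) s + h s) =
      (\<lambda>s\<in>simplices p L. f s + (\<lambda>s\<in>simplices p L. g s + h s) s)"
    by (rule restrict_ext) simp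
next
  fix f assume f: "f \<in> cocycles p L"
  show "(\<lambda>s\<in>simplices p L. (\<lambda>s\<in>simplices p L. 0) s + f s) = f"
    using cocycle_restrict_eq[OF f] by (simp cong: restrict_cong)
  have "(\<lambda>s\<in>simplices p L. 0 - f s) \<in> cocycles p L"
    by (rule restrict_cocycle[OF L]) (simp only: differential_diff cocycle_differential[OF f], simp add: differential_def)
  then show "\<exists>y\<in>cocycles p L. (\<lambda>s\<in>simplices p L. y s + f s) = (\<lambda>s\<in>simplices p L. 0)"
    by (rule rev_bexI) (simp cong: restrict_cong)
qed

lemma inv_cocycle_group:
  assumes L: "down_closed L" and f: "f \<in> cocycles p L"
  shows "inv\<^bsub>cocycle_group p L\<^esub> f = (\<lambda>s\<in>simplices p L. - f s)"
proof -
  interpret comm_group "cocycle_group p L" by (rule comm_group_cocycle_group[OF L])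
  have "(\<lambda>s\<in>simplices p L. 0 - f s) \<in> cocycles p L"
    by (rule restrict_cocycle[OF L]) (simp only: differential_diff cocycle_differential[OF f], simp add: differential_def)
  then show ?thesis using f by (intro inv_equality) (simp_all cong: restrict_cong)
qed

lemma subgroup_coboundaries:
  assumes L: "down_closed L"
  shows "subgroup (coboundaries p L) (cocycle_group p L)"
proof -
  interpret comm_group "cocycle_group p L" by (rule comm_group_cocycle_group[OF L])
  have sub: "coboundaries p L \<subseteq> cocycles p L"
  proof
    fix b assume "b \<in> coboundaries p L"
    then obtain c where c: "b = (\<lambda>J\<in>simplices p L. differential c J)" using coboundaries_iff[OF L] by blast
    show "b \<in> cocycles p L"
      unfolding c
    proof (rule restrict_cocycle[OF L])
      fix J assume "J \<in> simplices (p + 1) L"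
      then have "finite J" using L by (auto simp: simplices_def down_closed_def)
      then show "differential (differential c) J = 0" by (rule differential_differential)
    qed
  qed
  show ?thesis
  proof (rule subgroupI)
    show "coboundaries p L \<noteq> {}" using coboundaries_iff[OF L] by blast
    show "inv\<^bsub>cocycle_group p L\<^esub> b \<in> coboundaries p L" if b: "b \<in> coboundaries p L" for b
    proof -
      obtain c where c: "b = (\<lambda>J\<in>simplices p L. differential c J)" using b coboundaries_iff[OF L] by blast
      have "inv\<^bsub>cocycle_group p L\<^esub> b = (\<lambda>J\<in>simplices p L. differential (\<lambda>I. 0 - c I) J)"
        using b sub by (subst inv_cocycle_group[OF L])
          (auto simp: c differential_def sum_negf cong: restrict_cong)
      then show ?thesis using coboundaries_iff[OF L] by blast
    qed
    show "b \<otimes>\<^bsub>cocycle_group p L\<^esub> b' \<in> coboundaries p L"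
      if bb: "b \<in> coboundaries p L" "b' \<in> coboundaries p L" for b b'
    proof -
      obtain c c' where "b = (\<lambda>J\<in>simplices p L. differential c J)" "b' = (\<lambda>J\<in>simplices p L. differential c' J)"
        using bb coboundaries_iff[OF L] by meson
      then have "b \<otimes>\<^bsub>cocycle_group p L\<^esub> b' = (\<lambda>J\<in>simplices p L. differential (\<lambda>I. c I + c' I) J)"
        by (simp add: differential_add cong: restrict_cong)
      then show ?thesis using coboundaries_iff[OF L] by blast
    qed
  qed (use sub in simp)
qed

lemma normal_coboundaries:
  assumes "down_closed L"
  shows "coboundaries p L \<lhd> cocycle_group p L"
  by (rule comm_group.subgroup_imp_normal[OF comm_group_cocycle_group[OF assms] subgroup_coboundaries[OF assms]])

lemma comm_group_reduced_cohomology: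
  "down_closed L \<Longrightarrow> comm_group (reduced_cohomology p L)"
  unfolding reduced_cohomology_eq
  by (rule comm_group.abelian_FactGroup[OF comm_group_cocycle_group subgroup_coboundaries])

lemma coclass_eq: "coclass p L f = coboundaries p L #>\<^bsub>cocycle_group p L\<^esub> f"
  by (simp add: coclass_def r_coset_def cocycle_group_def)

lemma mem_coclass: "g \<in> coclass p L f \<longleftrightarrow> (\<exists>b\<in>coboundaries p L. g = (\<lambda>s\<in>simplices p L. b s + f s))"
  by (auto simp: coclass_eq r_coset_def)

lemma self_in_coclass:
  assumes "down_closed L" "f \<in> cocycles p L"
  shows "f \<in> coclass p L f"
proof -
  interpret comm_group "cocycle_group p L" by (rule comm_group_cocycle_group[OF assms(1)])
  show ?thesis using rcos_self[OF _ subgroup_coboundaries[OF assms(1)], of f] assms(2) by (simp add: coclass_eq)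
qed

lemma carrier_reduced_cohomology:
  "down_closed L \<Longrightarrow> carrier (reduced_cohomology p L) = coclass p L ` cocycles p L"
  by (simp add: reduced_cohomology_eq carrier_FactGroup coclass_eq[abs_def])

lemma coclass_add:
  assumes "down_closed L" "f \<in> cocycles p L" "g \<in> cocycles p L"
  shows "coclass p L f \<otimes>\<^bsub>reduced_cohomology p L\<^esub> coclass p L g = coclass p L (\<lambda>s\<in>simplices p L. f s + g s)"
  using normal.rcos_sum[OF normal_coboundaries[OF assms(1)], of f p g] assms
  by (simp add: reduced_cohomology_eq coclass_eq)

lemma coclass_zero:
  assumes "down_closed L"
  shows "coclass p L (\<lambda>s\<in>simplices p L. 0) = \<one>\<^bsub>reduced_cohomology p L\<^esub>"
proof -
  interpret comm_group "cocycle_group p L" by (rule comm_group_cocycle_group[OF assms])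
  have "(\<lambda>s\<in>simplices p L. 0) \<in> coboundaries p L"
    using subgroup.one_closed[OF subgroup_coboundaries[OF assms, of p]] by simp
  then show ?thesis
    using coset_join2[OF _ subgroup_coboundaries[OF assms, of p]] one_closed
    by (simp add: reduced_cohomology_eq[OF assms] coclass_eq)
qed

lemma coclass_eq_iff:
  assumes L: "down_closed L" and f: "f \<in> cocycles p L" and g: "g \<in> cocycles p L"
  shows "coclass p L f = coclass p L g \<longleftrightarrow> (\<exists>c. \<forall>s\<in>simplices p L. f s = g s + differential c s)"
proof -
  interpret comm_group "cocycle_group p L" by (rule comm_group_cocycle_group[OF L])
  note S = subgroup_coboundaries[OF L, of p]
  have "coclass p L f = coclass p L g \<longleftrightarrow> f \<in> coclass p L g"
    using rcos_self[OF _ S, of f] repr_independence[OF _ _ S, of f g] f g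
    unfolding coclass_eq by auto
  also have "\<dots> \<longleftrightarrow> (\<exists>c. f = (\<lambda>s\<in>simplices p L. (\<lambda>J\<in>simplices p L. differential c J) s + g s))"
    unfolding mem_coclass Bex_def coboundaries_iff[OF L] by blast
  also have "\<dots> \<longleftrightarrow> (\<exists>c. \<forall>s\<in>simplices p L. f s = g s + differential c s)"
  proof (intro ex_cong1)
    fix c
    show "f = (\<lambda>s\<in>simplices p L. (\<lambda>J\<in>simplices p L. differential c J) s + g s) \<longleftrightarrow>
        (\<forall>s\<in>simplices p L. f s = g s + differential c s)" (is "f = ?r \<longleftrightarrow> _")
    proof
      assume "f = ?r"
      then show "\<forall>s\<in>simplices p L. f s = g s + differential c s" by simp
    next
      assume *: "\<forall>s\<in>simplices p L. f s = g s + differential c s"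
      show "f = ?r"
        by (rule extensionalityI[of _ "simplices p L"]) (use * f in \<open>auto simp: cocycles_def\<close>)
    qed
  qed
  finally show ?thesis .
qed

lemma int_pow_cocycle_group:
  assumes L: "down_closed L" and f: "f \<in> cocycles p L"
  shows "f [^]\<^bsub>cocycle_group p L\<^esub> (n::int) = (\<lambda>s\<in>simplices p L. n * f s)"
proof (rule extensionalityI[of _ "simplices p L"])
  interpret comm_group "cocycle_group p L" by (rule comm_group_cocycle_group[OF L])
  show "f [^]\<^bsub>cocycle_group p L\<^esub> n \<in> extensional (simplices p L)"
    using int_pow_closed[of f n] f by (simp add: cocycles_def)
  fix s assume s: "s \<in> simplices p L"
  interpret ev: group_hom "cocycle_group p L" integer_group "\<lambda>f. f s"
    by (intro group_hom.intro group_hom_axioms.intro group_integer_group is_group) (auto simp: hom_def s)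
  show "(f [^]\<^bsub>cocycle_group p L\<^esub> n) s = (\<lambda>s\<in>simplices p L. n * f s) s"
    using ev.hom_int_pow[of f n] f s by simp
qed simp

lemma coclass_int_pow:
  assumes L: "down_closed L" and f: "f \<in> cocycles p L"
  shows "coclass p L f [^]\<^bsub>reduced_cohomology p L\<^esub> (n::int) = coclass p L (\<lambda>s\<in>simplices p L. n * f s)"
  using normal.FactGroup_int_pow[OF normal_coboundaries[OF L], of f p n] f int_pow_cocycle_group[OF L f, of n]
  by (simp add: reduced_cohomology_eq[OF L] coclass_eq)

lemma sum_cocycles:
  assumes L: "down_closed L" and "\<And>x. x \<in> A \<Longrightarrow> f x \<in> cocycles p L"
  shows "(\<lambda>s\<in>simplices p L. \<Sum>x\<in>A. c x * f x s) \<in> cocycles p L"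
  by (rule restrict_cocycle[OF L])
    (simp add: differential_sum cocycle_differential[OF assms(2)])

text \<open>The linear combinations of classes that occur in \<open>d'\<close> can be formed on representatives.\<close>

lemma coclass_finprod:
  assumes L: "down_closed L" and "finite A" "\<And>x. x \<in> A \<Longrightarrow> f x \<in> cocycles p L"
  shows "finprod (reduced_cohomology p L) (\<lambda>x. coclass p L (f x) [^]\<^bsub>reduced_cohomology p L\<^esub> (c x :: int)) A
    = coclass p L (\<lambda>s\<in>simplices p L. \<Sum>x\<in>A. c x * f x s)"
  using assms(2,3)
proof (induction A rule: finite_induct)
  case empty
  interpret H: comm_group "reduced_cohomology p L" by (rule comm_group_reduced_cohomology[OF L])
  show ?case by (simp only: H.finprod_empty sum.empty coclass_zero[OF L])
next
  case (insert x A)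
  interpret H: comm_group "reduced_cohomology p L" by (rule comm_group_reduced_cohomology[OF L])
  have carr: "coclass p L (f y) [^]\<^bsub>reduced_cohomology p L\<^esub> c y \<in> carrier (reduced_cohomology p L)"
    if "y \<in> insert x A" for y
    using insert.prems[OF that] by (intro H.int_pow_closed) (simp add: carrier_reduced_cohomology[OF L])
  have fx: "(\<lambda>s\<in>simplices p L. c x * f x s) \<in> cocycles p L"
    using sum_cocycles[OF L, of "{x}" f p c] insert.prems by simp
  have fA: "(\<lambda>s\<in>simplices p L. \<Sum>x\<in>A. c x * f x s) \<in> cocycles p L"
    using insert.prems by (intro sum_cocycles[OF L]) auto
  have IH: "finprod (reduced_cohomology p L) (\<lambda>x. coclass p L (f x) [^]\<^bsub>reduced_cohomology p L\<^esub> c x) A =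
      coclass p L (\<lambda>s\<in>simplices p L. \<Sum>x\<in>A. c x * f x s)"
    using insert.prems by (intro insert.IH) simp
  have "finprod (reduced_cohomology p L) (\<lambda>x. coclass p L (f x) [^]\<^bsub>reduced_cohomology p L\<^esub> c x) (insert x A) =
      coclass p L (f x) [^]\<^bsub>reduced_cohomology p L\<^esub> c x \<otimes>\<^bsub>reduced_cohomology p L\<^esub>
      finprod (reduced_cohomology p L) (\<lambda>x. coclass p L (f x) [^]\<^bsub>reduced_cohomology p L\<^esub> c x) A"
    using insert.hyps carr by (intro H.finprod_insert) auto
  also have "\<dots> = coclass p L (\<lambda>s\<in>simplices p L. (\<lambda>s\<in>simplices p L. c x * f x s) s +
      (\<lambda>s\<in>simplices p L. \<Sum>x\<in>A. c x * f x s) s)"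
    unfolding IH coclass_int_pow[OF L insert.prems[OF insertI1]] by (rule coclass_add[OF L fx fA])
  also have "(\<lambda>s\<in>simplices p L. (\<lambda>s\<in>simplices p L. c x * f x s) s + (\<lambda>s\<in>simplices p L. \<Sum>x\<in>A. c x * f x s) s)
      = (\<lambda>s\<in>simplices p L. \<Sum>x\<in>insert x A. c x * f x s)"
    using insert.hyps by (intro restrict_ext) simp
  finally show ?case .
qed

lemma simplices_mono: "M \<subseteq> L \<Longrightarrow> s \<in> simplices p M \<Longrightarrow> s \<in> simplices p L"
  by (auto simp: simplices_def)

lemma restrict_cocycle_subcomplex:
  assumes "down_closed M" "M \<subseteq> L" "f \<in> cocycles p L"
  shows "(\<lambda>s\<in>simplices p M. f s) \<in> cocycles p M"
  by (rule restrict_cocycle[OF assms(1)])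
    (use cocycle_differential[OF assms(3)] simplices_mono[OF assms(2)] in blast)

text \<open>All cosets in the union that defines the map on cohomology coincide, since the restriction of a
coboundary is a coboundary.\<close>

lemma restriction_map_coclass:
  assumes L: "down_closed L" and M: "down_closed M" "M \<subseteq> L" and f: "f \<in> cocycles p L"
  shows "restriction_map p M (coclass p L f) = coclass p M (\<lambda>s\<in>simplices p M. f s)"
proof -
  have "coclass p M (restrict g (simplices p M)) = coclass p M (restrict f (simplices p M))"
    if g: "g \<in> coclass p L f" for g
  proof -
    obtain b where b: "b \<in> coboundaries p L" "g = (\<lambda>s\<in>simplices p L. b s + f s)"
      using g by (auto simp: mem_coclass)
    obtain c where c: "b = (\<lambda>J\<in>simplices p L. differential c J)" using b(1) coboundaries_iff[OF L] by blast
    have g': "g \<in> cocycles p L"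
    proof -
      interpret comm_group "cocycle_group p L" by (rule comm_group_cocycle_group[OF L])
      have "b \<in> cocycles p L" using subgroup.subset[OF subgroup_coboundaries[OF L]] b(1) by auto
      then show ?thesis using m_closed[of b f] f b(2) by simp
    qed
    show ?thesis
      by (rule iffD2[OF coclass_eq_iff[OF M(1) restrict_cocycle_subcomplex[OF M g'] restrict_cocycle_subcomplex[OF M f]]])
        (auto simp: b c simplices_mono[OF M(2)] intro!: exI[of _ c])
  qed
  moreover have "f \<in> coclass p L f" by (rule self_in_coclass[OF L f])
  ultimately show ?thesis
    unfolding restriction_map_def coclass_def[symmetric] by blast
qed

section \<open>Vanishing of reduced cohomology, and subquotients of groups\<close>

lemma trivial_reduced_cohomology:
  assumes L: "down_closed L"
    and ex: "\<And>f. (\<And>J. J \<in> simplices (p + 1) L \<Longrightarrow> differential f J = 0) \<Longrightarrow>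
      \<exists>c. \<forall>s\<in>simplices p L. f s = differential c s"
  shows "trivial_group (reduced_cohomology p L)"
proof -
  interpret H: comm_group "reduced_cohomology p L" by (rule comm_group_reduced_cohomology[OF L])
  have "x = \<one>\<^bsub>reduced_cohomology p L\<^esub>" if "x \<in> carrier (reduced_cohomology p L)" for x
  proof -
    obtain f where f: "f \<in> cocycles p L" "x = coclass p L f"
      using \<open>x \<in> carrier (reduced_cohomology p L)\<close> by (auto simp: carrier_reduced_cohomology[OF L])
    obtain c where c: "\<forall>s\<in>simplices p L. f s = differential c s"
      using ex[of f] cocycle_differential[OF f(1)] by blast
    have z: "(\<lambda>s\<in>simplices p L. 0) \<in> cocycles p L"
      by (rule restrict_cocycle[OF L]) (simp add: differential_def)
    have "coclass p L f = coclass p L (\<lambda>s\<in>simplices p L. 0)"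
      by (rule iffD2[OF coclass_eq_iff[OF L f(1) z]]) (use c in auto)
    then show ?thesis using f(2) by (simp only: coclass_zero[OF L])
  qed
  then have "carrier (reduced_cohomology p L) = {\<one>\<^bsub>reduced_cohomology p L\<^esub>}" using H.one_closed by blast
  then show ?thesis using H.trivial_group by blast
qed

definition cone_cochain :: "nat \<Rightarrow> (nat set \<Rightarrow> int) \<Rightarrow> nat set \<Rightarrow> int" where
  "cone_cochain t f I = (if t \<in> I then 0 else eps t (insert t I) * f (insert t I))"

text \<open>In a simplex with vertex \<open>t\<close>, every cocycle is the coboundary of its cone. The hypothesis is the
cocycle condition on the simplex spanned by \<open>s\<close> and \<open>t\<close>.\<close>

lemma differential_cone:
  assumes s: "finite s" and closed: "t \<notin> s \<Longrightarrow> differential f (insert t s) = 0"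
  shows "differential (cone_cochain t f) s = f s"
proof (cases "t \<in> s")
  case True
  have "differential (cone_cochain t f) s = (\<Sum>j\<in>{t}. eps j s * cone_cochain t f (s - {j}))"
    unfolding differential_def using s True by (intro sum.mono_neutral_right) (auto simp: cone_cochain_def)
  also have "\<dots> = eps t s * eps t s * f s" using True by (simp add: cone_cochain_def insert_absorb mult.assoc)
  finally show ?thesis by simp
next
  case False
  let ?I = "insert t s"
  have "eps j s * cone_cochain t f (s - {j}) = - (eps t ?I * (eps j ?I * f (?I - {j})))" if j: "j \<in> s" for j
  proof -
    have eq: "insert t (s - {j}) = ?I - {j}" "t \<notin> s - {j}" "?I - {t} = s" using j False by auto
    have "eps j ?I * eps t (?I - {j}) = - (eps t ?I * eps j (?I - {t}))"
      using j s False by (intro eps_anticommute) auto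
    then have "eps j s = - (eps t ?I * eps j ?I * eps t (?I - {j}))"
      unfolding eq(3)
      by (metis (no_types, opaque_lifting) eps_square minus_mult_right mult.assoc mult.commute mult_1 add.inverse_inverse)
    then have "eps j s * eps t (?I - {j}) = - (eps t ?I * eps j ?I)" by (simp add: mult.assoc)
    then have "eps j s * (eps t (?I - {j}) * f (?I - {j})) = - (eps t ?I * eps j ?I) * f (?I - {j})"
      by (simp only: mult.assoc[symmetric])
    moreover have "cone_cochain t f (s - {j}) = eps t (?I - {j}) * f (?I - {j})"
      unfolding cone_cochain_def eq(1) using eq(2) by (rule if_not_P)
    ultimately show ?thesis by (simp only: mult.assoc mult_minus_left)
  qed
  then have "differential (cone_cochain t f) s = - (eps t ?I * (\<Sum>j\<in>s. eps j ?I * f (?I - {j})))"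
    by (simp add: differential_def sum_negf sum_distrib_left)
  moreover have "differential f ?I = eps t ?I * f s + (\<Sum>j\<in>s. eps j ?I * f (?I - {j}))"
    using s False by (simp add: differential_def)
  then have "(\<Sum>j\<in>s. eps j ?I * f (?I - {j})) = - (eps t ?I * f s)" using closed[OF False] by simp
  ultimately have "differential (cone_cochain t f) s = eps t ?I * eps t ?I * f s" by (simp add: mult.assoc)
  then show ?thesis by simp
qed

lemma down_closed_attachment: "iterated_simplex_attachment L \<Longrightarrow> down_closed L"
proof (induction rule: iterated_simplex_attachment.induct)
  case (simplex T)
  then show ?case by (auto simp: down_closed_def intro: finite_subset)
next
  case (attach K' \<sigma> T)
  then show ?case by (auto simp: down_closed_def intro: finite_subset)
qed

text \<open>On the old complex the cocycle is a coboundary by induction. After subtracting it, the cocycle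
vanishes there, and the cone over the attached simplex vanishes on the faces in the old complex if
the cone vertex is taken in \<open>\<sigma>\<close>. For empty \<open>\<sigma>\<close> no face of positive cardinality is shared, which is
where \<open>p \<ge> 1\<close> is needed.\<close>

lemma attachment_acyclic:
  assumes "iterated_simplex_attachment L" and p: "p \<ge> 1"
    and "\<And>J. J \<in> simplices (p + 1) L \<Longrightarrow> differential f J = 0"
  shows "\<exists>c. \<forall>s\<in>simplices p L. f s = differential c s"
  using assms(1,3)
proof (induction arbitrary: f)
  case (simplex T)
  then obtain t where t: "t \<in> T" by blast
  have "differential (cone_cochain t f) s = f s" if s: "s \<in> simplices p (Pow T)" for s
  proof (rule differential_cone)
    show fs: "finite s" using s simplex.hyps by (auto simp: simplices_def intro: finite_subset)
    assume "t \<notin> s"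
    then have "insert t s \<in> simplices (p + 1) (Pow T)" using s t fs by (simp add: simplices_def)
    then show "differential f (insert t s) = 0" by (rule simplex.prems)
  qed
  then show ?case by metis
next
  case (attach K' \<sigma> T)
  let ?L = "K' \<union> Pow T"
  have K': "down_closed K'" using down_closed_attachment[OF attach.hyps(1)] .
  have L: "down_closed ?L"
    using iterated_simplex_attachment.attach[OF attach.hyps] by (rule down_closed_attachment)
  have finL: "finite s" if "s \<in> ?L" for s using L that by (simp add: down_closed_def)
  have "\<And>J. J \<in> simplices (p + 1) K' \<Longrightarrow> differential f J = 0"
    by (rule attach.prems) (simp add: simplices_def)
  then obtain c' where c': "\<forall>s\<in>simplices p K'. f s = differential c' s" using attach.IH by metis
  define c1 where "c1 = (\<lambda>I. if I \<in> K' then c' I else 0)"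
  define f1 where "f1 = (\<lambda>I. f I - differential c1 I)"
  have f1_K': "f1 s = 0" if s: "s \<in> simplices p K'" for s
  proof -
    have "differential c1 s = differential c' s"
      by (rule differential_cong)
        (use face_simplices[OF K' s] in \<open>simp add: c1_def simplices_def\<close>)
    then show ?thesis using c' s by (simp add: f1_def)
  qed
  have f1_closed: "differential f1 J = 0" if J: "J \<in> simplices (p + 1) ?L" for J
  proof -
    have "finite J" using finL J by (simp add: simplices_def)
    then show ?thesis
      unfolding f1_def using attach.prems[OF J] by (simp add: differential_diff differential_differential)
  qed
  obtain t where t: "t \<in> T" "\<sigma> \<noteq> {} \<longrightarrow> t \<in> \<sigma>" using attach.hyps by blast
  define c2 where "c2 = (\<lambda>I. if I \<subseteq> T then cone_cochain t f1 I else 0)"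
  have "f1 s = differential c2 s" if s: "s \<in> simplices p ?L" for s
  proof (cases "s \<in> K'")
    case False
    then have sT: "s \<subseteq> T" using s by (auto simp: simplices_def)
    have fs: "finite s" using finL s by (simp add: simplices_def)
    have "differential c2 s = differential (cone_cochain t f1) s"
      by (rule differential_cong) (use sT in \<open>auto simp: c2_def\<close>)
    also have "\<dots> = f1 s"
    proof (rule differential_cone[OF fs])
      assume "t \<notin> s"
      then have "insert t s \<in> simplices (p + 1) ?L" using s t fs sT by (simp add: simplices_def)
      then show "differential f1 (insert t s) = 0" by (rule f1_closed)
    qed
    finally show ?thesis by simp
  next
    case True
    then have sK: "s \<in> simplices p K'" using s by (simp add: simplices_def)
    have "c2 (s - {j}) = 0" if j: "j \<in> s" for j
    proof (cases "s - {j} \<subseteq> T \<and> t \<notin> s - {j}")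
      case T: True
      have face: "s - {j} \<in> simplices (p - 1) K'" by (rule face_simplices[OF K' sK j])
      then have "s - {j} \<in> K' \<inter> Pow T" using T by (simp add: simplices_def)
      then have sub: "s - {j} \<subseteq> \<sigma>" using attach.hyps by auto
      moreover have "card (s - {j}) \<noteq> 0" using face p by (simp add: simplices_def)
      then have "s - {j} \<noteq> {}" by (metis card.empty)
      ultimately have "t \<in> \<sigma>" using t(2) by auto
      then have "insert t (s - {j}) \<in> Pow \<sigma>" using sub by simp
      then have "insert t (s - {j}) \<in> K'" using attach.hyps by blast
      moreover have "int (card (insert t (s - {j}))) = p + 1"
      proof -
        have "finite (s - {j})" using finL True by auto
        then show ?thesis using face T by (simp add: simplices_def)
      qed
      ultimately have "f1 (insert t (s - {j})) = 0" by (intro f1_K') (simp add: simplices_def)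
      then show ?thesis by (simp add: c2_def cone_cochain_def)
    qed (auto simp: c2_def cone_cochain_def)
    then have "differential c2 s = 0" by (simp add: differential_def)
    then show ?thesis using f1_K'[OF sK] by simp
  qed
  then have "\<forall>s\<in>simplices p ?L. f s = differential (\<lambda>I. c1 I + c2 I) s"
    by (simp add: differential_add f1_def algebra_simps)
  then show ?case by blast
qed

text \<open>The image of \<open>f\<close> appears as the kernel of a homomorphism on the kernel of \<open>d\<close>; this yields both its
normality and \<open>d f = 1\<close>.\<close>

lemma cohomology_at_iso:
  assumes B: "group B" and C: "group C" and d: "d \<in> hom B C" and H: "group H"
    and \<phi>: "\<phi> \<in> hom (B\<lparr>carrier := kernel B C d\<rparr>) H" and onto: "\<phi> ` kernel B C d = carrier H"
    and ker: "f ` carrier A = {x \<in> kernel B C d. \<phi> x = \<one>\<^bsub>H\<^esub>}"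
  shows "cohomology_at A f B d C \<cong> H"
proof -
  interpret d: group_hom B C d using B C d by (intro group_hom.intro group_hom_axioms.intro)
  let ?Z = "B\<lparr>carrier := kernel B C d\<rparr>"
  have Z: "group ?Z" by (rule group.subgroup_imp_group[OF B d.subgroup_kernel])
  interpret \<phi>: group_hom ?Z H \<phi> using Z H \<phi> by (intro group_hom.intro group_hom_axioms.intro)
  have "?Z Mod kernel ?Z H \<phi> \<cong> H" by (rule \<phi>.FactGroup_iso) (simp add: onto)
  moreover have "kernel ?Z H \<phi> = f ` carrier A" unfolding ker by (auto simp: kernel_def)
  ultimately show ?thesis by (simp add: cohomology_at_def)
qed

lemma cohomology_at_trivial:
  assumes B: "group B" and C: "group C" and d: "d \<in> hom B C"
    and exact: "f ` carrier A = kernel B C d"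
  shows "trivial_group (cohomology_at A f B d C)"
proof -
  interpret d: group_hom B C d using B C d by (intro group_hom.intro group_hom_axioms.intro)
  let ?Z = "B\<lparr>carrier := kernel B C d\<rparr>"
  interpret Z: group ?Z by (rule group.subgroup_imp_group[OF B d.subgroup_kernel])
  have one: "\<one>\<^bsub>B\<^esub> \<in> kernel B C d" using d.subgroup_kernel by (rule subgroup.one_closed)
  have iso: "cohomology_at A f B d C \<cong> singleton_group ()"
  proof (rule cohomology_at_iso[OF B C d])
    show "(\<lambda>_. ()) \<in> hom ?Z (singleton_group ())" by (simp add: hom_def singleton_group_def)
    show "(\<lambda>_. ()) ` kernel B C d = carrier (singleton_group ())" using one by auto
  qed (simp_all add: exact)
  have "group (cohomology_at A f B d C)"
    unfolding cohomology_at_def exact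
  proof (rule normal.factorgroup_is_group)
    have "subgroup (carrier ?Z) ?Z" by (rule Z.subgroup_self)
    then show "kernel B C d \<lhd> ?Z"
      using Z.normal_self by simp
  qed
  then show ?thesis using isomorphic_group_triviality[OF iso _ singleton_group] by simp
qed

section \<open>The differential on representing cochains\<close>

locale vertex_complex =
  fixes m :: nat and K :: "nat set set"
  assumes K: "abstract_complex {1..m} K"
begin

abbreviation V :: "nat set" where "V \<equiv> {1..m}"

abbreviation KI :: "nat set \<Rightarrow> nat set set" where "KI I \<equiv> full_subcomplex K I"

text \<open>Representatives of the elements of the bigraded cohomology: one cocycle on \<open>K\<^sub>I\<close> for every vertex set
\<open>I\<close> of size \<open>l\<close>.\<close>

definition cochain_families :: "int \<Rightarrow> int \<Rightarrow> (nat set \<Rightarrow> nat set \<Rightarrow> int) set" where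
  "cochain_families p l = {F. \<forall>I\<in>vertex_sets m l. F I \<in> cocycles p (KI I)}"

definition class_family :: "int \<Rightarrow> int \<Rightarrow> (nat set \<Rightarrow> nat set \<Rightarrow> int) \<Rightarrow> nat set \<Rightarrow> (nat set \<Rightarrow> int) set" where
  "class_family p l F = (\<lambda>I\<in>vertex_sets m l. coclass p (KI I) (F I))"

lemma down_closed_KI: "down_closed (KI I)"
proof -
  have "finite J" if "J \<in> K" for J using K that finite_subset[of J V] by (auto simp: abstract_complex_def)
  then show ?thesis using K by (auto simp: down_closed_def full_subcomplex_def abstract_complex_def)
qed

lemma KI_mono: "J \<subseteq> I \<Longrightarrow> KI J \<subseteq> KI I"
  by (auto simp: full_subcomplex_def)

lemma finite_vertex_sets: "finite (vertex_sets m l)"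
  by (rule finite_subset[of _ "Pow V"]) (auto simp: vertex_sets_def)

lemma insert_vertex_sets:
  assumes "J \<in> vertex_sets m (l - 1)" "i \<in> V - J"
  shows "insert i J \<in> vertex_sets m l"
  using assms finite_subset[of J V] by (auto simp: vertex_sets_def)

lemma group_bigraded: "group (bigraded_cohomology m K k l)"
  unfolding bigraded_cohomology_def
  using comm_group_reduced_cohomology[OF down_closed_KI] by (intro sum_group) (simp add: comm_group_def)

lemma carrier_bigraded:
  "carrier (bigraded_cohomology m K k l) = class_family (l - k - 1) l ` cochain_families (l - k - 1) l"
proof -
  let ?p = "l - k - 1"
  let ?H = "\<lambda>I. reduced_cohomology ?p (KI I)"
  have "carrier (bigraded_cohomology m K k l) = (\<Pi>\<^sub>E I\<in>vertex_sets m l. carrier (?H I))"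
    unfolding bigraded_cohomology_def
    using comm_group_reduced_cohomology[OF down_closed_KI] finite_vertex_sets
    by (subst carrier_sum_group) (auto simp: comm_group_def)
  also have "\<dots> = class_family ?p l ` cochain_families ?p l"
  proof
    show "class_family ?p l ` cochain_families ?p l \<subseteq> (\<Pi>\<^sub>E I\<in>vertex_sets m l. carrier (?H I))"
      by (auto simp: class_family_def cochain_families_def carrier_reduced_cohomology[OF down_closed_KI])
    show "(\<Pi>\<^sub>E I\<in>vertex_sets m l. carrier (?H I)) \<subseteq> class_family ?p l ` cochain_families ?p l"
    proof
      fix x assume x: "x \<in> (\<Pi>\<^sub>E I\<in>vertex_sets m l. carrier (?H I))"
      then have "\<forall>I\<in>vertex_sets m l. \<exists>f. f \<in> cocycles ?p (KI I) \<and> x I = coclass ?p (KI I) f"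
        by (auto simp: carrier_reduced_cohomology[OF down_closed_KI] dest!: PiE_mem)
      then obtain F where F: "\<forall>I\<in>vertex_sets m l. F I \<in> cocycles ?p (KI I) \<and> x I = coclass ?p (KI I) (F I)"
        by metis
      have "x = class_family ?p l F"
        by (rule extensionalityI[of _ "vertex_sets m l"])
          (use x F in \<open>auto simp: class_family_def PiE_def\<close>)
      then show "x \<in> class_family ?p l ` cochain_families ?p l"
        using F by (auto simp: cochain_families_def)
    qed
  qed
  finally show ?thesis .
qed

lemma mult_bigraded:
  assumes "F \<in> cochain_families (l - k - 1) l" "G \<in> cochain_families (l - k - 1) l"
  shows "class_family (l - k - 1) l F \<otimes>\<^bsub>bigraded_cohomology m K k l\<^esub> class_family (l - k - 1) l G =
    class_family (l - k - 1) l (\<lambda>I. \<lambda>s\<in>simplices (l - k - 1) (KI I). F I s + G I s)"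
  using assms coclass_add[OF down_closed_KI]
  by (auto simp: bigraded_cohomology_def class_family_def cochain_families_def intro!: restrict_ext)

lemma one_bigraded:
  "\<one>\<^bsub>bigraded_cohomology m K k l\<^esub> =
    class_family (l - k - 1) l (\<lambda>I. \<lambda>s\<in>simplices (l - k - 1) (KI I). 0)"
  unfolding bigraded_cohomology_def class_family_def by (simp only: one_sum_group coclass_zero[OF down_closed_KI])

lemma class_family_eq_iff:
  assumes "F \<in> cochain_families p l" "G \<in> cochain_families p l"
  shows "class_family p l F = class_family p l G \<longleftrightarrow>
    (\<forall>I\<in>vertex_sets m l. \<exists>c. \<forall>s\<in>simplices p (KI I). F I s = G I s + differential c s)"
proof -
  have "class_family p l F = class_family p l G \<longleftrightarrow>
      (\<forall>I\<in>vertex_sets m l. coclass p (KI I) (F I) = coclass p (KI I) (G I))"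
    unfolding class_family_def by (metis (no_types, lifting) restrict_apply' restrict_ext)
  also have "\<dots> \<longleftrightarrow> (\<forall>I\<in>vertex_sets m l. \<exists>c. \<forall>s\<in>simplices p (KI I). F I s = G I s + differential c s)"
    using assms by (intro ball_cong refl coclass_eq_iff[OF down_closed_KI]) (auto simp: cochain_families_def)
  finally show ?thesis .
qed

text \<open>The factor \<open>-1\<close> compensates the sign that is built into \<open>koszul\<close>.\<close>

definition lifted_dprime :: "int \<Rightarrow> (nat set \<Rightarrow> nat set \<Rightarrow> int) \<Rightarrow> nat set \<Rightarrow> nat set \<Rightarrow> int" where
  "lifted_dprime p F J = (\<lambda>s\<in>simplices p (KI J). (- 1) ^ nat (p + 1) * - koszul V F J s)"

lemma lifted_dprime_sum:
  "lifted_dprime p F J =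
    (\<lambda>s\<in>simplices p (KI J). \<Sum>i\<in>V - J. ((- 1) ^ nat (p + 1) * eps i (insert i J)) *
        (\<lambda>s\<in>simplices p (KI J). F (insert i J) s) s)"
  unfolding lifted_dprime_def by (rule restrict_ext) (simp add: koszul_def sum_distrib_left mult.assoc)

lemma cochain_families_restrict:
  assumes "F \<in> cochain_families p l" "J \<in> vertex_sets m (l - 1)" "i \<in> V - J"
  shows "F (insert i J) \<in> cocycles p (KI (insert i J))"
    "(\<lambda>s\<in>simplices p (KI J). F (insert i J) s) \<in> cocycles p (KI J)"
proof -
  show *: "F (insert i J) \<in> cocycles p (KI (insert i J))"
    using assms insert_vertex_sets[OF assms(2,3)] by (simp add: cochain_families_def)
  show "(\<lambda>s\<in>simplices p (KI J). F (insert i J) s) \<in> cocycles p (KI J)"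
    by (rule restrict_cocycle_subcomplex[OF down_closed_KI KI_mono *]) auto
qed

lemma lifted_dprime_families:
  assumes "F \<in> cochain_families p l"
  shows "lifted_dprime p F \<in> cochain_families p (l - 1)"
  unfolding cochain_families_def lifted_dprime_sum
  by (intro CollectI ballI sum_cocycles[OF down_closed_KI] cochain_families_restrict(2)[OF assms])

text \<open>This turns the computation of \<open>d'\<close> into a computation with integer-valued functions.\<close>

lemma dprime_class_family:
  assumes "F \<in> cochain_families (l - k - 1) l"
  shows "dprime m K k l (class_family (l - k - 1) l F) =
    class_family (l - k - 1) (l - 1) (lifted_dprime (l - k - 1) F)"
  unfolding dprime_def Let_def class_family_def
proof (rule restrict_ext)
  fix J assume J: "J \<in> vertex_sets m (l - 1)"
  let ?p = "l - k - 1" let ?H = "reduced_cohomology ?p (KI J)"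
  let ?G = "\<lambda>i. \<lambda>s\<in>simplices ?p (KI J). F (insert i J) s"
  let ?c = "\<lambda>i. (- 1) ^ nat (?p + 1) * eps i (insert i J)"
  interpret H: comm_group ?H by (rule comm_group_reduced_cohomology[OF down_closed_KI])
  have "finprod ?H (\<lambda>i. psi K ?p i (insert i J)
            ((\<lambda>I\<in>vertex_sets m l. coclass ?p (KI I) (F I)) (insert i J)) [^]\<^bsub>?H\<^esub> ?c i) (V - J) =
        finprod ?H (\<lambda>i. coclass ?p (KI J) (?G i) [^]\<^bsub>?H\<^esub> ?c i) (V - J)"
  proof (rule H.finprod_cong')
    show "(\<lambda>i. coclass ?p (KI J) (?G i) [^]\<^bsub>?H\<^esub> ?c i) \<in> V - J \<rightarrow> carrier ?H"
      using cochain_families_restrict(2)[OF assms J]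
      by (intro Pi_I H.int_pow_closed) (auto simp: carrier_reduced_cohomology[OF down_closed_KI])
    fix i assume i: "i \<in> V - J"
    have "psi K ?p i (insert i J) (coclass ?p (KI (insert i J)) (F (insert i J))) = coclass ?p (KI J) (?G i)"
    proof -
      have "insert i J - {i} = J" using i by auto
      then show ?thesis
        unfolding psi_def
        using restriction_map_coclass[OF down_closed_KI down_closed_KI KI_mono cochain_families_restrict(1)[OF assms J i], of J]
        by auto
    qed
    then show "psi K ?p i (insert i J) ((\<lambda>I\<in>vertex_sets m l. coclass ?p (KI I) (F I)) (insert i J)) [^]\<^bsub>?H\<^esub> ?c i
        = coclass ?p (KI J) (?G i) [^]\<^bsub>?H\<^esub> ?c i"
      using insert_vertex_sets[OF J i] by simp
  qed simp
  also have "\<dots> = coclass ?p (KI J) (lifted_dprime ?p F J)"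
    unfolding lifted_dprime_sum
    using cochain_families_restrict(2)[OF assms J]
    by (intro coclass_finprod[OF down_closed_KI]) auto
  finally show "finprod ?H (\<lambda>i. psi K ?p i (insert i J)
            ((\<lambda>I\<in>vertex_sets m l. coclass ?p (KI I) (F I)) (insert i J)) [^]\<^bsub>?H\<^esub> ?c i) (V - J) =
      coclass ?p (KI J) (lifted_dprime ?p F J)" .
qed

lemma dprime_hom:
  "dprime m K k l \<in> hom (bigraded_cohomology m K k l) (bigraded_cohomology m K (k - 1) (l - 1))"
proof (rule homI)
  let ?p = "l - k - 1"
  have p: "l - 1 - (k - 1) - 1 = ?p" by simp
  fix x assume "x \<in> carrier (bigraded_cohomology m K k l)"
  then obtain F where F: "F \<in> cochain_families ?p l" "x = class_family ?p l F"
    unfolding carrier_bigraded by blast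
  show "dprime m K k l x \<in> carrier (bigraded_cohomology m K (k - 1) (l - 1))"
    unfolding carrier_bigraded p F(2) dprime_class_family[OF F(1)]
    using lifted_dprime_families[OF F(1)] by blast
  fix y assume "y \<in> carrier (bigraded_cohomology m K k l)"
  then obtain G where G: "G \<in> cochain_families ?p l" "y = class_family ?p l G"
    unfolding carrier_bigraded by blast
  let ?S = "\<lambda>F G I. \<lambda>s\<in>simplices ?p (KI I). F I s + G I s"
  have FG: "?S F G \<in> cochain_families ?p l"
    using F(1) G(1) unfolding cochain_families_def by (intro CollectI ballI add_cocycles[OF down_closed_KI]) auto
  have eq: "lifted_dprime ?p (?S F G) J = ?S (lifted_dprime ?p F) (lifted_dprime ?p G) J"
    if "J \<in> vertex_sets m (l - 1)" for J
  proof -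
    have "koszul V (?S F G) J s = koszul V F J s + koszul V G J s" if s: "s \<in> simplices ?p (KI J)" for s
    proof -
      have "s \<in> simplices ?p (KI (insert i J))" for i
        using simplices_mono[OF KI_mono s, of "insert i J"] by blast
      then show ?thesis by (simp add: koszul_def distrib_left sum.distrib)
    qed
    then show ?thesis
      unfolding lifted_dprime_def by (intro restrict_ext) (simp add: algebra_simps)
  qed
  have "dprime m K k l (x \<otimes>\<^bsub>bigraded_cohomology m K k l\<^esub> y) =
      class_family ?p (l - 1) (lifted_dprime ?p (?S F G))"
    unfolding F(2) G(2) mult_bigraded[OF F(1) G(1)] by (rule dprime_class_family[OF FG])
  also have "\<dots> = class_family ?p (l - 1) (?S (lifted_dprime ?p F) (lifted_dprime ?p G))"
    unfolding class_family_def using eq by (intro restrict_ext) simp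
  also have "\<dots> = dprime m K k l x \<otimes>\<^bsub>bigraded_cohomology m K (k - 1) (l - 1)\<^esub> dprime m K k l y"
    using mult_bigraded[of "lifted_dprime ?p F" "l - 1" "k - 1" "lifted_dprime ?p G"]
      lifted_dprime_families[OF F(1)] lifted_dprime_families[OF G(1)]
    unfolding p F(2) G(2) dprime_class_family[OF F(1)] dprime_class_family[OF G(1)] by simp
  finally show "dprime m K k l (x \<otimes>\<^bsub>bigraded_cohomology m K k l\<^esub> y) =
      dprime m K k l x \<otimes>\<^bsub>bigraded_cohomology m K (k - 1) (l - 1)\<^esub> dprime m K k l y" .
qed

lemma dprime_hom_into:
  "dprime m K (k + 1) (l + 1) \<in> hom (bigraded_cohomology m K (k + 1) (l + 1)) (bigraded_cohomology m K k l)"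
  using dprime_hom[of "k + 1" "l + 1"] by simp

lemma trivial_bigraded:
  assumes "\<And>I. I \<in> vertex_sets m l \<Longrightarrow> trivial_group (reduced_cohomology (l - k - 1) (KI I))"
  shows "carrier (bigraded_cohomology m K k l) = {\<one>\<^bsub>bigraded_cohomology m K k l\<^esub>}"
proof -
  have "x = \<one>\<^bsub>bigraded_cohomology m K k l\<^esub>" if x: "x \<in> carrier (bigraded_cohomology m K k l)" for x
  proof -
    obtain F where F: "F \<in> cochain_families (l - k - 1) l" "x = class_family (l - k - 1) l F"
      using x unfolding carrier_bigraded by blast
    have "coclass (l - k - 1) (KI I) (F I) = \<one>\<^bsub>reduced_cohomology (l - k - 1) (KI I)\<^esub>"
      if "I \<in> vertex_sets m l" for I
      using assms[OF that] F(1) that carrier_reduced_cohomology[OF down_closed_KI, of "l - k - 1" I]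
      by (auto simp: trivial_group_def cochain_families_def)
    then show ?thesis
      unfolding F(2) bigraded_cohomology_def class_family_def by (simp cong: restrict_cong)
  qed
  moreover have "\<one>\<^bsub>bigraded_cohomology m K k l\<^esub> \<in> carrier (bigraded_cohomology m K k l)"
    by (rule monoid.one_closed[OF group.is_monoid[OF group_bigraded]])
  ultimately show ?thesis by blast
qed

lemma double_cohomology_trivialI:
  assumes "carrier (bigraded_cohomology m K k l) = {\<one>\<^bsub>bigraded_cohomology m K k l\<^esub>}"
  shows "trivial_group (double_cohomology m K k l)"
  unfolding double_cohomology_def
proof (rule cohomology_at_trivial[OF group_bigraded group_bigraded dprime_hom])
  let ?A = "bigraded_cohomology m K (k + 1) (l + 1)" let ?B = "bigraded_cohomology m K k l"
  have "dprime m K k l \<one>\<^bsub>?B\<^esub> = \<one>\<^bsub>bigraded_cohomology m K (k - 1) (l - 1)\<^esub>"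
    by (rule hom_one[OF dprime_hom group_bigraded group_bigraded])
  then have "kernel ?B (bigraded_cohomology m K (k - 1) (l - 1)) (dprime m K k l) = {\<one>\<^bsub>?B\<^esub>}"
    unfolding kernel_def assms by auto
  moreover have "dprime m K (k + 1) (l + 1) ` carrier ?A = {\<one>\<^bsub>?B\<^esub>}"
  proof -
    have sub: "dprime m K (k + 1) (l + 1) ` carrier ?A \<subseteq> {\<one>\<^bsub>?B\<^esub>}"
      using dprime_hom_into[of k l] unfolding hom_def assms by blast
    have "\<one>\<^bsub>?A\<^esub> \<in> carrier ?A" by (rule monoid.one_closed[OF group.is_monoid[OF group_bigraded]])
    then have ne: "dprime m K (k + 1) (l + 1) ` carrier ?A \<noteq> {}" by auto
    show ?thesis by (rule disjE[OF subset_singletonD[OF sub]], erule notE[OF ne], assumption)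
  qed
  ultimately show "dprime m K (k + 1) (l + 1) ` carrier ?A =
      kernel ?B (bigraded_cohomology m K (k - 1) (l - 1)) (dprime m K k l)" by simp
qed

end

section \<open>Double cohomology of iterated attachments\<close>

lemma differential_empty [simp]: "differential c {} = 0"
  by (simp add: differential_def)

lemma differential_singleton [simp]: "differential c {x} = c {}"
  by (simp add: differential_def)

lemma simplices_minus1: "down_closed L \<Longrightarrow> s \<in> simplices (- 1) L \<Longrightarrow> s = {}"
  by (auto simp: simplices_def down_closed_def)

context vertex_complex
begin

lemma simplices_0: "I \<subseteq> V \<Longrightarrow> simplices 0 (KI I) = (\<lambda>x. {x}) ` I"
  using K by (auto simp: simplices_def full_subcomplex_def abstract_complex_def card_1_singleton_iff)

lemma cocycle_locally_constant:
  assumes f: "f \<in> cocycles 0 (KI I)"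
  shows "locally_constant K I (\<lambda>x. f {x})"
proof -
  have lt: "f {a} = f {b}" if ab: "a \<in> I" "b \<in> I" "{a, b} \<in> K" "a < b" for a b
  proof -
    have "{a, b} \<in> simplices (0 + 1) (KI I)" using ab by (simp add: simplices_def full_subcomplex_def)
    then have "differential f {a, b} = 0" by (rule cocycle_differential[OF f])
    moreover have "{a, b} - {a} = {b}" "{a, b} - {b} = {a}" using ab(4) by auto
    ultimately have "eps a {a, b} * f {b} + eps b {a, b} * f {a} = 0"
      using ab(4) by (simp add: differential_def)
    then have "eps b {a, b} * (f {a} - f {b}) = 0" using eps_pair[of a b] ab(4) by (simp add: algebra_simps)
    then show ?thesis by (simp add: eps_def)
  qed
  show ?thesis
    unfolding locally_constant_def
  proof (intro ballI impI)
    fix a b assume ab: "a \<in> I" "b \<in> I" "{a, b} \<in> K"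
    then have ba: "{b, a} \<in> K" by (simp add: insert_commute)
    show "f {a} = f {b}"
    proof (cases a b rule: linorder_cases)
      case less
      then show ?thesis by (rule lt[OF ab])
    next
      case greater
      then show ?thesis by (rule lt[OF ab(2,1) ba, symmetric])
    qed simp
  qed
qed

text \<open>Simplices of dimension \<open>0\<close> are singletons, so functions on vertices and cochains of degree \<open>0\<close>
are the same up to the bijection between \<open>x\<close> and \<open>{x}\<close>.\<close>

definition cocycle_of :: "nat set \<Rightarrow> (nat \<Rightarrow> int) \<Rightarrow> nat set \<Rightarrow> int" where
  "cocycle_of I g = (\<lambda>s\<in>simplices 0 (KI I). g (the_elem s))"

lemma cocycle_of_apply: "I \<subseteq> V \<Longrightarrow> x \<in> I \<Longrightarrow> cocycle_of I g {x} = g x"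
  by (simp add: cocycle_of_def simplices_0)

lemma cocycle_of_in:
  assumes g: "locally_constant K I g"
  shows "cocycle_of I g \<in> cocycles 0 (KI I)"
  unfolding cocycle_of_def
proof (rule restrict_cocycle[OF down_closed_KI])
  fix J assume "J \<in> simplices (0 + 1) (KI I)"
  then have J: "J \<in> K" "J \<subseteq> I" "card J = 2" by (auto simp: simplices_def full_subcomplex_def)
  then obtain a b where ab: "J = {a, b}" "a \<noteq> b" by (auto simp: card_2_iff)
  have "{a, b} - {a} = {b}" "{a, b} - {b} = {a}" using ab by auto
  then have "differential (\<lambda>s. g (the_elem s)) J = eps a {a, b} * g b + eps b {a, b} * g a"
    using ab by (simp add: differential_def)
  moreover have "g a = g b" using g J ab by (auto simp: locally_constant_def)
  ultimately show "differential (\<lambda>s. g (the_elem s)) J = 0" using eps_pair[OF ab(2)] by simp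
qed

abbreviation vertex_values :: "(nat set \<Rightarrow> nat set \<Rightarrow> int) \<Rightarrow> nat set \<Rightarrow> nat \<Rightarrow> int" where
  "vertex_values F \<equiv> \<lambda>I x. F I {x}"

lemma class_family_0_eq_iff:
  assumes "F \<in> cochain_families 0 l" "G \<in> cochain_families 0 l"
  shows "class_family 0 l F = class_family 0 l G \<longleftrightarrow>
    (\<forall>I\<in>vertex_sets m l. \<exists>c. \<forall>x\<in>I. F I {x} = G I {x} + c)"
  unfolding class_family_eq_iff[OF assms]
proof (intro ball_cong refl)
  fix I assume "I \<in> vertex_sets m l"
  then have I: "I \<subseteq> V" by (simp add: vertex_sets_def)
  have "(\<exists>c. \<forall>s\<in>simplices 0 (KI I). F I s = G I s + differential c s) \<longleftrightarrow>
      (\<exists>c :: nat set \<Rightarrow> int. \<forall>x\<in>I. F I {x} = G I {x} + c {})"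
    unfolding simplices_0[OF I] by simp
  also have "\<dots> \<longleftrightarrow> (\<exists>c. \<forall>x\<in>I. F I {x} = G I {x} + c)"
  proof
    assume "\<exists>c. \<forall>x\<in>I. F I {x} = G I {x} + c"
    then obtain c where "\<forall>x\<in>I. F I {x} = G I {x} + c" by blast
    then show "\<exists>c :: nat set \<Rightarrow> int. \<forall>x\<in>I. F I {x} = G I {x} + c {}"
      by (intro exI[of _ "\<lambda>_. c"]) simp
  qed blast
  finally show "(\<exists>c. \<forall>s\<in>simplices 0 (KI I). F I s = G I s + differential c s) \<longleftrightarrow>
      (\<exists>c. \<forall>x\<in>I. F I {x} = G I {x} + c)" .
qed

lemma lifted_dprime_vertex_values:
  "J \<subseteq> V \<Longrightarrow> x \<in> J \<Longrightarrow> lifted_dprime 0 F J {x} = koszul V (vertex_values F) J x"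
  by (simp add: lifted_dprime_def simplices_0 koszul_def)

lemma zero_family: "(\<lambda>I. \<lambda>s\<in>simplices p (KI I). 0) \<in> cochain_families p l"
  unfolding cochain_families_def
  by (intro CollectI ballI restrict_cocycle[OF down_closed_KI]) (simp add: differential_def)

lemma vertex_sets_finite: "I \<in> vertex_sets m l \<Longrightarrow> I \<subseteq> V \<and> finite I \<and> card I = nat l"
  using finite_subset[of I V] by (auto simp: vertex_sets_def)

lemma dprime_0_eq_one_iff:
  assumes F: "F \<in> cochain_families 0 l"
  shows "dprime m K (l - 1) l (class_family 0 l F) = \<one>\<^bsub>bigraded_cohomology m K (l - 2) (l - 1)\<^esub> \<longleftrightarrow>
    (\<forall>J\<in>vertex_sets m (l - 1). \<exists>c. \<forall>x\<in>J. koszul V (vertex_values F) J x = c)"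
proof -
  have "dprime m K (l - 1) l (class_family 0 l F) = class_family 0 (l - 1) (lifted_dprime 0 F)"
    using dprime_class_family[of F l "l - 1"] F by simp
  moreover have "\<one>\<^bsub>bigraded_cohomology m K (l - 2) (l - 1)\<^esub> =
      class_family 0 (l - 1) (\<lambda>I. \<lambda>s\<in>simplices 0 (KI I). 0)"
    using one_bigraded[of "l - 2" "l - 1"] by simp
  moreover have "class_family 0 (l - 1) (lifted_dprime 0 F) =
      class_family 0 (l - 1) (\<lambda>I. \<lambda>s\<in>simplices 0 (KI I). 0) \<longleftrightarrow>
    (\<forall>J\<in>vertex_sets m (l - 1). \<exists>c. \<forall>x\<in>J. koszul V (vertex_values F) J x = c)"
    unfolding class_family_0_eq_iff[OF lifted_dprime_families[OF F] zero_family]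
    using vertex_sets_finite
    by (intro ball_cong refl ex_cong1) (simp add: lifted_dprime_vertex_values simplices_0)
  ultimately show ?thesis by simp
qed

lemma carrier_bigraded_0:
  "carrier (bigraded_cohomology m K (l - 1) l) = class_family 0 l ` cochain_families 0 l"
  using carrier_bigraded[of "l - 1" l] by simp

lemma cochain_families_0_locally_constant:
  assumes "F \<in> cochain_families 0 l" "I \<in> vertex_sets m l"
  shows "locally_constant K I (vertex_values F I)"
  using cocycle_locally_constant assms by (simp add: cochain_families_def)

text \<open>Exactness of the complex of locally constant functions, carried over to cohomology classes.\<close>

lemma exact_imp_in_dprime_image:
  assumes sv: "simplicial_vertex V K v N u" and l: "l \<ge> 2"
    and F: "F \<in> cochain_families 0 l"
    and closed: "\<forall>J\<in>vertex_sets m (l - 1). \<exists>c. \<forall>x\<in>J. koszul V (vertex_values F) J x = c"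
    and pairs: "l = 2 \<Longrightarrow> pair_sum V (vertex_values F) = 0"
  shows "class_family 0 l F \<in> dprime m K l (l + 1) ` carrier (bigraded_cohomology m K l (l + 1))"
proof -
  interpret simplicial_vertex V K v N u by (rule sv)
  have vs: "I \<in> vertex_sets m l \<longleftrightarrow> I \<subseteq> V \<and> card I = nat l" for I
    using l by (auto simp: vertex_sets_def)
  have vs1: "J \<in> vertex_sets m (l - 1) \<longleftrightarrow> J \<subseteq> V \<and> card J = nat l - 1" for J
    using l by (auto simp: vertex_sets_def)
  have vs2: "I \<in> vertex_sets m (l + 1) \<longleftrightarrow> I \<subseteq> V \<and> card I = Suc (nat l)" for I
    using l by (auto simp: vertex_sets_def)
  obtain h where h: "\<And>I. I \<subseteq> V \<Longrightarrow> card I = Suc (nat l) \<Longrightarrow> locally_constant K I (h I)"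
    and eq: "\<And>I x y. I \<subseteq> V \<Longrightarrow> card I = nat l \<Longrightarrow> x \<in> I \<Longrightarrow> y \<in> I \<Longrightarrow>
      vertex_values F I x - koszul V h I x = vertex_values F I y - koszul V h I y"
  proof (rule koszul_exact[of "nat l" "vertex_values F"])
    show "2 \<le> nat l" using l by simp
    show "locally_constant K I (vertex_values F I)" if "I \<subseteq> V" "card I = nat l" for I
      by (rule cochain_families_0_locally_constant[OF F]) (simp only: vs that simp_thms)
    show "koszul V (vertex_values F) J x = koszul V (vertex_values F) J y"
      if "J \<subseteq> V" "card J = nat l - 1" "x \<in> J" "y \<in> J" for J x y
      using closed that vs1[of J] by metis
    show "pair_sum V (vertex_values F) = 0" if "nat l = 2" using pairs that by simp
  qed (rule that)
  let ?H = "\<lambda>I. cocycle_of I (h I)"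
  have H: "?H \<in> cochain_families 0 (l + 1)"
    unfolding cochain_families_def using h vs2 by (intro CollectI ballI cocycle_of_in) blast
  have d: "dprime m K l (l + 1) (class_family 0 (l + 1) ?H) = class_family 0 l (lifted_dprime 0 ?H)"
    using dprime_class_family[of ?H "l + 1" l] H by simp
  have D: "lifted_dprime 0 ?H \<in> cochain_families 0 l"
    using lifted_dprime_families[OF H] by simp
  have "class_family 0 l F = class_family 0 l (lifted_dprime 0 ?H)"
    unfolding class_family_0_eq_iff[OF F D]
  proof
    fix I assume I: "I \<in> vertex_sets m l"
    then have IV: "I \<subseteq> V" "card I = nat l" using vs by auto
    have k: "lifted_dprime 0 ?H I {x} = koszul V h I x" if x: "x \<in> I" for x
      unfolding lifted_dprime_vertex_values[OF IV(1) x] koszul_def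
    proof (intro arg_cong[of _ _ uminus] sum.cong refl)
      fix i assume "i \<in> V - I"
      then show "eps i (insert i I) * ?H (insert i I) {x} = eps i (insert i I) * h (insert i I) x"
        using x IV cocycle_of_apply[of "insert i I" x] by simp
    qed
    show "\<exists>c. \<forall>x\<in>I. F I {x} = lifted_dprime 0 ?H I {x} + c"
    proof (cases "I = {}")
      case False
      then obtain y where y: "y \<in> I" by blast
      have "F I {x} = lifted_dprime 0 ?H I {x} + (F I {y} - koszul V h I y)" if x: "x \<in> I" for x
        using eq[OF IV x y] k[OF x] by simp
      then show ?thesis by blast
    qed simp
  qed
  then have "class_family 0 l F = dprime m K l (l + 1) (class_family 0 (l + 1) ?H)"
    by (simp only: d)
  moreover have "class_family 0 (l + 1) ?H \<in> carrier (bigraded_cohomology m K l (l + 1))"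
    using carrier_bigraded_0[of "l + 1"] H by simp
  ultimately show ?thesis by (rule image_eqI)
qed

lemma dprime_image_closed:
  assumes H: "H \<in> cochain_families 0 (l + 1)" and J: "J \<subseteq> V" "x \<in> J"
  shows "koszul V (vertex_values (lifted_dprime 0 H)) J x = 0"
proof -
  have "koszul V (vertex_values (lifted_dprime 0 H)) J x = koszul V (koszul V (vertex_values H)) J x"
    unfolding koszul_def[of V _ J x] using J
    by (intro arg_cong[of _ _ uminus] sum.cong refl) (simp add: lifted_dprime_vertex_values)
  also have "\<dots> = 0"
    by (rule koszul_koszul) (use J finite_subset[of J V] in auto)
  finally show ?thesis .
qed

lemma dprime_image_0:
  "dprime m K l (l + 1) ` carrier (bigraded_cohomology m K l (l + 1)) =
    class_family 0 l ` lifted_dprime 0 ` cochain_families 0 (l + 1)"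
proof -
  have "dprime m K l (l + 1) (class_family 0 (l + 1) H) = class_family 0 l (lifted_dprime 0 H)"
    if "H \<in> cochain_families 0 (l + 1)" for H
    using dprime_class_family[of H "l + 1" l] that by simp
  then show ?thesis
    using carrier_bigraded_0[of "l + 1"] by (simp add: image_image cong: image_cong)
qed

proposition double_cohomology_diagonal_trivial:
  assumes sv: "simplicial_vertex V K v N u" and l: "l \<ge> 3"
  shows "trivial_group (double_cohomology m K (l - 1) l)"
  unfolding double_cohomology_def
proof (rule cohomology_at_trivial[OF group_bigraded group_bigraded dprime_hom])
  have s: "l - 1 + 1 = l" "l - 1 - 1 = l - 2" by simp_all
  let ?B = "bigraded_cohomology m K (l - 1) l" let ?C = "bigraded_cohomology m K (l - 1 - 1) (l - 1)"
  show "dprime m K (l - 1 + 1) (l + 1) ` carrier (bigraded_cohomology m K (l - 1 + 1) (l + 1)) =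
      kernel ?B ?C (dprime m K (l - 1) l)"
    unfolding s
  proof (intro equalityI subsetI)
    fix x assume "x \<in> dprime m K l (l + 1) ` carrier (bigraded_cohomology m K l (l + 1))"
    then obtain H where H: "H \<in> cochain_families 0 (l + 1)" "x = class_family 0 l (lifted_dprime 0 H)"
      unfolding dprime_image_0 by blast
    have D: "lifted_dprime 0 H \<in> cochain_families 0 l" using lifted_dprime_families[OF H(1)] by simp
    have "dprime m K (l - 1) l x = \<one>\<^bsub>bigraded_cohomology m K (l - 2) (l - 1)\<^esub>"
      unfolding H(2) dprime_0_eq_one_iff[OF D]
      using dprime_image_closed[OF H(1)] vertex_sets_finite by metis
    then show "x \<in> kernel ?B (bigraded_cohomology m K (l - 2) (l - 1)) (dprime m K (l - 1) l)"
      unfolding kernel_def carrier_bigraded_0 using D H(2) by blast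
  next
    fix x assume "x \<in> kernel ?B (bigraded_cohomology m K (l - 2) (l - 1)) (dprime m K (l - 1) l)"
    then obtain F where F: "F \<in> cochain_families 0 l" "x = class_family 0 l F"
      and one: "dprime m K (l - 1) l (class_family 0 l F) = \<one>\<^bsub>bigraded_cohomology m K (l - 2) (l - 1)\<^esub>"
      unfolding kernel_def carrier_bigraded_0 by blast
    show "x \<in> dprime m K l (l + 1) ` carrier (bigraded_cohomology m K l (l + 1))"
      unfolding F(2)
      by (rule exact_imp_in_dprime_image[OF sv _ F(1) iffD1[OF dprime_0_eq_one_iff[OF F(1)] one]]) (use l in auto)
  qed
qed

end

context vertex_complex
begin

text \<open>The chosen cocycle is determined only up to a constant, which \<open>pair_sum\<close> does not see.\<close>

definition pair_invariant :: "(nat set \<Rightarrow> (nat set \<Rightarrow> int) set) \<Rightarrow> int" where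
  "pair_invariant x = pair_sum V (\<lambda>I y. (SOME f. f \<in> x I) {y})"

lemma pair_invariant_class_family:
  assumes F: "F \<in> cochain_families 0 2"
  shows "pair_invariant (class_family 0 2 F) = pair_sum V (vertex_values F)"
  unfolding pair_invariant_def
proof (rule pair_sum_mod_constants)
  fix I assume I: "I \<subseteq> V" "card I = 2"
  then have vs: "I \<in> vertex_sets m 2" by (simp add: vertex_sets_def)
  let ?f = "SOME f. f \<in> class_family 0 2 F I"
  have cl: "class_family 0 2 F I = coclass 0 (KI I) (F I)" using vs by (simp add: class_family_def)
  have FI: "F I \<in> cocycles 0 (KI I)" using F vs by (simp add: cochain_families_def)
  have "?f \<in> coclass 0 (KI I) (F I)"
    unfolding cl by (rule someI_ex[of "\<lambda>f. f \<in> coclass 0 (KI I) (F I)"]) (use self_in_coclass[OF down_closed_KI FI] in blast)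
  then obtain b where b: "b \<in> coboundaries 0 (KI I)" "?f = (\<lambda>s\<in>simplices 0 (KI I). b s + F I s)"
    unfolding mem_coclass by blast
  obtain c where c: "b = (\<lambda>J\<in>simplices 0 (KI I). differential c J)"
    using b(1) coboundaries_iff[OF down_closed_KI] by blast
  have "?f {x} = F I {x} + c {}" if x: "x \<in> I" for x
  proof -
    have "{x} \<in> simplices 0 (KI I)" using x I by (simp add: simplices_0)
    then show ?thesis unfolding b(2) c by simp
  qed
  then show "\<exists>c. \<forall>x\<in>I. ?f {x} = vertex_values F I x + c" by blast
qed simp

lemma trivial_of_no_simplices:
  assumes "down_closed L" "simplices p L = {}"
  shows "trivial_group (reduced_cohomology p L)"
  using assms by (intro trivial_reduced_cohomology) auto

lemma trivial_low_vertices: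
  assumes I: "I \<subseteq> V" "card I \<le> 1"
  shows "trivial_group (reduced_cohomology 0 (KI I))"
proof (rule trivial_reduced_cohomology[OF down_closed_KI])
  fix f :: "nat set \<Rightarrow> int"
  have fin: "finite I" using I finite_subset by blast
  have "f s = differential (\<lambda>_. f I) s" if s: "s \<in> simplices 0 (KI I)" for s
  proof -
    obtain x where x: "x \<in> I" "s = {x}" using s unfolding simplices_0[OF I(1)] by blast
    then have "card I > 0" using fin by (auto simp: card_gt_0_iff)
    then have "card I = 1" using I by simp
    then have "I = {x}" using x by (auto simp: card_1_singleton_iff)
    then show ?thesis using x by simp
  qed
  then show "\<exists>c. \<forall>s\<in>simplices 0 (KI I). f s = differential c s" by blast
qed

lemma trivial_minus1:
  assumes I: "I \<subseteq> V" "I \<noteq> {}"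
  shows "trivial_group (reduced_cohomology (- 1) (KI I))"
proof (rule trivial_reduced_cohomology[OF down_closed_KI])
  fix f :: "nat set \<Rightarrow> int"
  assume f: "\<And>J. J \<in> simplices (- 1 + 1) (KI I) \<Longrightarrow> differential f J = 0"
  obtain x where "x \<in> I" using I by blast
  then have "{x} \<in> simplices (- 1 + 1) (KI I)" using I by (simp add: simplices_0)
  then have "f {} = 0" using f by force
  then have "f s = differential f s" if "s \<in> simplices (- 1) (KI I)" for s
    using simplices_minus1[OF down_closed_KI that] by simp
  then show "\<exists>c. \<forall>s\<in>simplices (- 1) (KI I). f s = differential c s" by blast
qed

text \<open>All families on two-element sets are cocycles, because the groups for one-element sets vanish. So the
double cohomology is the quotient by the image of \<open>d'\<close>, and by exactness \<open>pair_sum\<close> identifies it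
with the integers. A generator is the indicator function of \<open>v\<close> on the non-edge \<open>{u, v}\<close>.\<close>

proposition double_cohomology_pairs:
  assumes sv: "simplicial_vertex V K v N u"
  shows "double_cohomology m K 1 2 \<cong> integer_group"
proof -
  interpret simplicial_vertex V K v N u by (rule sv)
  let ?A = "bigraded_cohomology m K 2 3" let ?B = "bigraded_cohomology m K 1 2"
  let ?C = "bigraded_cohomology m K 0 1" let ?d = "dprime m K 1 2"
  have carrB: "carrier ?B = class_family 0 2 ` cochain_families 0 2"
    using carrier_bigraded_0[of 2] by simp
  have C: "carrier ?C = {\<one>\<^bsub>?C\<^esub>}"
  proof (rule trivial_bigraded)
    fix I assume "I \<in> vertex_sets m 1"
    then show "trivial_group (reduced_cohomology (1 - 0 - 1) (KI I))"
      using trivial_low_vertices[of I] by (auto simp: vertex_sets_def)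
  qed
  have dhom: "?d \<in> hom ?B ?C" using dprime_hom[of 1 2] by simp
  have ker: "kernel ?B ?C ?d = carrier ?B"
  proof -
    have "?d x = \<one>\<^bsub>?C\<^esub>" if "x \<in> carrier ?B" for x
    proof -
      have "?d x \<in> carrier ?C" using dhom that by (rule hom_in_carrier)
      then show ?thesis unfolding C by simp
    qed
    then show ?thesis unfolding kernel_def by blast
  qed
  have image: "dprime m K 2 3 ` carrier ?A = class_family 0 2 ` lifted_dprime 0 ` cochain_families 0 3"
    using dprime_image_0[of 2] by simp
  have closed: "\<forall>J\<in>vertex_sets m (2 - 1). \<exists>c. \<forall>x\<in>J. koszul V (vertex_values F) J x = c" for F
  proof
    fix J assume "J \<in> vertex_sets m (2 - 1)"
    then have "card J = 1" by (simp add: vertex_sets_def)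
    then show "\<exists>c. \<forall>x\<in>J. koszul V (vertex_values F) J x = c" by (auto simp: card_1_singleton_iff)
  qed
  have "cohomology_at ?A (dprime m K 2 3) ?B ?d ?C \<cong> integer_group"
  proof (rule cohomology_at_iso[OF group_bigraded group_bigraded dhom group_integer_group, where \<phi> = pair_invariant])
    show "pair_invariant \<in> hom (?B\<lparr>carrier := kernel ?B ?C ?d\<rparr>) integer_group"
    proof (rule homI)
      fix x y assume "x \<in> carrier (?B\<lparr>carrier := kernel ?B ?C ?d\<rparr>)" "y \<in> carrier (?B\<lparr>carrier := kernel ?B ?C ?d\<rparr>)"
      then obtain F G where F: "F \<in> cochain_families 0 2" "x = class_family 0 2 F"
        and G: "G \<in> cochain_families 0 2" "y = class_family 0 2 G"
        by (auto simp: ker carrB)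
      let ?S = "\<lambda>I. \<lambda>s\<in>simplices 0 (KI I). F I s + G I s"
      have S: "?S \<in> cochain_families 0 2"
        using F(1) G(1) unfolding cochain_families_def by (intro CollectI ballI add_cocycles[OF down_closed_KI]) auto
      have "x \<otimes>\<^bsub>?B\<^esub> y = class_family 0 2 ?S"
        using mult_bigraded[of F 2 1 G] F G by simp
      moreover have "pair_sum V (vertex_values ?S) = pair_sum V (\<lambda>I x. F I {x} + G I {x})"
        by (rule pair_sum_mod_constants) (auto simp: simplices_0 intro!: exI[of _ 0])
      moreover have "pair_sum V (\<lambda>I x. F I {x} + G I {x}) = pair_sum V (vertex_values F) + pair_sum V (vertex_values G)"
        by (simp add: pair_sum_def koszul_add sum.distrib)
      ultimately show "pair_invariant (x \<otimes>\<^bsub>?B\<lparr>carrier := kernel ?B ?C ?d\<rparr>\<^esub> y) =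
          pair_invariant x \<otimes>\<^bsub>integer_group\<^esub> pair_invariant y"
        using F G S by (simp add: pair_invariant_class_family)
    qed simp
    show "pair_invariant ` kernel ?B ?C ?d = carrier integer_group"
    proof -
      have "n \<in> pair_invariant ` carrier ?B" for n :: int
      proof -
        let ?n = "- (eps u {u, v} * n)"
        define g where "g = (\<lambda>I x. if I = {u, v} \<and> x = v then ?n else 0)"
        have nonedge: "{u, v} \<notin> K" "{v, u} \<notin> K" using nbr[of u] u by (auto simp: insert_commute)
        have lc: "locally_constant K I (g I)" for I
          unfolding locally_constant_def g_def using nonedge by (auto split: if_splits)
        let ?G = "\<lambda>I. cocycle_of I (g I)"
        have G: "?G \<in> cochain_families 0 2"
          unfolding cochain_families_def by (intro CollectI ballI cocycle_of_in lc)
        have "pair_sum V (vertex_values ?G) = pair_sum V g"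
          by (rule pair_sum_mod_constants) (auto simp: cocycle_of_apply intro!: exI[of _ 0])
        also have "\<dots> = (\<Sum>j\<in>{v}. koszul V g {j} j)"
          unfolding pair_sum_def using finV v
          by (intro sum.mono_neutral_right) (auto simp: g_def koszul_def)
        also have "(\<Sum>j\<in>{v}. koszul V g {j} j) = koszul V g {v} v" by simp
        also have "koszul V g {v} v = - (eps u (insert u {v}) * g (insert u {v}) v)"
          using finV u by (intro koszul_single) (auto simp: g_def doubleton_eq_iff)
        also have "g (insert u {v}) v = ?n" by (simp add: g_def)
        finally have "pair_sum V (vertex_values ?G) = n" by (simp flip: mult.assoc)
        then have "pair_invariant (class_family 0 2 ?G) = n"
          using pair_invariant_class_family[OF G] by simp
        then show ?thesis using G unfolding carrB by blast
      qed
      then show ?thesis unfolding ker by auto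
    qed
    show "dprime m K 2 3 ` carrier ?A = {x \<in> kernel ?B ?C ?d. pair_invariant x = \<one>\<^bsub>integer_group\<^esub>}"
      unfolding ker one_integer_group
    proof (intro equalityI subsetI)
      fix x assume "x \<in> dprime m K 2 3 ` carrier ?A"
      then obtain H where H: "H \<in> cochain_families 0 3" "x = class_family 0 2 (lifted_dprime 0 H)"
        unfolding image by blast
      have D: "lifted_dprime 0 H \<in> cochain_families 0 2" using lifted_dprime_families[OF H(1)] by simp
      have "pair_sum V (vertex_values (lifted_dprime 0 H)) = 0"
        unfolding pair_sum_def using dprime_image_closed[of H 2] H(1) by (intro sum.neutral) auto
      then have "pair_invariant x = 0"
        unfolding H(2) pair_invariant_class_family[OF D] .
      moreover have "x \<in> carrier ?B" unfolding H(2) carrB by (rule imageI[OF D])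
      ultimately show "x \<in> {x \<in> carrier ?B. pair_invariant x = 0}" by (intro CollectI conjI)
    next
      fix x assume "x \<in> {x \<in> carrier ?B. pair_invariant x = 0}"
      then obtain F where F: "F \<in> cochain_families 0 2" "x = class_family 0 2 F" "pair_invariant x = 0"
        unfolding carrB by blast
      have "class_family 0 2 F \<in> dprime m K 2 (2 + 1) ` carrier (bigraded_cohomology m K 2 (2 + 1))"
      proof (rule exact_imp_in_dprime_image[OF sv _ F(1) closed])
        show "pair_sum V (vertex_values F) = 0"
          using F(3) pair_invariant_class_family[OF F(1)] unfolding F(2) by simp
      qed simp
      then show "x \<in> dprime m K 2 3 ` carrier ?A" unfolding F(2) by simp
    qed
  qed
  then show ?thesis by (simp add: double_cohomology_def)
qed

definition origin_invariant :: "(nat set \<Rightarrow> (nat set \<Rightarrow> int) set) \<Rightarrow> int" where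
  "origin_invariant x = (SOME f. f \<in> x {}) {}"

text \<open>The only vertex set of size \<open>0\<close> is empty, where a class in degree \<open>-1\<close> is one integer, and the
groups of both neighbouring bidegrees vanish.\<close>

proposition double_cohomology_origin:
  "double_cohomology m K 0 0 \<cong> integer_group"
proof -
  let ?A = "bigraded_cohomology m K 1 1" let ?B = "bigraded_cohomology m K 0 0"
  let ?C = "bigraded_cohomology m K (- 1) (- 1)" let ?d = "dprime m K 0 0"
  have empty: "{} \<in> vertex_sets m 0" "I \<in> vertex_sets m 0 \<Longrightarrow> I = {}" for I
    using finite_subset[of I V] by (auto simp: vertex_sets_def)
  have carrB: "carrier ?B = class_family (- 1) 0 ` cochain_families (- 1) 0"
    using carrier_bigraded[of 0 0] by simp
  have dhom: "?d \<in> hom ?B ?C" using dprime_hom[of 0 0] by simp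
  have C: "carrier ?C = {\<one>\<^bsub>?C\<^esub>}"
    by (rule trivial_bigraded) (simp add: vertex_sets_def)
  have ker: "kernel ?B ?C ?d = carrier ?B"
  proof -
    have "?d x = \<one>\<^bsub>?C\<^esub>" if "x \<in> carrier ?B" for x
    proof -
      have "?d x \<in> carrier ?C" using dhom that by (rule hom_in_carrier)
      then show ?thesis unfolding C by simp
    qed
    then show ?thesis unfolding kernel_def by blast
  qed
  have A: "carrier ?A = {\<one>\<^bsub>?A\<^esub>}"
  proof (rule trivial_bigraded)
    fix I assume "I \<in> vertex_sets m 1"
    then have "I \<subseteq> V" "card I = 1" by (simp_all add: vertex_sets_def)
    then have "I \<subseteq> V" "I \<noteq> {}" by auto
    then have "trivial_group (reduced_cohomology (- 1) (KI I))" by (rule trivial_minus1)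
    then show "trivial_group (reduced_cohomology (1 - 1 - 1) (KI I))" by simp
  qed
  have image: "dprime m K 1 1 ` carrier ?A = {\<one>\<^bsub>?B\<^esub>}"
    unfolding A using hom_one[OF _ group_bigraded group_bigraded] dprime_hom[of 1 1] by simp
  have s: "{} \<in> simplices (- 1) (KI {})"
    using K by (simp add: simplices_def full_subcomplex_def abstract_complex_def)
  have \<phi>: "origin_invariant (class_family (- 1) 0 F) = F {} {}" if F: "F \<in> cochain_families (- 1) 0" for F
  proof -
    let ?f = "SOME f. f \<in> coclass (- 1) (KI {}) (F {})"
    have "F {} \<in> cocycles (- 1) (KI {})" using F empty by (simp add: cochain_families_def)
    then have "?f \<in> coclass (- 1) (KI {}) (F {})"
      by (intro someI_ex[of "\<lambda>f. f \<in> coclass (- 1) (KI {}) (F {})"]) (use self_in_coclass[OF down_closed_KI] in blast)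
    then obtain b where b: "b \<in> coboundaries (- 1) (KI {})" "?f = (\<lambda>s\<in>simplices (- 1) (KI {}). b s + F {} s)"
      unfolding mem_coclass by blast
    obtain c where "b = (\<lambda>J\<in>simplices (- 1) (KI {}). differential c J)"
      using b(1) coboundaries_iff[OF down_closed_KI] by blast
    then have "?f {} = F {} {}" using s unfolding b(2) by simp
    then show ?thesis using empty by (simp add: origin_invariant_def class_family_def)
  qed
  have eq: "class_family (- 1) 0 F = class_family (- 1) 0 G \<longleftrightarrow> F {} {} = G {} {}"
    if "F \<in> cochain_families (- 1) 0" "G \<in> cochain_families (- 1) 0" for F G
  proof -
    have "simplices (- 1) (KI {}) = {{}}" using s simplices_minus1[OF down_closed_KI] by blast
    moreover have "vertex_sets m 0 = {{}}" using empty by blast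
    ultimately show ?thesis unfolding class_family_eq_iff[OF that] by simp
  qed
  have one: "\<one>\<^bsub>?B\<^esub> = class_family (- 1) 0 (\<lambda>I. \<lambda>s\<in>simplices (- 1) (KI I). 0)"
    using one_bigraded[of 0 0] by simp
  have "cohomology_at ?A (dprime m K 1 1) ?B ?d ?C \<cong> integer_group"
  proof (rule cohomology_at_iso[OF group_bigraded group_bigraded dhom group_integer_group, where \<phi> = origin_invariant])
    show "origin_invariant \<in> hom (?B\<lparr>carrier := kernel ?B ?C ?d\<rparr>) integer_group"
    proof (rule homI)
      fix x y assume "x \<in> carrier (?B\<lparr>carrier := kernel ?B ?C ?d\<rparr>)" "y \<in> carrier (?B\<lparr>carrier := kernel ?B ?C ?d\<rparr>)"
      then obtain F G where F: "F \<in> cochain_families (- 1) 0" "x = class_family (- 1) 0 F"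
        and G: "G \<in> cochain_families (- 1) 0" "y = class_family (- 1) 0 G"
        by (auto simp: ker carrB)
      let ?S = "\<lambda>I. \<lambda>s\<in>simplices (- 1) (KI I). F I s + G I s"
      have S: "?S \<in> cochain_families (- 1) 0"
        using F(1) G(1) unfolding cochain_families_def by (intro CollectI ballI add_cocycles[OF down_closed_KI]) auto
      have "x \<otimes>\<^bsub>?B\<^esub> y = class_family (- 1) 0 ?S"
        using mult_bigraded[of F 0 0 G] F G by simp
      then have xy: "x \<otimes>\<^bsub>?B\<lparr>carrier := kernel ?B ?C ?d\<rparr>\<^esub> y = class_family (- 1) 0 ?S" by simp
      show "origin_invariant (x \<otimes>\<^bsub>?B\<lparr>carrier := kernel ?B ?C ?d\<rparr>\<^esub> y) = origin_invariant x \<otimes>\<^bsub>integer_group\<^esub> origin_invariant y"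
      proof -
        have "origin_invariant (class_family (- 1) 0 ?S) = F {} {} + G {} {}" unfolding \<phi>[OF S] using s by simp
        moreover have "origin_invariant x = F {} {}" unfolding F(2) by (rule \<phi>[OF F(1)])
        moreover have "origin_invariant y = G {} {}" unfolding G(2) by (rule \<phi>[OF G(1)])
        ultimately show ?thesis unfolding xy mult_integer_group by (simp only:)
      qed
    qed simp
    show "origin_invariant ` kernel ?B ?C ?d = carrier integer_group"
    proof -
      have "n \<in> origin_invariant ` carrier ?B" for n :: int
      proof -
        let ?G = "\<lambda>I. \<lambda>s\<in>simplices (- 1) (KI I). n"
        have G: "?G \<in> cochain_families (- 1) 0"
          unfolding cochain_families_def
        proof (intro CollectI ballI restrict_cocycle[OF down_closed_KI])
          fix I J assume "I \<in> vertex_sets m 0" "J \<in> simplices (- 1 + 1) (KI I)"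
          then have "J \<subseteq> {}" "card J = 1" using empty(2) by (auto simp: simplices_def full_subcomplex_def)
          then show "differential (\<lambda>_. n) J = 0" by simp
        qed
        have val: "origin_invariant (class_family (- 1) 0 ?G) = n" unfolding \<phi>[OF G] using s by simp
        have "class_family (- 1) 0 ?G \<in> carrier ?B" unfolding carrB by (rule imageI[OF G])
        then have "origin_invariant (class_family (- 1) 0 ?G) \<in> origin_invariant ` carrier ?B"
          by (rule imageI)
        then show ?thesis unfolding val .
      qed
      then show ?thesis unfolding ker by auto
    qed
    show "dprime m K 1 1 ` carrier ?A = {x \<in> kernel ?B ?C ?d. origin_invariant x = \<one>\<^bsub>integer_group\<^esub>}"
      unfolding ker image one_integer_group
    proof (intro equalityI subsetI)
      fix x assume "x \<in> {\<one>\<^bsub>?B\<^esub>}"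
      then have "x = class_family (- 1) 0 (\<lambda>I. \<lambda>s\<in>simplices (- 1) (KI I). 0)" using one by simp
      moreover have "origin_invariant (class_family (- 1) 0 (\<lambda>I. \<lambda>s\<in>simplices (- 1) (KI I). 0)) = 0"
        unfolding \<phi>[OF zero_family] using s by simp
      moreover have "x \<in> carrier ?B"
        unfolding carrB \<open>x = class_family (- 1) 0 _\<close> by (rule imageI[OF zero_family])
      ultimately show "x \<in> {x \<in> carrier ?B. origin_invariant x = 0}" by (intro CollectI conjI) simp_all
    next
      fix x assume "x \<in> {x \<in> carrier ?B. origin_invariant x = 0}"
      then obtain F where F: "F \<in> cochain_families (- 1) 0" "x = class_family (- 1) 0 F" "origin_invariant x = 0"
        unfolding carrB by blast
      then have "F {} {} = 0" using \<phi>[OF F(1)] by simp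
      then have "x = \<one>\<^bsub>?B\<^esub>" unfolding F(2) one eq[OF F(1) zero_family] using s by simp
      then show "x \<in> {\<one>\<^bsub>?B\<^esub>}" by simp
    qed
  qed
  then show ?thesis by (simp add: double_cohomology_def)
qed

text \<open>The sum of \<open>k\<close> and the cohomological degree is \<open>l - 1\<close>; the cases are sorted by that degree.\<close>

theorem double_cohomology_attachment:
  assumes att: "iterated_simplex_attachment K" and sv: "simplicial_vertex V K v N u"
  shows "if (k, l) = (0, 0) \<or> (k, l) = (1, 2)
         then double_cohomology m K k l \<cong> integer_group
         else trivial_group (double_cohomology m K k l)"
proof -
  have triv: "trivial_group (double_cohomology m K k l)"
    if "\<And>I. I \<in> vertex_sets m l \<Longrightarrow> trivial_group (reduced_cohomology (l - k - 1) (KI I))"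
    by (rule double_cohomology_trivialI[OF trivial_bigraded[OF that]])
  consider "l - k - 1 \<ge> 1" | "l - k - 1 \<le> - 2" | "l - k - 1 = - 1" "l \<noteq> 0" | "k = 0" "l = 0"
    | "l - k - 1 = 0" "l \<le> 1" | "k = 1" "l = 2" | "k = l - 1" "l \<ge> 3"
    by linarith
  then show ?thesis
  proof cases
    case 1
    have "trivial_group (reduced_cohomology (l - k - 1) (KI I))" for I
      using iterated_attachment_full_subcomplex[OF att, of I]
    proof
      assume "KI I = {{}}"
      then show ?thesis
        using 1 by (intro trivial_of_no_simplices[OF down_closed_KI]) (auto simp: simplices_def)
    next
      assume "iterated_simplex_attachment (KI I)"
      then show ?thesis
        using attachment_acyclic[OF _ 1] by (intro trivial_reduced_cohomology[OF down_closed_KI]) blast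
    qed
    then show ?thesis using triv 1 by auto
  next
    case 2
    then have "trivial_group (reduced_cohomology (l - k - 1) (KI I))" for I
      by (intro trivial_of_no_simplices[OF down_closed_KI]) (auto simp: simplices_def)
    then show ?thesis using triv 2 by auto
  next
    case 3
    have "trivial_group (reduced_cohomology (l - k - 1) (KI I))" if "I \<in> vertex_sets m l" for I
    proof -
      have "I \<subseteq> V" "int (card I) = l" using that by (simp_all add: vertex_sets_def)
      then have "I \<subseteq> V" "I \<noteq> {}" using 3(2) by auto
      then show ?thesis unfolding 3(1) by (rule trivial_minus1)
    qed
    then show ?thesis using triv 3 by auto
  next
    case 4
    then show ?thesis using double_cohomology_origin by simp
  next
    case 5
    then have "trivial_group (reduced_cohomology (l - k - 1) (KI I))" if "I \<in> vertex_sets m l" for I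
      using that trivial_low_vertices[of I] by (auto simp: vertex_sets_def)
    then show ?thesis using triv 5 by auto
  next
    case 6
    then show ?thesis using double_cohomology_pairs[OF sv] by simp
  next
    case 7
    then show ?thesis using double_cohomology_diagonal_trivial[OF sv 7(2)] by simp
  qed
qed

end

theorem theorem6p8:
  fixes m :: nat and K :: "nat set set"
  assumes "m \<ge> 1" and "abstract_complex {1..m} K"
  shows
    "((\<forall>I. I \<subseteq> {1..m} \<longrightarrow> homotopy_discrete (geometric_realization (full_subcomplex K I)))
        \<longleftrightarrow> flag_complex {1..m} K \<and> chordal (edges (skeleton 1 K))) \<and>
     (flag_complex {1..m} K \<and> chordal (edges (skeleton 1 K))
        \<longleftrightarrow> iterated_simplex_attachment K) \<and>
     ((\<forall>I. I \<subseteq> {1..m} \<longrightarrow> homotopy_discrete (geometric_realization (full_subcomplex K I))) \<or>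
      (flag_complex {1..m} K \<and> chordal (edges (skeleton 1 K))) \<or>
      iterated_simplex_attachment K
        \<longrightarrow> is_simplex_on {1..m} K \<or>
            (\<forall>k l :: int.
               if (k, l) = (0, 0) \<or> (k, l) = (1, 2)
               then double_cohomology m K k l \<cong> integer_group
               else trivial_group (double_cohomology m K k l)))"
    (is "(?a \<longleftrightarrow> ?b) \<and> (?b \<longleftrightarrow> ?c) \<and> (?a \<or> ?b \<or> ?c \<longrightarrow> ?simplex \<or> ?HH)")
proof -
  note K = assms(2)
  have ab: ?b if ?a using homotopy_discrete_imp_flag_chordal[OF K] that by blast
  have bc: ?c if ?b using flag_chordal_imp_attachment[OF K] assms(1) that by simp
  have ca: ?a if ?c using attachment_imp_homotopy_discrete[OF that] by blast
  have HH: ?HH if b: ?b and "\<not> ?simplex"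
  proof -
    obtain w N u where w: "w \<in> {1..m}" "N \<subseteq> {1..m} - {w}" "insert w N \<in> K"
      "\<forall>J\<in>K. w \<in> J \<longrightarrow> J \<subseteq> insert w N" "u \<in> {1..m}" "u \<noteq> w" "u \<notin> N"
      using flag_chordal_split[OF K _ _ \<open>\<not> ?simplex\<close>] b by blast
    have down: "I \<in> K" if "I \<subseteq> insert w N" for I
      using abstract_complexD(5)[OF K w(3) that] .
    have "simplicial_vertex {1..m} K w N u"
    proof
      show "{w, a} \<in> K \<longleftrightarrow> a \<in> insert w N" for a using w(4) down[of "{w, a}"] by auto
      show "{a, b} \<in> K" if "a \<in> N" "b \<in> N" for a b using that by (intro down) auto
    qed (use w in auto)
    moreover have "vertex_complex m K" using K by unfold_locales
    ultimately show ?thesis using vertex_complex.double_cohomology_attachment bc[OF b] by blast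
  qed
  show ?thesis using ab bc ca HH by blast
qed

end
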